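(* Let $R$ be an integral domain such that $R/(m)$ is finite for every $m\in R\setminus\{0\}$, let $K$ be its field of fractions, and let $\mathcal{R}$ be the set of relations on $K\rtimes K^\times$ described in the context. The $*$-homomorphism $\Psi:\mathfrak{A}[R]\to C^*_{\mathrm{p}}(K\rtimes K^\times,\mathcal{R})$ determined by $\Psi(u^n)=[n,1]$ for $n\in R$ and $\Psi(s_m)=[0,m]$ for $m\in R^\times$ is a $*$-isomorphism. Its inverse $\Phi: C^*_{\mathrm{p}}(K\rtimes K^\times,\mathcal{R})\to\mathfrak{A}[R]$ is given by $$\Phi\left(\left[\tfrac{n}{m'},\tfrac{m}{m'}\right]\right)=s_{m'}^*u^ns_m\qquad (n\in R,\ m,m'\in R^\times).$$
   Context: An integral domain is a unital commutative ring without zero divisors. $R^\times=R\setminus\{0\}$, $K^\times=K\setminus\{0\}$. The algebra $\mathfrak{A}[R]$ is the universal $C^*$-algebra generated by isometries $\{s_m : m\in R^\times\}$ and unitaries $\{u^n : n\in R\}$ subject to: (CL1) $s_ms_{m'}=s_{mm'}$; (CL2) $u^nu^{n'}=u^{n+n'}$; (CL3) $s_mu^n=u^{mn}s_m$; (CL4) $\sum_{l+(m)\in R/(m)}u^ls_ms_m^*u^{-l}=1$, for all $m,m'\in R^\times$, $n,n'\in R$. (The summands in (CL4) do not depend on the choice of representative $l$.) The group $K\rtimes K^\times$ consists of pairs $(u,w)$, $u\in K$, $w\in K^\times$, with $(u,w)(u',w')=(u+u'w,ww')$ and $(u,w)^{-1}=(-u/w,1/w)$; its identity is $(0,1)$.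 Every element can be written as $\left(\frac{n}{m'},\frac{m}{m'}\right)$ with $n\in R$, $m,m'\in R^\times$. For a discrete group $G$, take a formal symbol $[g]$ for each $g\in G$ (for $g=(u,w)$ write $[u,w]$) and put $e_g=[g][g^{-1}]$. Let $\mathcal{R}_{\mathrm{p}}$ be the relations $[e]=1$, $[g^{-1}]=[g]^*$, $[g][h][h^{-1}]=[gh][h^{-1}]$ for all $g,h\in G$. For a set $\mathcal{R}$ of relations of the form $\sum_i\lambda_i\prod_j e_{g_{ij}}=0$, $C^*_{\mathrm{p}}(G,\mathcal{R})$ is the universal unital $C^*$-algebra generated by $\{[g]:g\in G\}$ subject to $\mathcal{R}_{\mathrm{p}}\cup\mathcal{R}$. Here $G=K\rtimes K^\times$ and $\mathcal{R}=\mathcal{R}_1\cup\mathcal{R}_2\cup\mathcal{R}_3$, where $\mathcal{R}_1=\{e_{(n,1)}=1 : n\in R\}$, $\mathcal{R}_2=\{e_{(0,1/m)}=1 : m\in R^\times\}$, $\mathcal{R}_3=\{\sum_{n+(m)\in R/(m)}e_{(n,m)}=1 : m\in R^\times\}$ (modulo $\mathcal{R}_1$ and $\mathcal{R}_{\mathrm{p}}$, $e_{(n,m)}$ depends only on the class $n+(m)$). *)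

theory Defs
  imports
    Complex_Main
    "HOL-Library.Poly_Mapping"
    "HOL-Computational_Algebra.Fraction_Field"
    "HOL-Algebra.Ring"
begin

section \<open>The free unital $*$-algebra\<close>

datatype 'x letter = Gen 'x | Adj 'x

datatype 'x star_word = Word (letters: "'x letter list")

instantiation star_word :: (type) monoid_add
begin

definition zero_star_word :: "'a star_word" where
  "zero_star_word = Word []"

definition plus_star_word :: "'a star_word \<Rightarrow> 'a star_word \<Rightarrow> 'a star_word" where
  "plus_star_word v w = Word (letters v @ letters w)"

instance
  by standard (auto simp: zero_star_word_def plus_star_word_def)

end

fun adj_letter :: "'x letter \<Rightarrow> 'x letter" where
  "adj_letter (Gen x) = Adj x"
| "adj_letter (Adj x) = Gen x"

definition adj_word :: "'x star_word \<Rightarrow> 'x star_word" where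
  "adj_word w = Word (rev (map adj_letter (letters w)))"

fun letter_gen :: "'x letter \<Rightarrow> 'x" where
  "letter_gen (Gen x) = x"
| "letter_gen (Adj x) = x"

text \<open>
  Words form a monoid under concatenation (written additively, so the empty word is \<open>0\<close>).
  Hence the finitely supported functions from words to the complex numbers, with the convolution
  product of \<open>HOL-Library.Poly_Mapping\<close>, are the noncommutative polynomials in the
  letters \<open>x\<close> and \<open>x\<^sup>*\<close>.
\<close>

type_synonym 'x free_star = "'x star_word \<Rightarrow>\<^sub>0 complex"

definition fgen :: "'x \<Rightarrow> 'x free_star" where
  "fgen x = Poly_Mapping.single (Word [Gen x]) 1"

definition fscale :: "complex \<Rightarrow> 'x free_star \<Rightarrow> 'x free_star" where
  "fscale c p = Poly_Mapping.map ((*) c) p"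

definition fstar :: "'x free_star \<Rightarrow> 'x free_star" where
  "fstar p = Poly_Mapping.map cnj (Poly_Mapping.map_key adj_word p)"

definition free_star_on :: "'x set \<Rightarrow> 'x free_star set" where
  "free_star_on X = {p. \<forall>w\<in>Poly_Mapping.keys p. letter_gen ` set (letters w) \<subseteq> X}"


section \<open>C*-algebras and *-homomorphisms\<close>

record 'a star_algebra = "'a ring" +
  scale :: "complex \<Rightarrow> 'a \<Rightarrow> 'a"
  adj :: "'a \<Rightarrow> 'a"
  cnorm :: "'a \<Rightarrow> real"

locale cstar_algebra = ring A for A :: "('a, 'm) star_algebra_scheme" (structure) +
  assumes scale_closed: "x \<in> carrier A \<Longrightarrow> scale A c x \<in> carrier A"
    and scale_add_right:
      "\<lbrakk>x \<in> carrier A; y \<in> carrier A\<rbrakk> \<Longrightarrow> scale A c (x \<oplus> y) = scale A c x \<oplus> scale A c y"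
    and scale_add_left: "x \<in> carrier A \<Longrightarrow> scale A (c + d) x = scale A c x \<oplus> scale A d x"
    and scale_scale: "x \<in> carrier A \<Longrightarrow> scale A c (scale A d x) = scale A (c * d) x"
    and scale_one: "x \<in> carrier A \<Longrightarrow> scale A 1 x = x"
    and scale_mult_left:
      "\<lbrakk>x \<in> carrier A; y \<in> carrier A\<rbrakk> \<Longrightarrow> scale A c x \<otimes> y = scale A c (x \<otimes> y)"
    and scale_mult_right:
      "\<lbrakk>x \<in> carrier A; y \<in> carrier A\<rbrakk> \<Longrightarrow> x \<otimes> scale A c y = scale A c (x \<otimes> y)"
    and adj_closed: "x \<in> carrier A \<Longrightarrow> adj A x \<in> carrier A"
    and adj_adj: "x \<in> carrier A \<Longrightarrow> adj A (adj A x) = x"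
    and adj_add: "\<lbrakk>x \<in> carrier A; y \<in> carrier A\<rbrakk> \<Longrightarrow> adj A (x \<oplus> y) = adj A x \<oplus> adj A y"
    and adj_mult: "\<lbrakk>x \<in> carrier A; y \<in> carrier A\<rbrakk> \<Longrightarrow> adj A (x \<otimes> y) = adj A y \<otimes> adj A x"
    and adj_scale: "x \<in> carrier A \<Longrightarrow> adj A (scale A c x) = scale A (cnj c) (adj A x)"
    and cnorm_eq_zero: "\<lbrakk>x \<in> carrier A; cnorm A x = 0\<rbrakk> \<Longrightarrow> x = \<zero>"
    and cnorm_triangle:
      "\<lbrakk>x \<in> carrier A; y \<in> carrier A\<rbrakk> \<Longrightarrow> cnorm A (x \<oplus> y) \<le> cnorm A x + cnorm A y"
    and cnorm_scale: "x \<in> carrier A \<Longrightarrow> cnorm A (scale A c x) = cmod c * cnorm A x"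
    and cnorm_mult:
      "\<lbrakk>x \<in> carrier A; y \<in> carrier A\<rbrakk> \<Longrightarrow> cnorm A (x \<otimes> y) \<le> cnorm A x * cnorm A y"
    and cnorm_cstar: "x \<in> carrier A \<Longrightarrow> cnorm A (adj A x \<otimes> x) = (cnorm A x)\<^sup>2"
    and complete:
      "\<lbrakk>\<And>n. f n \<in> carrier A; \<forall>e>0. \<exists>M. \<forall>m\<ge>M. \<forall>n\<ge>M. cnorm A (f m \<ominus> f n) < e\<rbrakk>
        \<Longrightarrow> \<exists>x\<in>carrier A. (\<lambda>n. cnorm A (f (n::nat) \<ominus> x)) \<longlonglongrightarrow> 0"

text \<open>
  Homomorphisms are unital, because \<open>ring_hom\<close> preserves \<open>\<one>\<close>; continuity is
  automatic (theorem \<open>star_hom_contractive\<close> below).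
\<close>

definition star_hom ::
    "('a, 'm) star_algebra_scheme \<Rightarrow> ('b, 'n) star_algebra_scheme \<Rightarrow> ('a \<Rightarrow> 'b) set" where
  "star_hom A B = {h \<in> ring_hom A B.
     (\<forall>c. \<forall>x\<in>carrier A. h (scale A c x) = scale B c (h x)) \<and>
     (\<forall>x\<in>carrier A. h (adj A x) = adj B (h x))}"

definition star_iso ::
    "('a, 'm) star_algebra_scheme \<Rightarrow> ('b, 'n) star_algebra_scheme \<Rightarrow> ('a \<Rightarrow> 'b) set" where
  "star_iso A B = {h \<in> star_hom A B. bij_betw h (carrier A) (carrier B)}"


section \<open>Universal C*-algebras\<close>

text \<open>
  A relation \<open>a = b\<close> between noncommutative $*$-polynomials is encoded as the element
  \<open>a - b\<close>.  The universal unital C*-algebra on generators \<open>X\<close> with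
  relations \<open>Rel\<close> is the separated completion of the free unital $*$-algebra on
  \<open>X\<close> with respect to the largest C*-seminorm that vanishes on \<open>Rel\<close>.
  Nonnegativity of a C*-seminorm, its value \<open>0\<close> at \<open>0\<close> and its invariance
  under the involution follow from the listed conditions.
\<close>

definition cstar_seminorm :: "'x set \<Rightarrow> ('x free_star \<Rightarrow> real) \<Rightarrow> bool" where
  "cstar_seminorm X p \<longleftrightarrow>
     (\<forall>x\<in>free_star_on X. \<forall>y\<in>free_star_on X. p (x + y) \<le> p x + p y) \<and>
     (\<forall>x\<in>free_star_on X. \<forall>y\<in>free_star_on X. p (x * y) \<le> p x * p y) \<and>
     (\<forall>x\<in>free_star_on X. \<forall>c. p (fscale c x) = cmod c * p x) \<and>
     (\<forall>x\<in>free_star_on X. p (fstar x * x) = (p x)\<^sup>2)"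

definition admissible :: "'x set \<Rightarrow> 'x free_star set \<Rightarrow> ('x free_star \<Rightarrow> real) set" where
  "admissible X Rel = {p. cstar_seminorm X p \<and> (\<forall>r\<in>Rel. p r = 0)}"

text \<open>
  The supremum below is meaningful only if it is finite for every polynomial.
\<close>

definition bounded_presentation :: "'x set \<Rightarrow> 'x free_star set \<Rightarrow> bool" where
  "bounded_presentation X Rel \<longleftrightarrow>
     (\<forall>x\<in>free_star_on X. bdd_above ((\<lambda>p. p x) ` admissible X Rel))"

definition univ_norm :: "'x set \<Rightarrow> 'x free_star set \<Rightarrow> 'x free_star \<Rightarrow> real" where
  "univ_norm X Rel x = (SUP p\<in>admissible X Rel. p x)"

definition cauchy_seqs ::
    "'x set \<Rightarrow> ('x free_star \<Rightarrow> real) \<Rightarrow> (nat \<Rightarrow> 'x free_star) set" where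
  "cauchy_seqs X N = {f. (\<forall>n. f n \<in> free_star_on X) \<and>
     (\<forall>e>0. \<exists>M. \<forall>m\<ge>M. \<forall>n\<ge>M. N (f m - f n) < e)}"

definition null_rel ::
    "'x set \<Rightarrow> ('x free_star \<Rightarrow> real) \<Rightarrow> ((nat \<Rightarrow> 'x free_star) \<times> (nat \<Rightarrow> 'x free_star)) set" where
  "null_rel X N = {(f, g). f \<in> cauchy_seqs X N \<and> g \<in> cauchy_seqs X N \<and>
     (\<lambda>n. N (f n - g n)) \<longlonglongrightarrow> 0}"

definition completion ::
    "'x set \<Rightarrow> ('x free_star \<Rightarrow> real) \<Rightarrow> (nat \<Rightarrow> 'x free_star) set star_algebra" where
  "completion X N =
     \<lparr>carrier = cauchy_seqs X N // null_rel X N,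
      mult = (\<lambda>A B. \<Union>f\<in>A. \<Union>g\<in>B. null_rel X N `` {\<lambda>n. f n * g n}),
      one = null_rel X N `` {\<lambda>n. 1},
      zero = null_rel X N `` {\<lambda>n. 0},
      add = (\<lambda>A B. \<Union>f\<in>A. \<Union>g\<in>B. null_rel X N `` {\<lambda>n. f n + g n}),
      scale = (\<lambda>c A. \<Union>f\<in>A. null_rel X N `` {\<lambda>n. fscale c (f n)}),
      adj = (\<lambda>A. \<Union>f\<in>A. null_rel X N `` {\<lambda>n. fstar (f n)}),
      cnorm = (\<lambda>A. the_elem ((\<lambda>f. lim (\<lambda>n. N (f n))) ` A))\<rparr>"

definition univ_cstar ::
    "'x set \<Rightarrow> 'x free_star set \<Rightarrow> (nat \<Rightarrow> 'x free_star) set star_algebra" where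
  "univ_cstar X Rel = completion X (univ_norm X Rel)"

definition univ_gen ::
    "'x set \<Rightarrow> 'x free_star set \<Rightarrow> 'x \<Rightarrow> (nat \<Rightarrow> 'x free_star) set" where
  "univ_gen X Rel x = null_rel X (univ_norm X Rel) `` {\<lambda>n. fgen x}"


text \<open>
  The theorems \<open>cstar_univ_cstar\<close>, \<open>univ_cstar_satisfies\<close>,
  \<open>univ_cstar_universal\<close> and \<open>univ_cstar_hom_eqI\<close> below show that, for a bounded
  presentation, \<open>univ_cstar X Rel\<close> is a unital C*-algebra with the expected universal
  property; \<open>satisfies A \<phi> Rel\<close> says that the family \<open>\<phi>\<close> of elements of
  \<open>A\<close> satisfies the relations.
\<close>

primrec eval_letter :: "('a, 'm) star_algebra_scheme \<Rightarrow> ('x \<Rightarrow> 'a) \<Rightarrow> 'x letter \<Rightarrow> 'a" where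
  "eval_letter A \<phi> (Gen x) = \<phi> x"
| "eval_letter A \<phi> (Adj x) = adj A (\<phi> x)"

definition eval_word :: "('a, 'm) star_algebra_scheme \<Rightarrow> ('x \<Rightarrow> 'a) \<Rightarrow> 'x star_word \<Rightarrow> 'a" where
  "eval_word A \<phi> w = foldr (\<lambda>l a. eval_letter A \<phi> l \<otimes>\<^bsub>A\<^esub> a) (letters w) \<one>\<^bsub>A\<^esub>"

definition eval_poly :: "('a, 'm) star_algebra_scheme \<Rightarrow> ('x \<Rightarrow> 'a) \<Rightarrow> 'x free_star \<Rightarrow> 'a" where
  "eval_poly A \<phi> p =
     (\<Oplus>\<^bsub>A\<^esub>w\<in>Poly_Mapping.keys p. scale A (Poly_Mapping.lookup p w) (eval_word A \<phi> w))"

definition satisfies :: "('a, 'm) star_algebra_scheme \<Rightarrow> ('x \<Rightarrow> 'a) \<Rightarrow> 'x free_star set \<Rightarrow> bool" where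
  "satisfies A \<phi> Rel \<longleftrightarrow> (\<forall>r\<in>Rel. eval_poly A \<phi> r = \<zero>\<^bsub>A\<^esub>)"


section \<open>The ring C*-algebra\<close>

definition cong_rel :: "'r::idom \<Rightarrow> ('r \<times> 'r) set" where
  "cong_rel m = {(a, b). m dvd a - b}"

definition residues :: "'r::idom \<Rightarrow> 'r set set" where
  "residues m = UNIV // cong_rel m"

definition residue_choice :: "'r::idom \<Rightarrow> ('r set \<Rightarrow> 'r) \<Rightarrow> bool" where
  "residue_choice m \<rho> \<longleftrightarrow> (\<forall>L\<in>residues m. \<rho> L \<in> L)"

datatype 'r ring_gen = Iso 'r | Uni 'r

definition ring_gens :: "'r::idom ring_gen set" where
  "ring_gens = {Iso m |m. m \<noteq> 0} \<union> range Uni"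

abbreviation fs :: "'r \<Rightarrow> 'r ring_gen free_star" where
  "fs m \<equiv> fgen (Iso m)"

abbreviation fu :: "'r \<Rightarrow> 'r ring_gen free_star" where
  "fu n \<equiv> fgen (Uni n)"

text \<open>
  Sums over $R/(m)$ are imposed for every choice \<open>\<rho>\<close> of representatives.
\<close>

definition ring_rels :: "'r::idom ring_gen free_star set" where
  "ring_rels =
     {fstar (fs m) * fs m - 1 |m. m \<noteq> 0} \<union>
     {fstar (fu n) * fu n - 1 |n. True} \<union>
     {fu n * fstar (fu n) - 1 |n. True} \<union>
     {fs m * fs m' - fs (m * m') |m m'. m \<noteq> 0 \<and> m' \<noteq> 0} \<union>
     {fu n * fu n' - fu (n + n') |n n'. True} \<union>
     {fs m * fu n - fu (m * n) * fs m |m n. m \<noteq> 0} \<union>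
     {(\<Sum>L\<in>residues m. fu (\<rho> L) * fs m * fstar (fs m) * fu (- \<rho> L)) - 1 |m \<rho>.
        m \<noteq> 0 \<and> residue_choice m \<rho>}"

definition ring_cstar :: "(nat \<Rightarrow> 'r::idom ring_gen free_star) set star_algebra" where
  "ring_cstar = univ_cstar ring_gens ring_rels"

definition isom :: "'r::idom \<Rightarrow> (nat \<Rightarrow> 'r ring_gen free_star) set" where
  "isom m = univ_gen ring_gens ring_rels (Iso m)"

definition unitary :: "'r::idom \<Rightarrow> (nat \<Rightarrow> 'r ring_gen free_star) set" where
  "unitary n = univ_gen ring_gens ring_rels (Uni n)"


section \<open>C*-algebras of partial representations\<close>

definition proj :: "('g, 'b) monoid_scheme \<Rightarrow> 'g \<Rightarrow> 'g free_star" where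
  "proj G g = fgen g * fgen (inv\<^bsub>G\<^esub> g)"

definition partial_rels :: "('g, 'b) monoid_scheme \<Rightarrow> 'g free_star set" where
  "partial_rels G =
     {fgen \<one>\<^bsub>G\<^esub> - 1} \<union>
     {fgen (inv\<^bsub>G\<^esub> g) - fstar (fgen g) |g. g \<in> carrier G} \<union>
     {fgen g * fgen h * fgen (inv\<^bsub>G\<^esub> h) - fgen (g \<otimes>\<^bsub>G\<^esub> h) * fgen (inv\<^bsub>G\<^esub> h) |g h.
        g \<in> carrier G \<and> h \<in> carrier G}"

definition partial_cstar ::
    "('g, 'b) monoid_scheme \<Rightarrow> 'g free_star set \<Rightarrow> (nat \<Rightarrow> 'g free_star) set star_algebra" where
  "partial_cstar G Rel = univ_cstar (carrier G) (partial_rels G \<union> Rel)"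

definition partial_gen ::
    "('g, 'b) monoid_scheme \<Rightarrow> 'g free_star set \<Rightarrow> 'g \<Rightarrow> (nat \<Rightarrow> 'g free_star) set" where
  "partial_gen G Rel g = univ_gen (carrier G) (partial_rels G \<union> Rel) g"

definition affine_group :: "('k::field \<times> 'k) monoid" where
  "affine_group =
     \<lparr>carrier = {(u, w). w \<noteq> 0},
      mult = (\<lambda>(u, w) (u', w'). (u + u' * w, w * w')),
      one = (0, 1)\<rparr>"

definition affine_rels :: "('r::idom fract \<times> 'r fract) free_star set" where
  "affine_rels =
     {proj affine_group (Fract n 1, 1) - 1 |n. True} \<union>
     {proj affine_group (0, Fract 1 m) - 1 |m. m \<noteq> 0} \<union>
     {(\<Sum>L\<in>residues m. proj affine_group (Fract (\<rho> L) 1, Fract m 1)) - 1 |m \<rho>.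
        m \<noteq> 0 \<and> residue_choice m \<rho>}"


section \<open>Facts about the free $*$-algebra\<close>

lemma fscale_conv: "fscale c p = Poly_Mapping.single 0 c * p"
  by (simp add: fscale_def mult_map_scale_conv_mult)

lemma lookup_fscale: "Poly_Mapping.lookup (fscale c p) w = c * Poly_Mapping.lookup p w"
  by (simp add: fscale_def map.rep_eq when_def)

lemma adj_letter_adj_letter [simp]: "adj_letter (adj_letter l) = l"
  by (cases l) auto

lemma letter_gen_adj_letter [simp]: "letter_gen (adj_letter l) = letter_gen l"
  by (cases l) auto

lemma letters_simps [simp]:
  "letters 0 = []" "letters (v + w) = letters v @ letters w"
  "letters (adj_word w) = rev (map adj_letter (letters w))"
  by (auto simp: zero_star_word_def plus_star_word_def adj_word_def)

lemma star_word_eqI: "letters v = letters w \<Longrightarrow> v = w"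
  by (cases v; cases w) auto

lemma adj_word_adj_word [simp]: "adj_word (adj_word w) = w"
  by (rule star_word_eqI) (auto simp: rev_map comp_def)

lemma inj_adj_word: "inj adj_word"
  by (rule injI) (metis adj_word_adj_word)

lemma adj_word_add: "adj_word (v + w) = adj_word w + adj_word v"
  by (rule star_word_eqI) auto

lemma adj_word_zero [simp]: "adj_word 0 = 0"
  by (rule star_word_eqI) auto

lemma lookup_fstar: "Poly_Mapping.lookup (fstar p) w = cnj (Poly_Mapping.lookup p (adj_word w))"
  by (simp add: fstar_def map.rep_eq map_key.rep_eq inj_adj_word when_def)

lemma fstar_single: "fstar (Poly_Mapping.single w c) = Poly_Mapping.single (adj_word w) (cnj c)"
  by (rule poly_mapping_eqI) (auto simp: lookup_fstar lookup_single when_def)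

lemma fstar_add: "fstar (p + q) = fstar p + fstar q"
  by (rule poly_mapping_eqI) (auto simp: lookup_fstar lookup_add)

lemma fstar_zero [simp]: "fstar 0 = 0"
  by (rule poly_mapping_eqI) (auto simp: lookup_fstar)

lemma fstar_diff: "fstar (p - q) = fstar p - fstar q"
  by (rule poly_mapping_eqI) (auto simp: lookup_fstar lookup_minus)

lemma fstar_fstar [simp]: "fstar (fstar p) = p"
  by (rule poly_mapping_eqI) (auto simp: lookup_fstar)

lemma free_star_induct [consumes 1, case_names zero single add]:
  assumes "p \<in> free_star_on X"
    and "P 0"
    and "\<And>w c. letter_gen ` set (letters w) \<subseteq> X \<Longrightarrow> P (Poly_Mapping.single w c)"
    and "\<And>p q. \<lbrakk>p \<in> free_star_on X; q \<in> free_star_on X; P p; P q\<rbrakk> \<Longrightarrow> P (p + q)"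
  shows "P p"
proof -
  have sum: "p = (\<Sum>w\<in>Poly_Mapping.keys p. Poly_Mapping.single w (Poly_Mapping.lookup p w))"
    by (rule poly_mapping_eqI)
      (auto simp: lookup_sum lookup_single when_def in_keys_iff sum.delta' sum.delta)
  have "finite W \<Longrightarrow> W \<subseteq> Poly_Mapping.keys p \<Longrightarrow>
      (\<Sum>w\<in>W. Poly_Mapping.single w (Poly_Mapping.lookup p w)) \<in> free_star_on X \<and>
      P (\<Sum>w\<in>W. Poly_Mapping.single w (Poly_Mapping.lookup p w))" for W
  proof (induction W rule: finite_induct)
    case empty
    then show ?case using assms(2) by (simp add: free_star_on_def)
  next
    case (insert w W)
    have w: "letter_gen ` set (letters w) \<subseteq> X"
      using insert.prems assms(1) by (auto simp: free_star_on_def)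
    have "Poly_Mapping.single w (Poly_Mapping.lookup p w) \<in> free_star_on X"
      using w by (auto simp: free_star_on_def)
    moreover have "Poly_Mapping.single w (Poly_Mapping.lookup p w) +
        (\<Sum>w\<in>W. Poly_Mapping.single w (Poly_Mapping.lookup p w)) \<in> free_star_on X"
      using calculation insert Poly_Mapping.keys_add by (fastforce simp: free_star_on_def)
    ultimately show ?case
      using insert assms(3)[OF w] assms(4) by simp
  qed
  from this[of "Poly_Mapping.keys p"] show ?thesis using sum by simp
qed

lemma free_star_on_UNIV [simp]: "p \<in> free_star_on UNIV"
  by (simp add: free_star_on_def)

lemma fstar_mult: "fstar (p * q) = fstar q * fstar p"
proof -
  have "p \<in> free_star_on UNIV" by simp
  then show ?thesis
  proof (induction p rule: free_star_induct)
    case (single v c)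
    have "q \<in> free_star_on UNIV" by simp
    then show ?case
    proof (induction q rule: free_star_induct)
      case (single w d)
      then show ?case by (simp add: mult_single fstar_single adj_word_add mult.commute)
    qed (simp_all add: distrib_left distrib_right fstar_add)
  qed (simp_all add: distrib_left distrib_right fstar_add)
qed

lemma fstar_one [simp]: "fstar 1 = 1"
  by (metis adj_word_zero complex_cnj_one fstar_single single_one)

lemma fstar_fscale: "fstar (fscale c p) = fscale (cnj c) (fstar p)"
  by (rule poly_mapping_eqI) (auto simp: lookup_fstar lookup_fscale)

lemma fscale_add_right: "fscale c (p + q) = fscale c p + fscale c q"
  by (simp add: fscale_conv distrib_left)

lemma fscale_diff_right: "fscale c (p - q) = fscale c p - fscale c q"
  by (simp add: fscale_conv right_diff_distrib)

lemma fscale_add_left: "fscale (c + d) p = fscale c p + fscale d p"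
  by (simp add: fscale_conv distrib_right single_add)

lemma fscale_fscale: "fscale c (fscale d p) = fscale (c * d) p"
  by (rule poly_mapping_eqI) (auto simp: lookup_fscale)

lemma fscale_one [simp]: "fscale 1 p = p"
  by (rule poly_mapping_eqI) (auto simp: lookup_fscale)

lemma fscale_mult_left: "fscale c p * q = fscale c (p * q)"
  by (simp add: fscale_conv mult.assoc)

lemma fscale_minus_one: "fscale (-1) p = - p"
  by (rule poly_mapping_eqI) (auto simp: lookup_fscale)

lemma fscale_mult_right: "p * fscale c q = fscale c (p * q)"
  by (metis complex_cnj_cnj fscale_mult_left fstar_fscale fstar_fstar fstar_mult)

lemma free_star_on_zero [simp, intro]: "0 \<in> free_star_on X"
  by (simp add: free_star_on_def)

lemma free_star_on_single: "letter_gen ` set (letters w) \<subseteq> X \<Longrightarrow> Poly_Mapping.single w c \<in> free_star_on X"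
  by (auto simp: free_star_on_def)

lemma free_star_on_one [simp, intro]: "1 \<in> free_star_on X"
  using free_star_on_single[of 0 X 1] by simp

lemma free_star_on_fgen [intro]: "x \<in> X \<Longrightarrow> fgen x \<in> free_star_on X"
  by (auto simp: fgen_def intro!: free_star_on_single)

lemma free_star_on_add [intro]:
  "\<lbrakk>p \<in> free_star_on X; q \<in> free_star_on X\<rbrakk> \<Longrightarrow> p + q \<in> free_star_on X"
  using Poly_Mapping.keys_add[of p q] by (auto simp: free_star_on_def)

lemma free_star_on_mult [intro]:
  "\<lbrakk>p \<in> free_star_on X; q \<in> free_star_on X\<rbrakk> \<Longrightarrow> p * q \<in> free_star_on X"
  using keys_mult[of p q] by (fastforce simp: free_star_on_def)

lemma free_star_on_fscale [intro]: "p \<in> free_star_on X \<Longrightarrow> fscale c p \<in> free_star_on X"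
  by (auto simp: free_star_on_def in_keys_iff lookup_fscale)

lemma free_star_on_uminus [intro]: "p \<in> free_star_on X \<Longrightarrow> - p \<in> free_star_on X"
  using free_star_on_fscale[of p X "-1"] by (simp add: fscale_minus_one)

lemma free_star_on_diff [intro]:
  "\<lbrakk>p \<in> free_star_on X; q \<in> free_star_on X\<rbrakk> \<Longrightarrow> p - q \<in> free_star_on X"
  using free_star_on_add[of p X "- q"] free_star_on_uminus[of q X] by simp

lemma free_star_on_fstar [intro]: "p \<in> free_star_on X \<Longrightarrow> fstar p \<in> free_star_on X"
proof -
  assume p: "p \<in> free_star_on X"
  show ?thesis
    unfolding free_star_on_def
  proof safe
    fix w l assume "w \<in> Poly_Mapping.keys (fstar p)" "l \<in> set (letters w)"
    then have "adj_word w \<in> Poly_Mapping.keys p" by (simp add: in_keys_iff lookup_fstar)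
    moreover have "adj_letter l \<in> set (letters (adj_word w))"
      using \<open>l \<in> set (letters w)\<close> by simp
    ultimately have "letter_gen (adj_letter l) \<in> X"
      using p unfolding free_star_on_def by blast
    then show "letter_gen l \<in> X" by simp
  qed
qed

lemma free_star_on_sum [intro]:
  "(\<And>i. i \<in> I \<Longrightarrow> f i \<in> free_star_on X) \<Longrightarrow> sum f I \<in> free_star_on X"
  by (induction I rule: infinite_finite_induct) auto


section \<open>The completion is a C*-algebra\<close>

locale cstar_seminorm_on =
  fixes X :: "'x set" and N :: "'x free_star \<Rightarrow> real"
  assumes seminorm: "cstar_seminorm X N"
begin

abbreviation "F \<equiv> free_star_on X"

lemma tri: "x \<in> F \<Longrightarrow> y \<in> F \<Longrightarrow> N (x + y) \<le> N x + N y"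
  and submult: "x \<in> F \<Longrightarrow> y \<in> F \<Longrightarrow> N (x * y) \<le> N x * N y"
  and homog: "x \<in> F \<Longrightarrow> N (fscale c x) = cmod c * N x"
  and cstar: "x \<in> F \<Longrightarrow> N (fstar x * x) = (N x)\<^sup>2"
  using seminorm by (auto simp: cstar_seminorm_def)

lemma N_zero [simp]: "N 0 = 0"
  using homog[of 0 0] by (simp add: fscale_conv)

lemma N_uminus: "x \<in> F \<Longrightarrow> N (- x) = N x"
  using homog[of x "-1"] by (simp add: fscale_minus_one)

lemma N_nonneg: "x \<in> F \<Longrightarrow> 0 \<le> N x"
  using tri[of x "- x"] N_uminus[of x] by auto

lemma N_diff_comm: "x \<in> F \<Longrightarrow> y \<in> F \<Longrightarrow> N (x - y) = N (y - x)"
  using N_uminus[OF free_star_on_diff, of x y] by simp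

lemma tri_diff: "x \<in> F \<Longrightarrow> y \<in> F \<Longrightarrow> N (x - y) \<le> N x + N y"
  using tri[of x "- y"] N_uminus[of y] by auto

lemma tri3: "x \<in> F \<Longrightarrow> y \<in> F \<Longrightarrow> z \<in> F \<Longrightarrow> N (x - z) \<le> N (x - y) + N (y - z)"
  using tri[OF free_star_on_diff free_star_on_diff, of x y y z] by simp

lemma rev_tri: "x \<in> F \<Longrightarrow> y \<in> F \<Longrightarrow> \<bar>N x - N y\<bar> \<le> N (x - y)"
  using tri[OF free_star_on_diff, of x y y] tri[OF free_star_on_diff, of y x x] N_diff_comm[of x y] by simp

lemma N_fstar_le: "x \<in> F \<Longrightarrow> N x \<le> N (fstar x)"
proof -
  assume x: "x \<in> F"
  then have "N x * N x \<le> N (fstar x) * N x"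
    using cstar[of x] submult[of "fstar x" x] by (auto simp: power2_eq_square)
  then show ?thesis
    using N_nonneg[OF x] N_nonneg[of "fstar x"] x by (cases "N x = 0") auto
qed

lemma N_fstar [simp]: "x \<in> F \<Longrightarrow> N (fstar x) = N x"
  using N_fstar_le[of x] N_fstar_le[of "fstar x"] by fastforce

lemma N_one: "N 1 \<le> 1"
proof -
  have "N 1 = (N 1)\<^sup>2" using cstar[of 1] by simp
  then show ?thesis by (metis le_numeral_extra(4) numeral_One power2_eq_iff_nonneg
        mult_cancel_right1 power2_eq_square zero_le_one)
qed

abbreviation "C \<equiv> cauchy_seqs X N"
abbreviation "R \<equiv> null_rel X N"
abbreviation "A \<equiv> completion X N"
definition cl :: "(nat \<Rightarrow> 'x free_star) \<Rightarrow> (nat \<Rightarrow> 'x free_star) set" where "cl f = R `` {f}"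

lemma C_in: "f \<in> C \<Longrightarrow> f n \<in> F"
  by (simp add: cauchy_seqs_def)

lemma C_D: "f \<in> C \<Longrightarrow> e > 0 \<Longrightarrow> \<exists>M. \<forall>m\<ge>M. \<forall>n\<ge>M. N (f m - f n) < e"
  by (simp add: cauchy_seqs_def)

lemma C_I: "(\<And>n. f n \<in> F) \<Longrightarrow> (\<And>e. e > 0 \<Longrightarrow> \<exists>M. \<forall>m\<ge>M. \<forall>n\<ge>M. N (f m - f n) < e) \<Longrightarrow> f \<in> C"
  by (simp add: cauchy_seqs_def)

lemma C_const [simp, intro]: "x \<in> F \<Longrightarrow> (\<lambda>_. x) \<in> C"
  by (rule C_I) auto

lemma C_lipschitz:
  assumes f: "f \<in> C" and F: "\<And>x. x \<in> F \<Longrightarrow> T x \<in> F"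
    and L: "\<And>x y. x \<in> F \<Longrightarrow> y \<in> F \<Longrightarrow> N (T x - T y) \<le> L * N (x - y)"
  shows "(\<lambda>n. T (f n)) \<in> C"
proof (rule C_I)
  fix e :: real assume e: "e > 0"
  have "e / (\<bar>L\<bar> + 1) > 0" using e by (simp add: add_pos_nonneg)
  from C_D[OF f this] obtain M where M: "\<And>m n. m \<ge> M \<Longrightarrow> n \<ge> M \<Longrightarrow> N (f m - f n) < e / (\<bar>L\<bar> + 1)"
    by blast
  have "N (T (f m) - T (f n)) < e" if "m \<ge> M" "n \<ge> M" for m n
  proof -
    have "N (T (f m) - T (f n)) \<le> L * N (f m - f n)" using L C_in[OF f] by blast
    also have "\<dots> \<le> (\<bar>L\<bar> + 1) * N (f m - f n)"
      using N_nonneg[of "f m - f n"] C_in[OF f] by (intro mult_right_mono) auto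
    also have "\<dots> < e" using M[OF that] by (simp add: field_simps add_pos_nonneg)
    finally show ?thesis .
  qed
  then show "\<exists>M. \<forall>m\<ge>M. \<forall>n\<ge>M. N (T (f m) - T (f n)) < e" by blast
qed (use F C_in[OF f] in auto)

lemma C_scale: "f \<in> C \<Longrightarrow> (\<lambda>n. fscale c (f n)) \<in> C"
  by (rule C_lipschitz[where T = "fscale c" and L = "cmod c"])
    (auto simp: fscale_diff_right[symmetric] homog free_star_on_diff free_star_on_fscale)

lemma C_star: "f \<in> C \<Longrightarrow> (\<lambda>n. fstar (f n)) \<in> C"
  by (rule C_lipschitz[where T = fstar and L = 1])
    (auto simp: fstar_diff[symmetric] free_star_on_diff free_star_on_fstar)

lemma C_add: assumes f: "f \<in> C" and g: "g \<in> C" shows "(\<lambda>n. f n + g n) \<in> C"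
proof (rule C_I)
  fix e :: real assume "e > 0"
  then have e: "e / 2 > 0" by simp
  obtain M1 where M1: "\<And>m n. m \<ge> M1 \<Longrightarrow> n \<ge> M1 \<Longrightarrow> N (f m - f n) < e / 2"
    using C_D[OF f e] by blast
  obtain M2 where M2: "\<And>m n. m \<ge> M2 \<Longrightarrow> n \<ge> M2 \<Longrightarrow> N (g m - g n) < e / 2"
    using C_D[OF g e] by blast
  have "N (f m + g m - (f n + g n)) < e" if "m \<ge> max M1 M2" "n \<ge> max M1 M2" for m n
  proof -
    have "N ((f m - f n) + (g m - g n)) \<le> N (f m - f n) + N (g m - g n)"
      by (rule tri) (use C_in[OF f] C_in[OF g] in auto)
    then show ?thesis using M1[of m n] M2[of m n] that by (simp add: add_diff_add)
  qed
  then show "\<exists>M. \<forall>m\<ge>M. \<forall>n\<ge>M. N (f m + g m - (f n + g n)) < e" by blast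
qed (use C_in[OF f] C_in[OF g] in auto)

lemma C_norm_Cauchy: assumes f: "f \<in> C" shows "Cauchy (\<lambda>n. N (f n))"
proof (rule metric_CauchyI)
  fix e :: real assume e: "e > 0"
  obtain M where M: "\<And>m n. m \<ge> M \<Longrightarrow> n \<ge> M \<Longrightarrow> N (f m - f n) < e"
    using C_D[OF f e] by blast
  have "dist (N (f m)) (N (f n)) < e" if "m \<ge> M" "n \<ge> M" for m n
    using rev_tri[of "f m" "f n"] M[OF that] C_in[OF f] by (auto simp: dist_real_def)
  then show "\<exists>M. \<forall>m\<ge>M. \<forall>n\<ge>M. dist (N (f m)) (N (f n)) < e" by blast
qed

lemma C_norm_lim: "f \<in> C \<Longrightarrow> (\<lambda>n. N (f n)) \<longlonglongrightarrow> lim (\<lambda>n. N (f n))"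
  using C_norm_Cauchy Cauchy_convergent convergent_LIMSEQ_iff by blast

lemma C_bound: assumes f: "f \<in> C" shows "\<exists>B>0. \<forall>n. N (f n) \<le> B"
proof -
  have "Bseq (\<lambda>n. N (f n))"
    using C_norm_Cauchy[OF f] Cauchy_Bseq by blast
  then obtain B where "B > 0" "\<And>n. norm (N (f n)) \<le> B" unfolding Bseq_def by blast
  then show ?thesis by (metis abs_le_D1 real_norm_def)
qed

lemma N_mult_diff:
  assumes "a \<in> F" "b \<in> F" "c \<in> F" "d \<in> F"
  shows "N (a * b - c * d) \<le> N a * N (b - d) + N (a - c) * N d"
proof -
  have "a * b - c * d = a * (b - d) + (a - c) * d" by (simp add: algebra_simps)
  moreover have "N (a * (b - d) + (a - c) * d) \<le> N (a * (b - d)) + N ((a - c) * d)"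
    using assms by (intro tri) auto
  moreover have "N (a * (b - d)) \<le> N a * N (b - d)" "N ((a - c) * d) \<le> N (a - c) * N d"
    using assms by (auto intro!: submult)
  ultimately show ?thesis by simp
qed

lemma C_mult: assumes f: "f \<in> C" and g: "g \<in> C" shows "(\<lambda>n. f n * g n) \<in> C"
proof (rule C_I)
  fix e :: real assume e: "e > 0"
  obtain B1 where B1: "B1 > 0" "\<And>n. N (f n) \<le> B1" using C_bound[OF f] by blast
  obtain B2 where B2: "B2 > 0" "\<And>n. N (g n) \<le> B2" using C_bound[OF g] by blast
  obtain M1 where M1: "\<And>m n. m \<ge> M1 \<Longrightarrow> n \<ge> M1 \<Longrightarrow> N (f m - f n) < e / (2 * B2)"
    using C_D[OF f, of "e / (2 * B2)"] e B2 by auto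
  obtain M2 where M2: "\<And>m n. m \<ge> M2 \<Longrightarrow> n \<ge> M2 \<Longrightarrow> N (g m - g n) < e / (2 * B1)"
    using C_D[OF g, of "e / (2 * B1)"] e B1 by auto
  have "N (f m * g m - f n * g n) < e" if "m \<ge> max M1 M2" "n \<ge> max M1 M2" for m n
  proof -
    have nn: "0 \<le> N (f m)" "0 \<le> N (g n)" "0 \<le> N (f m - f n)" "0 \<le> N (g m - g n)"
      using C_in[OF f] C_in[OF g] by (auto intro!: N_nonneg)
    have "N (f m * g m - f n * g n) \<le> N (f m) * N (g m - g n) + N (f m - f n) * N (g n)"
      using C_in[OF f] C_in[OF g] by (intro N_mult_diff) auto
    also have "\<dots> \<le> B1 * N (g m - g n) + N (f m - f n) * B2"
      using nn B1 B2 by (intro add_mono mult_right_mono mult_left_mono) auto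
    also have "\<dots> < B1 * (e / (2 * B1)) + e / (2 * B2) * B2"
      using M1[of m n] M2[of m n] that B1 B2
      by (intro add_strict_mono mult_strict_left_mono mult_strict_right_mono) auto
    also have "\<dots> = e" using B1 B2 by simp
    finally show ?thesis .
  qed
  then show "\<exists>M. \<forall>m\<ge>M. \<forall>n\<ge>M. N (f m * g m - f n * g n) < e" by blast
qed (use C_in[OF f] C_in[OF g] in auto)

lemma R_iff: "(f, g) \<in> R \<longleftrightarrow> f \<in> C \<and> g \<in> C \<and> (\<lambda>n. N (f n - g n)) \<longlonglongrightarrow> 0"
  by (simp add: null_rel_def)

lemma R_I:
  assumes "f \<in> C" "g \<in> C" "\<And>n. N (f n - g n) \<le> h n" "h \<longlonglongrightarrow> 0"
  shows "(f, g) \<in> R"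
proof -
  have "0 \<le> N (f n - g n)" for n
    by (intro N_nonneg free_star_on_diff C_in[OF assms(1)] C_in[OF assms(2)])
  then have "(\<lambda>n. N (f n - g n)) \<longlonglongrightarrow> 0"
    using assms(3,4) by (intro tendsto_sandwich[OF _ _ tendsto_const assms(4)]) auto
  then show ?thesis using assms(1,2) by (simp add: R_iff)
qed

lemma equiv_R: "equiv C R"
proof (rule equivI)
  show "refl_on C R" by (auto simp: refl_on_def R_iff)
  show "R \<subseteq> C \<times> C" by (auto simp: R_iff)
  show "sym R"
  proof (rule symI)
    fix f g assume fg: "(f, g) \<in> R"
    then have "N (f n - g n) = N (g n - f n)" for n
      by (intro N_diff_comm) (auto simp: R_iff C_in)
    with fg show "(g, f) \<in> R" by (auto simp: R_iff)
  qed
  show "trans R"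
  proof (rule transI)
    fix f g h assume "(f, g) \<in> R" "(g, h) \<in> R"
    then have fgh: "f \<in> C" "g \<in> C" "h \<in> C" and
      lim: "(\<lambda>n. N (f n - g n) + N (g n - h n)) \<longlonglongrightarrow> 0 + 0"
      by (auto simp: R_iff simp del: add_0 add_0_right intro!: tendsto_add)
    show "(f, h) \<in> R"
      by (rule R_I[where h = "\<lambda>n. N (f n - g n) + N (g n - h n)"])
        (use lim C_in[OF fgh(1)] C_in[OF fgh(2)] C_in[OF fgh(3)] fgh in \<open>auto intro!: tri3\<close>)
  qed
qed

lemma cl_eq_iff: "f \<in> C \<Longrightarrow> g \<in> C \<Longrightarrow> cl f = cl g \<longleftrightarrow> (\<lambda>n. N (f n - g n)) \<longlonglongrightarrow> 0"
  unfolding cl_def using eq_equiv_class_iff[OF equiv_R] by (auto simp: R_iff)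

lemma mem_clD: "f' \<in> cl f \<Longrightarrow> f \<in> C \<and> f' \<in> C \<and> (\<lambda>n. N (f n - f' n)) \<longlonglongrightarrow> 0"
  by (auto simp: cl_def R_iff)

lemma self_cl: "f \<in> C \<Longrightarrow> f \<in> cl f"
  unfolding cl_def by (rule equiv_class_self[OF equiv_R])

lemma cl_mem_eq: "f' \<in> cl f \<Longrightarrow> cl f' = cl f"
  unfolding cl_def by (metis ImageE equiv_R equiv_class_eq singletonD)

lemma carrier_cl [intro]: "f \<in> C \<Longrightarrow> cl f \<in> carrier A"
  by (auto simp: completion_def cl_def intro: quotientI)

lemma carrier_clE: assumes "a \<in> carrier A" obtains f where "f \<in> C" "a = cl f"
  using assms by (auto simp: completion_def cl_def elim: quotientE)

lemma UN1: assumes "f \<in> C" "\<And>f'. f' \<in> cl f \<Longrightarrow> cl (T f') = cl (T f)"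
  shows "(\<Union>f'\<in>cl f. cl (T f')) = cl (T f)"
proof -
  have "(\<Union>f'\<in>cl f. cl (T f')) = (\<Union>f'\<in>cl f. cl (T f))"
    by (rule SUP_cong[OF refl assms(2)])
  then show ?thesis using self_cl[OF assms(1)] by auto
qed

lemma UN2: assumes "f \<in> C" "g \<in> C"
   "\<And>f' g'. f' \<in> cl f \<Longrightarrow> g' \<in> cl g \<Longrightarrow> cl (T f' g') = cl (T f g)"
 shows "(\<Union>f'\<in>cl f. \<Union>g'\<in>cl g. cl (T f' g')) = cl (T f g)"
proof -
  have "(\<Union>f'\<in>cl f. \<Union>g'\<in>cl g. cl (T f' g')) = (\<Union>f'\<in>cl f. \<Union>g'\<in>cl g. cl (T f g))"
    by (rule SUP_cong[OF refl], rule SUP_cong[OF refl], rule assms(3))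
  then show ?thesis using self_cl[OF assms(1)] self_cl[OF assms(2)] by auto
qed

lemma scale_cl: assumes f: "f \<in> C" shows "scale A c (cl f) = cl (\<lambda>n. fscale c (f n))"
proof -
  have "cl (\<lambda>n. fscale c (f' n)) = cl (\<lambda>n. fscale c (f n))" if "f' \<in> cl f" for f'
  proof -
    have f': "f' \<in> C" and lim: "(\<lambda>n. cmod c * N (f n - f' n)) \<longlonglongrightarrow> cmod c * 0"
      using mem_clD[OF that] by (auto intro!: tendsto_mult_right_zero)
    have "N (fscale c (f n) - fscale c (f' n)) = cmod c * N (f n - f' n)" for n
      using f f' by (simp add: fscale_diff_right[symmetric] homog C_in free_star_on_diff)
    then show ?thesis
      using lim cl_eq_iff[OF C_scale[OF f, of c] C_scale[OF f', of c]] by simp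
  qed
  from UN1[where T = "\<lambda>f n. fscale c (f n)", OF f this] show ?thesis by (simp add: completion_def cl_def)
qed

lemma adj_cl: assumes f: "f \<in> C" shows "adj A (cl f) = cl (\<lambda>n. fstar (f n))"
proof -
  have "cl (\<lambda>n. fstar (f' n)) = cl (\<lambda>n. fstar (f n))" if "f' \<in> cl f" for f'
  proof -
    have f': "f' \<in> C" and lim: "(\<lambda>n. N (f n - f' n)) \<longlonglongrightarrow> 0"
      using mem_clD[OF that] by auto
    have "N (fstar (f n) - fstar (f' n)) = N (f n - f' n)" for n
      using f f' by (simp add: fstar_diff[symmetric] C_in free_star_on_diff)
    then show ?thesis
      using lim cl_eq_iff[OF C_star[OF f] C_star[OF f']] by simp
  qed
  from UN1[where T = "\<lambda>f n. fstar (f n)", OF f this] show ?thesis by (simp add: completion_def cl_def)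
qed

lemma add_cl: assumes f: "f \<in> C" and g: "g \<in> C"
  shows "cl f \<oplus>\<^bsub>A\<^esub> cl g = cl (\<lambda>n. f n + g n)"
proof -
  have "cl (\<lambda>n. f' n + g' n) = cl (\<lambda>n. f n + g n)" if "f' \<in> cl f" "g' \<in> cl g" for f' g'
  proof -
    have f': "f' \<in> C" and g': "g' \<in> C" and
      lim: "(\<lambda>n. N (f n - f' n) + N (g n - g' n)) \<longlonglongrightarrow> 0 + 0"
      using mem_clD[OF that(1)] mem_clD[OF that(2)] by (auto simp del: add_0 add_0_right intro!: tendsto_add)
    have "N (f n + g n - (f' n + g' n)) \<le> N (f n - f' n) + N (g n - g' n)" for n
      unfolding add_diff_add by (rule tri) (use C_in[OF f] C_in[OF g] C_in[OF f'] C_in[OF g'] in auto)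
    then have "(\<lambda>n. f n + g n, \<lambda>n. f' n + g' n) \<in> R"
      by (intro R_I[OF C_add[OF f g] C_add[OF f' g']]) (use lim in auto)
    then show ?thesis unfolding cl_def by (metis equiv_R equiv_class_eq)
  qed
  from UN2[where T = "\<lambda>f g n. f n + g n", OF f g this] show ?thesis by (simp add: completion_def cl_def)
qed

lemma mult_cl: assumes f: "f \<in> C" and g: "g \<in> C"
  shows "cl f \<otimes>\<^bsub>A\<^esub> cl g = cl (\<lambda>n. f n * g n)"
proof -
  have "cl (\<lambda>n. f' n * g' n) = cl (\<lambda>n. f n * g n)" if "f' \<in> cl f" "g' \<in> cl g" for f' g'
  proof -
    obtain B1 where B1: "\<And>n. N (f n) \<le> B1" using C_bound[OF f] by blast
    have f': "f' \<in> C" and g': "g' \<in> C" and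
      lim1: "(\<lambda>n. N (f n - f' n)) \<longlonglongrightarrow> 0" and lim2: "(\<lambda>n. N (g n - g' n)) \<longlonglongrightarrow> 0"
      using mem_clD[OF that(1)] mem_clD[OF that(2)] by auto
    obtain B2 where B2: "\<And>n. N (g' n) \<le> B2" using C_bound[OF g'] by blast
    have lim: "(\<lambda>n. B1 * N (g n - g' n) + N (f n - f' n) * B2) \<longlonglongrightarrow> B1 * 0 + 0 * B2"
      by (intro tendsto_intros lim1 lim2)
    have "N (f n * g n - f' n * g' n) \<le> B1 * N (g n - g' n) + N (f n - f' n) * B2" for n
    proof -
      have "N (f n * g n - f' n * g' n) \<le> N (f n) * N (g n - g' n) + N (f n - f' n) * N (g' n)"
        using C_in[OF f] C_in[OF g] C_in[OF f'] C_in[OF g'] by (intro N_mult_diff) auto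
      also have "\<dots> \<le> B1 * N (g n - g' n) + N (f n - f' n) * B2"
        using B1 B2 C_in[OF f] C_in[OF g] C_in[OF f'] C_in[OF g']
        by (intro add_mono mult_right_mono mult_left_mono) (auto intro!: N_nonneg)
      finally show ?thesis .
    qed
    then have "(\<lambda>n. f n * g n, \<lambda>n. f' n * g' n) \<in> R"
      by (intro R_I[OF C_mult[OF f g] C_mult[OF f' g']]) (use lim in auto)
    then show ?thesis unfolding cl_def by (metis equiv_R equiv_class_eq)
  qed
  from UN2[where T = "\<lambda>f g n. f n * g n", OF f g this] show ?thesis by (simp add: completion_def cl_def)
qed

lemma one_cl: "\<one>\<^bsub>A\<^esub> = cl (\<lambda>_. 1)" and zero_cl: "\<zero>\<^bsub>A\<^esub> = cl (\<lambda>_. 0)"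
  by (simp_all add: completion_def cl_def)

lemma norm_cl_lim: assumes f: "f \<in> C" shows "(\<lambda>n. N (f n)) \<longlonglongrightarrow> cnorm A (cl f)"
proof -
  have "lim (\<lambda>n. N (f' n)) = lim (\<lambda>n. N (f n))" if "f' \<in> cl f" for f'
  proof -
    have f': "f' \<in> C" and lim: "(\<lambda>n. N (f n - f' n)) \<longlonglongrightarrow> 0"
      using mem_clD[OF that] by auto
    have "norm (N (f n) - N (f' n)) \<le> norm (N (f n - f' n)) * 1" for n
      using rev_tri[OF C_in[OF f] C_in[OF f'], of n n] by simp
    then have "(\<lambda>n. N (f n) - N (f' n)) \<longlonglongrightarrow> 0"
      by (intro tendsto_0_le[where K = 1, OF lim] always_eventually) blast
    moreover have "(\<lambda>n. N (f n) - N (f' n)) \<longlonglongrightarrow> lim (\<lambda>n. N (f n)) - lim (\<lambda>n. N (f' n))"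
      by (intro tendsto_diff C_norm_lim f f')
    ultimately show ?thesis using LIMSEQ_unique by fastforce
  qed
  then have "(\<lambda>f. lim (\<lambda>n. N (f n))) ` cl f = (\<lambda>_. lim (\<lambda>n. N (f n))) ` cl f"
    by (intro image_cong refl)
  also have "\<dots> = {lim (\<lambda>n. N (f n))}"
    using self_cl[OF f] by (simp add: image_constant)
  finally have "(\<lambda>f. lim (\<lambda>n. N (f n))) ` cl f = {lim (\<lambda>n. N (f n))}" .
  then show ?thesis using C_norm_lim[OF f] by (simp add: completion_def)
qed

lemma norm_const: "x \<in> F \<Longrightarrow> cnorm A (cl (\<lambda>_. x)) = N x"
  using norm_cl_lim[of "\<lambda>_. x"] LIMSEQ_unique[OF tendsto_const] by fastforce

lemma ring_A: "ring A"
proof (rule ringI)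
  show "abelian_group A"
  proof (rule abelian_groupI)
    fix x assume "x \<in> carrier A"
    then obtain f where f: "f \<in> C" "x = cl f" by (elim carrier_clE)
    have "cl (\<lambda>n. fscale (-1) (f n)) \<oplus>\<^bsub>A\<^esub> x = \<zero>\<^bsub>A\<^esub>"
      using f C_scale[OF f(1), of "-1"] by (simp add: add_cl zero_cl fscale_minus_one)
    then show "\<exists>y\<in>carrier A. y \<oplus>\<^bsub>A\<^esub> x = \<zero>\<^bsub>A\<^esub>"
      using carrier_cl[OF C_scale[OF f(1)]] by blast
  qed (auto elim!: carrier_clE intro!: carrier_cl simp: add_cl zero_cl C_add add_ac)
  show "Group.monoid A"
    by (rule monoidI) (auto elim!: carrier_clE intro!: carrier_cl simp: mult_cl one_cl C_mult mult.assoc)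
qed (auto elim!: carrier_clE intro!: carrier_cl simp: add_cl mult_cl C_mult C_add distrib_left distrib_right)

lemma uminus_cl: assumes f: "f \<in> C" shows "\<ominus>\<^bsub>A\<^esub> cl f = cl (\<lambda>n. - f n)"
proof -
  interpret ring A by (rule ring_A)
  have C: "(\<lambda>n. - f n) \<in> C" using C_scale[OF f, of "-1"] by (simp add: fscale_minus_one)
  have "cl (\<lambda>n. - f n) \<oplus>\<^bsub>A\<^esub> cl f = \<zero>\<^bsub>A\<^esub>"
    using f C by (simp add: add_cl zero_cl)
  then show ?thesis using f C by (metis carrier_cl minus_equality)
qed

lemma C_diff: "f \<in> C \<Longrightarrow> g \<in> C \<Longrightarrow> (\<lambda>n. f n - g n) \<in> C"
  using C_add[of f "\<lambda>n. fscale (-1) (g n)"] C_scale[of g "-1"] by (simp add: fscale_minus_one)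

lemma minus_cl: assumes f: "f \<in> C" and g: "g \<in> C" shows "cl f \<ominus>\<^bsub>A\<^esub> cl g = cl (\<lambda>n. f n - g n)"
  using C_scale[OF g, of "-1"] f g by (simp add: a_minus_def uminus_cl add_cl fscale_minus_one)

lemma dense:
  assumes f: "f \<in> C" and e: "e > 0"
  shows "\<exists>M. \<forall>n\<ge>M. cnorm A (cl f \<ominus>\<^bsub>A\<^esub> cl (\<lambda>_. f n)) \<le> e"
proof -
  obtain M where M: "\<And>m n. m \<ge> M \<Longrightarrow> n \<ge> M \<Longrightarrow> N (f m - f n) < e"
    using C_D[OF f e] by blast
  have "cnorm A (cl f \<ominus>\<^bsub>A\<^esub> cl (\<lambda>_. f n)) \<le> e" if "n \<ge> M" for n
  proof -
    have c: "(\<lambda>_. f n) \<in> C" using C_in[OF f] by blast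
    have "(\<lambda>m. N (f m - f n)) \<longlonglongrightarrow> cnorm A (cl f \<ominus>\<^bsub>A\<^esub> cl (\<lambda>_. f n))"
      using norm_cl_lim[OF C_diff[OF f c]] minus_cl[OF f c] by simp
    then show ?thesis
      by (rule LIMSEQ_le_const2) (use M that in \<open>auto intro!: exI[of _ M] less_imp_le\<close>)
  qed
  then show ?thesis by blast
qed

lemma norm_tri_A:
  assumes "x \<in> carrier A" "y \<in> carrier A"
  shows "cnorm A (x \<oplus>\<^bsub>A\<^esub> y) \<le> cnorm A x + cnorm A y"
proof -
  from assms obtain f g where fg: "f \<in> C" "x = cl f" "g \<in> C" "y = cl g" by (auto elim!: carrier_clE)
  show ?thesis unfolding fg add_cl[OF fg(1,3)]
    by (rule LIMSEQ_le[OF norm_cl_lim[OF C_add] tendsto_add[OF norm_cl_lim norm_cl_lim]])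
      (use fg(1,3) C_in[OF fg(1)] C_in[OF fg(3)] in \<open>auto intro!: tri\<close>)
qed

lemma norm_diff_comm_A:
  assumes "x \<in> carrier A" "y \<in> carrier A"
  shows "cnorm A (x \<ominus>\<^bsub>A\<^esub> y) = cnorm A (y \<ominus>\<^bsub>A\<^esub> x)"
proof -
  from assms obtain f g where fg: "f \<in> C" "x = cl f" "g \<in> C" "y = cl g" by (auto elim!: carrier_clE)
  have "N (f n - g n) = N (g n - f n)" for n using C_in[OF fg(1)] C_in[OF fg(3)] by (intro N_diff_comm) auto
  then show ?thesis
    using norm_cl_lim[OF C_diff[OF fg(1,3)]] norm_cl_lim[OF C_diff[OF fg(3,1)]]
    unfolding fg minus_cl[OF fg(1,3)] minus_cl[OF fg(3,1)] by (simp add: LIMSEQ_unique)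
qed

lemma norm_tri3_A:
  assumes "x \<in> carrier A" "y \<in> carrier A" "z \<in> carrier A"
  shows "cnorm A (x \<ominus>\<^bsub>A\<^esub> z) \<le> cnorm A (x \<ominus>\<^bsub>A\<^esub> y) + cnorm A (y \<ominus>\<^bsub>A\<^esub> z)"
proof -
  interpret ring A by (rule ring_A)
  have "(x \<ominus>\<^bsub>A\<^esub> y) \<oplus>\<^bsub>A\<^esub> (y \<ominus>\<^bsub>A\<^esub> z) = x \<ominus>\<^bsub>A\<^esub> z"
    using assms by (simp add: a_minus_def a_assoc r_neg1 r_neg2)
  then show ?thesis using norm_tri_A[of "x \<ominus>\<^bsub>A\<^esub> y" "y \<ominus>\<^bsub>A\<^esub> z"] assms by simp
qed

lemma complete_A:
  assumes f: "\<And>n. f n \<in> carrier A"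
    and cau: "\<forall>e>0. \<exists>M. \<forall>m\<ge>M. \<forall>n\<ge>M. cnorm A (f m \<ominus>\<^bsub>A\<^esub> f n) < e"
  shows "\<exists>x\<in>carrier A. (\<lambda>n. cnorm A (f (n::nat) \<ominus>\<^bsub>A\<^esub> x)) \<longlonglongrightarrow> 0"
proof -
  interpret ring A by (rule ring_A)
  have "\<exists>d. d \<in> F \<and> cnorm A (f k \<ominus>\<^bsub>A\<^esub> cl (\<lambda>_. d)) \<le> 1 / real (Suc k)" for k
  proof -
    obtain h where h: "h \<in> C" "f k = cl h" using f[of k] by (elim carrier_clE)
    from dense[OF h(1), of "1 / real (Suc k)"] show ?thesis using h C_in[OF h(1)] by fastforce
  qed
  then obtain d where d: "\<And>k. d k \<in> F"
    and dk: "\<And>k. cnorm A (f k \<ominus>\<^bsub>A\<^esub> cl (\<lambda>_. d k)) \<le> 1 / real (Suc k)"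
    by metis
  have dA: "cl (\<lambda>_. d k) \<in> carrier A" for k using d by blast
  have dC: "d \<in> C"
  proof (rule C_I)
    fix e :: real assume e: "e > 0"
    obtain M1 where M1: "\<And>m n. m \<ge> M1 \<Longrightarrow> n \<ge> M1 \<Longrightarrow> cnorm A (f m \<ominus>\<^bsub>A\<^esub> f n) < e / 3"
      using cau e by (metis divide_pos_pos zero_less_numeral)
    obtain M2 where M2: "\<And>n. n \<ge> M2 \<Longrightarrow> 1 / real (Suc n) < e / 3"
    proof -
      have "(\<lambda>n. 1 / real (Suc n)) \<longlonglongrightarrow> 0" by (rule LIMSEQ_Suc[OF lim_1_over_n])
      from LIMSEQ_D[OF this, of "e / 3"] e show ?thesis using that by auto
    qed
    have "N (d m - d n) < e" if mn: "m \<ge> max M1 M2" "n \<ge> max M1 M2" for m n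
    proof -
      have "N (d m - d n) = cnorm A (cl (\<lambda>_. d m) \<ominus>\<^bsub>A\<^esub> cl (\<lambda>_. d n))"
        using d by (subst minus_cl) (auto simp: norm_const free_star_on_diff)
      also have "\<dots> \<le> cnorm A (cl (\<lambda>_. d m) \<ominus>\<^bsub>A\<^esub> f m) + cnorm A (f m \<ominus>\<^bsub>A\<^esub> cl (\<lambda>_. d n))"
        by (intro norm_tri3_A dA f)
      also have "\<dots> \<le> cnorm A (cl (\<lambda>_. d m) \<ominus>\<^bsub>A\<^esub> f m) +
          (cnorm A (f m \<ominus>\<^bsub>A\<^esub> f n) + cnorm A (f n \<ominus>\<^bsub>A\<^esub> cl (\<lambda>_. d n)))"
        by (intro add_left_mono norm_tri3_A dA f)
      also have "\<dots> < e / 3 + (e / 3 + e / 3)"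
        using dk[of m] dk[of n] M1[of m n] M2[of m] M2[of n] mn
          norm_diff_comm_A[OF dA[of m] f[of m]] by linarith
      finally show ?thesis by simp
    qed
    then show "\<exists>M. \<forall>m\<ge>M. \<forall>n\<ge>M. N (d m - d n) < e" by blast
  qed (rule d)
  have "(\<lambda>n. cnorm A (f n \<ominus>\<^bsub>A\<^esub> cl d)) \<longlonglongrightarrow> 0"
  proof (rule LIMSEQ_I)
    fix e :: real assume e: "e > 0"
    obtain M1 where M1: "\<And>n. n \<ge> M1 \<Longrightarrow> cnorm A (cl d \<ominus>\<^bsub>A\<^esub> cl (\<lambda>_. d n)) \<le> e / 3"
      using dense[OF dC, of "e / 3"] e by auto
    have "(\<lambda>n. 1 / real (Suc n)) \<longlonglongrightarrow> 0" by (rule LIMSEQ_Suc[OF lim_1_over_n])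
    from LIMSEQ_D[OF this, of "e / 3"] e obtain M2 where
      M2: "\<And>n. n \<ge> M2 \<Longrightarrow> norm (1 / real (Suc n) - 0) < e / 3" by auto
    have "norm (cnorm A (f n \<ominus>\<^bsub>A\<^esub> cl d) - 0) < e" if n: "n \<ge> max M1 M2" for n
    proof -
      have clA: "cl d \<in> carrier A" using dC by blast
      have "cnorm A (f n \<ominus>\<^bsub>A\<^esub> cl d) \<le>
          cnorm A (f n \<ominus>\<^bsub>A\<^esub> cl (\<lambda>_. d n)) + cnorm A (cl (\<lambda>_. d n) \<ominus>\<^bsub>A\<^esub> cl d)"
        by (intro norm_tri3_A dA f clA)
      moreover have "0 \<le> cnorm A (f n \<ominus>\<^bsub>A\<^esub> cl d)"
      proof -
        obtain h where h: "h \<in> C" "f n = cl h" using f[of n] by (elim carrier_clE)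
        have "0 \<le> N (h k - d k)" for k using C_in[OF h(1)] C_in[OF dC] by (intro N_nonneg) auto
        then show ?thesis
          using norm_cl_lim[OF C_diff[OF h(1) dC]] unfolding h minus_cl[OF h(1) dC]
          by (intro LIMSEQ_le_const) auto
      qed
      ultimately show ?thesis
        using dk[of n] M1[of n] M2[of n] n norm_diff_comm_A[OF clA dA[of n]] e by simp
    qed
    then show "\<exists>M. \<forall>n\<ge>M. norm (cnorm A (f n \<ominus>\<^bsub>A\<^esub> cl d) - 0) < e" by blast
  qed
  then show ?thesis using dC by blast
qed

theorem cstar_completion: "cstar_algebra A"
proof (intro cstar_algebra.intro ring_A cstar_algebra_axioms.intro)
  fix x y assume x: "x \<in> carrier A" and y: "y \<in> carrier A"
  from x y obtain f g where fg: "f \<in> C" "x = cl f" "g \<in> C" "y = cl g" by (auto elim!: carrier_clE)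
  show "cnorm A (x \<otimes>\<^bsub>A\<^esub> y) \<le> cnorm A x * cnorm A y"
    unfolding fg mult_cl[OF fg(1,3)]
    by (rule LIMSEQ_le[OF norm_cl_lim[OF C_mult] tendsto_mult[OF norm_cl_lim norm_cl_lim]])
      (use fg(1,3) C_in[OF fg(1)] C_in[OF fg(3)] in \<open>auto intro!: submult\<close>)
next
  fix x c assume "x \<in> carrier A"
  then obtain f where f: "f \<in> C" "x = cl f" by (elim carrier_clE)
  have "(\<lambda>n. N (fscale c (f n))) \<longlonglongrightarrow> cnorm A (scale A c x)"
    unfolding f scale_cl[OF f(1)] by (rule norm_cl_lim[OF C_scale[OF f(1)]])
  moreover have "(\<lambda>n. cmod c * N (f n)) \<longlonglongrightarrow> cmod c * cnorm A x"
    unfolding f by (intro tendsto_intros norm_cl_lim f)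
  ultimately show "cnorm A (scale A c x) = cmod c * cnorm A x"
    using C_in[OF f(1)] by (simp add: homog LIMSEQ_unique)
next
  fix x assume "x \<in> carrier A"
  then obtain f where f: "f \<in> C" "x = cl f" by (elim carrier_clE)
  have "(\<lambda>n. N (fstar (f n) * f n)) \<longlonglongrightarrow> cnorm A (adj A x \<otimes>\<^bsub>A\<^esub> x)"
    unfolding f adj_cl[OF f(1)] mult_cl[OF C_star[OF f(1)] f(1)]
    by (rule norm_cl_lim[OF C_mult[OF C_star]]) (auto intro: f)
  moreover have "(\<lambda>n. (N (f n))\<^sup>2) \<longlonglongrightarrow> (cnorm A x)\<^sup>2"
    unfolding f by (intro tendsto_intros norm_cl_lim f)
  ultimately show "cnorm A (adj A x \<otimes>\<^bsub>A\<^esub> x) = (cnorm A x)\<^sup>2"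
    using C_in[OF f(1)] by (simp add: cstar LIMSEQ_unique)
next
  fix x assume "x \<in> carrier A" and n: "cnorm A x = 0"
  then obtain f where f: "f \<in> C" "x = cl f" by (elim carrier_clE)
  show "x = \<zero>\<^bsub>A\<^esub>"
    using norm_cl_lim[OF f(1)] n unfolding f zero_cl by (subst cl_eq_iff) (use f in auto)
qed (blast intro: norm_tri_A complete_A |
    (auto elim!: carrier_clE intro!: carrier_cl simp: scale_cl add_cl mult_cl adj_cl C_scale C_add C_mult C_star
      fscale_add_right fscale_add_left fscale_fscale fscale_mult_left fscale_mult_right
      fstar_add fstar_mult fstar_fscale)[1])+

end

lemma zero_admissible: "(\<lambda>_. 0) \<in> admissible X Rel"
  by (simp add: admissible_def cstar_seminorm_def)

lemma admissibleD: "p \<in> admissible X Rel \<Longrightarrow> cstar_seminorm_on X p"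
  by (simp add: admissible_def cstar_seminorm_on_def)

context
  fixes X :: "'x set" and Rel :: "'x free_star set"
  assumes bounded: "bounded_presentation X Rel"
begin

private abbreviation "u \<equiv> univ_norm X Rel"

lemma univ_norm_ge: "\<lbrakk>p \<in> admissible X Rel; x \<in> free_star_on X\<rbrakk> \<Longrightarrow> p x \<le> u x"
  unfolding univ_norm_def using bounded by (intro cSUP_upper) (auto simp: bounded_presentation_def)

lemma univ_norm_le: "(\<And>p. p \<in> admissible X Rel \<Longrightarrow> p x \<le> b) \<Longrightarrow> u x \<le> b"
  unfolding univ_norm_def using zero_admissible[of X Rel] by (intro cSUP_least) auto

lemma univ_norm_nonneg: "x \<in> free_star_on X \<Longrightarrow> 0 \<le> u x"
  using univ_norm_ge[OF zero_admissible] by simp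

lemma univ_norm_scale_le: "x \<in> free_star_on X \<Longrightarrow> u (fscale c x) \<le> cmod c * u x"
proof (rule univ_norm_le)
  fix p assume x: "x \<in> free_star_on X" and p: "p \<in> admissible X Rel"
  interpret cstar_seminorm_on X p by (rule admissibleD[OF p])
  show "p (fscale c x) \<le> cmod c * u x"
    using univ_norm_ge[OF p x] x by (simp add: homog mult_left_mono)
qed

theorem cstar_seminorm_univ_norm: "cstar_seminorm X u"
  unfolding cstar_seminorm_def
proof (intro conjI ballI allI)
  fix x y assume x: "x \<in> free_star_on X" and y: "y \<in> free_star_on X"
  show "u (x + y) \<le> u x + u y"
  proof (rule univ_norm_le)
    fix p assume p: "p \<in> admissible X Rel"
    interpret cstar_seminorm_on X p by (rule admissibleD[OF p])
    show "p (x + y) \<le> u x + u y"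
      using tri[OF x y] univ_norm_ge[OF p x] univ_norm_ge[OF p y] by linarith
  qed
  show "u (x * y) \<le> u x * u y"
  proof (rule univ_norm_le)
    fix p assume p: "p \<in> admissible X Rel"
    interpret cstar_seminorm_on X p by (rule admissibleD[OF p])
    have "p x * p y \<le> u x * u y"
      by (intro mult_mono univ_norm_ge p x y N_nonneg univ_norm_nonneg)
    then show "p (x * y) \<le> u x * u y"
      using submult[OF x y] by linarith
  qed
next
  fix x c assume x: "x \<in> free_star_on X"
  show "u (fscale c x) = cmod c * u x"
  proof (cases "c = 0")
    case True
    have "u (fscale c x) \<le> 0" "0 \<le> u (fscale c x)"
      using univ_norm_scale_le[OF x, of c] univ_norm_nonneg[OF free_star_on_fscale[OF x]] True
      by auto
    then show ?thesis using True by simp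
  next
    case False
    have "u x \<le> cmod (inverse c) * u (fscale c x)"
      using univ_norm_scale_le[OF free_star_on_fscale[OF x], of "inverse c" c] False
      by (simp add: fscale_fscale)
    then have "cmod c * u x \<le> u (fscale c x)"
      using False by (simp add: norm_inverse norm_divide field_simps)
    then show ?thesis using univ_norm_scale_le[OF x, of c] by simp
  qed
next
  fix x assume x: "x \<in> free_star_on X"
  have xx: "fstar x * x \<in> free_star_on X" using x by blast
  show "u (fstar x * x) = (u x)\<^sup>2"
  proof (rule antisym)
    show "u (fstar x * x) \<le> (u x)\<^sup>2"
    proof (rule univ_norm_le)
      fix p assume p: "p \<in> admissible X Rel"
      interpret cstar_seminorm_on X p by (rule admissibleD[OF p])
      show "p (fstar x * x) \<le> (u x)\<^sup>2"
        unfolding cstar[OF x] by (intro power_mono univ_norm_ge p x N_nonneg)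
    qed
    have "u x \<le> sqrt (u (fstar x * x))"
    proof (rule univ_norm_le)
      fix p assume p: "p \<in> admissible X Rel"
      interpret cstar_seminorm_on X p by (rule admissibleD[OF p])
      show "p x \<le> sqrt (u (fstar x * x))"
        using univ_norm_ge[OF p xx] unfolding cstar[OF x] by (rule real_le_rsqrt)
    qed
    then have "(u x)\<^sup>2 \<le> (sqrt (u (fstar x * x)))\<^sup>2"
      by (intro power_mono univ_norm_nonneg x)
    then show "(u x)\<^sup>2 \<le> u (fstar x * x)"
      using univ_norm_nonneg[OF xx] by simp
  qed
qed

theorem cstar_univ_cstar: "cstar_algebra (univ_cstar X Rel)"
  unfolding univ_cstar_def
  by (rule cstar_seminorm_on.cstar_completion) (simp add: cstar_seminorm_on_def cstar_seminorm_univ_norm)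

lemma univ_norm_rel: "r \<in> Rel \<Longrightarrow> u r = 0"
proof -
  assume "r \<in> Rel"
  then have "\<And>p. p \<in> admissible X Rel \<Longrightarrow> p r = 0" by (simp add: admissible_def)
  then have "(\<lambda>p. p r) ` admissible X Rel = {0}"
    using zero_admissible[of X Rel] by force
  then show ?thesis by (simp add: univ_norm_def)
qed

end

text \<open>Elementary consequences of the axioms of a C*-algebra.\<close>

context cstar_algebra
begin

lemma scale_zero_left: "x \<in> carrier A \<Longrightarrow> scale A 0 x = \<zero>"
  using scale_add_left[of x 0 0] scale_closed[of x 0] by simp

lemma scale_minus_one: "x \<in> carrier A \<Longrightarrow> scale A (-1) x = \<ominus> x"
proof -
  assume x: "x \<in> carrier A"
  have "scale A (-1) x \<oplus> x = \<zero>"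
    using scale_add_left[OF x, of "-1" 1] x by (simp add: scale_zero_left scale_one)
  from minus_equality[OF this x scale_closed[OF x]] show ?thesis by simp
qed

lemma scale_zero_right: "scale A c \<zero> = \<zero>"
  using scale_add_right[of \<zero> \<zero> c] scale_closed[of \<zero> c] by simp

lemma scale_uminus: "x \<in> carrier A \<Longrightarrow> scale A c (\<ominus> x) = \<ominus> scale A c x"
  by (simp add: scale_minus_one[symmetric] scale_closed scale_scale)

lemma scale_diff: "\<lbrakk>x \<in> carrier A; y \<in> carrier A\<rbrakk> \<Longrightarrow> scale A c (x \<ominus> y) = scale A c x \<ominus> scale A c y"
  by (simp add: a_minus_def scale_add_right scale_uminus)

lemma adj_uminus: "x \<in> carrier A \<Longrightarrow> adj A (\<ominus> x) = \<ominus> adj A x"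
  using adj_scale[of x "-1"] by (simp add: scale_minus_one adj_closed)

lemma adj_diff: "\<lbrakk>x \<in> carrier A; y \<in> carrier A\<rbrakk> \<Longrightarrow> adj A (x \<ominus> y) = adj A x \<ominus> adj A y"
  by (simp add: a_minus_def adj_add adj_uminus)

lemma adj_one: "adj A \<one> = \<one>"
  using adj_mult[of "adj A \<one>" \<one>] adj_adj[of \<one>] adj_closed[of \<one>] by simp

lemma adj_zero: "adj A \<zero> = \<zero>"
  using adj_add[of \<zero> \<zero>] adj_closed[of \<zero>] by simp

lemma cnorm_zero: "cnorm A \<zero> = 0"
  using cnorm_scale[of \<zero> 0] by (simp add: scale_zero_right)

lemma cnorm_uminus: "x \<in> carrier A \<Longrightarrow> cnorm A (\<ominus> x) = cnorm A x"
  using cnorm_scale[of x "-1"] by (simp add: scale_minus_one)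

lemma cnorm_nonneg: "x \<in> carrier A \<Longrightarrow> 0 \<le> cnorm A x"
  using cnorm_triangle[of x "\<ominus> x"] by (simp add: cnorm_uminus cnorm_zero r_neg)

lemma minus_uminus: "\<lbrakk>x \<in> carrier A; y \<in> carrier A\<rbrakk> \<Longrightarrow> \<ominus> (x \<ominus> y) = y \<ominus> x"
  by (simp add: a_minus_def minus_add a_comm)

lemma cnorm_minus_commute: "\<lbrakk>x \<in> carrier A; y \<in> carrier A\<rbrakk> \<Longrightarrow> cnorm A (x \<ominus> y) = cnorm A (y \<ominus> x)"
  by (metis cnorm_uminus minus_closed minus_uminus)

lemma cnorm_triangle3:
  assumes "x \<in> carrier A" "y \<in> carrier A" "z \<in> carrier A"
  shows "cnorm A (x \<ominus> z) \<le> cnorm A (x \<ominus> y) + cnorm A (y \<ominus> z)"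
proof -
  have "(x \<ominus> y) \<oplus> (y \<ominus> z) = x \<ominus> z"
    using assms by (simp add: a_minus_def a_assoc r_neg1 r_neg2)
  then show ?thesis using cnorm_triangle[of "x \<ominus> y" "y \<ominus> z"] assms by simp
qed

lemma cnorm_le_add: "\<lbrakk>x \<in> carrier A; y \<in> carrier A\<rbrakk> \<Longrightarrow> cnorm A x \<le> cnorm A (x \<ominus> y) + cnorm A y"
  using cnorm_triangle3[of x y \<zero>] by (simp add: a_minus_def)

lemma cnorm_adj_ge: "x \<in> carrier A \<Longrightarrow> cnorm A x \<le> cnorm A (adj A x)"
proof -
  assume x: "x \<in> carrier A"
  then have "cnorm A x * cnorm A x \<le> cnorm A (adj A x) * cnorm A x"
    using cnorm_cstar[of x] cnorm_mult[of "adj A x" x] by (auto simp: power2_eq_square adj_closed)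
  then show ?thesis
    using cnorm_nonneg[OF x] cnorm_nonneg[OF adj_closed[OF x]] by (cases "cnorm A x = 0") auto
qed

lemma cnorm_adj: "x \<in> carrier A \<Longrightarrow> cnorm A (adj A x) = cnorm A x"
  by (metis adj_adj adj_closed cnorm_adj_ge order_antisym)

lemma minus_eq_zeroD: "\<lbrakk>x \<in> carrier A; y \<in> carrier A; x \<ominus> y = \<zero>\<rbrakk> \<Longrightarrow> x = y"
proof -
  assume xy: "x \<in> carrier A" "y \<in> carrier A" and z: "x \<ominus> y = \<zero>"
  have "(x \<ominus> y) \<oplus> y = x" using xy by (simp add: a_minus_def a_assoc l_neg)
  then show ?thesis using xy z by simp
qed

definition conv :: "(nat \<Rightarrow> 'a) \<Rightarrow> 'a \<Rightarrow> bool" where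
  "conv f x \<longleftrightarrow> (\<forall>n. f n \<in> carrier A) \<and> x \<in> carrier A \<and> (\<lambda>n. cnorm A (f n \<ominus> x)) \<longlonglongrightarrow> 0"

lemma convD: "conv f x \<Longrightarrow> f n \<in> carrier A" "conv f x \<Longrightarrow> x \<in> carrier A"
  "conv f x \<Longrightarrow> (\<lambda>n. cnorm A (f n \<ominus> x)) \<longlonglongrightarrow> 0"
  by (auto simp: conv_def)

lemma conv_const: "x \<in> carrier A \<Longrightarrow> conv (\<lambda>_. x) x"
  by (simp add: conv_def cnorm_zero a_minus_def r_neg)

lemma convI:
  assumes "\<And>n. f n \<in> carrier A" "x \<in> carrier A" "\<And>n. cnorm A (f n \<ominus> x) \<le> h n" "h \<longlonglongrightarrow> 0"
  shows "conv f x"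
proof -
  have "(\<lambda>n. cnorm A (f n \<ominus> x)) \<longlonglongrightarrow> 0"
    by (rule tendsto_sandwich[OF _ _ tendsto_const assms(4)])
      (auto intro!: always_eventually cnorm_nonneg minus_closed assms(1,2,3))
  then show ?thesis using assms by (simp add: conv_def)
qed

lemma conv_unique: assumes "conv f x" "conv f y" shows "x = y"
proof -
  note [simp] = convD(1)[OF assms(1)] convD(2)[OF assms(1)] convD(2)[OF assms(2)]
  have "(\<lambda>n. cnorm A (f n \<ominus> x) + cnorm A (f n \<ominus> y)) \<longlonglongrightarrow> 0 + 0"
    by (intro tendsto_add convD assms)
  moreover have "cnorm A (x \<ominus> y) \<le> cnorm A (f n \<ominus> x) + cnorm A (f n \<ominus> y)" for n
    using cnorm_triangle3[of x "f n" y] cnorm_minus_commute[of x "f n"] by simp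
  ultimately have "cnorm A (x \<ominus> y) \<le> 0"
    by (intro LIMSEQ_le_const[where X = "\<lambda>n. cnorm A (f n \<ominus> x) + cnorm A (f n \<ominus> y)"]) auto
  then have "x \<ominus> y = \<zero>" using cnorm_nonneg[of "x \<ominus> y"] by (intro cnorm_eq_zero) auto
  then show ?thesis using minus_eq_zeroD[of x y] by simp
qed

lemma conv_add: assumes "conv f x" "conv g y" shows "conv (\<lambda>n. f n \<oplus> g n) (x \<oplus> y)"
proof (rule convI)
  note [simp] = convD(1)[OF assms(1)] convD(2)[OF assms(1)] convD(1)[OF assms(2)] convD(2)[OF assms(2)]
  show "f n \<oplus> g n \<in> carrier A" "x \<oplus> y \<in> carrier A" for n by simp_all
  have "(f n \<oplus> g n) \<ominus> (x \<oplus> y) = (f n \<ominus> x) \<oplus> (g n \<ominus> y)" for n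
    by (simp add: a_minus_def minus_add a_ac)
  then show "cnorm A ((f n \<oplus> g n) \<ominus> (x \<oplus> y)) \<le> cnorm A (f n \<ominus> x) + cnorm A (g n \<ominus> y)" for n
    using cnorm_triangle[of "f n \<ominus> x" "g n \<ominus> y"] by simp
  show "(\<lambda>n. cnorm A (f n \<ominus> x) + cnorm A (g n \<ominus> y)) \<longlonglongrightarrow> 0"
    using tendsto_add[OF convD(3)[OF assms(1)] convD(3)[OF assms(2)]] by simp
qed

lemma conv_scale: assumes "conv f x" shows "conv (\<lambda>n. scale A c (f n)) (scale A c x)"
  by (rule convI[where h = "\<lambda>n. cmod c * cnorm A (f n \<ominus> x)"])
    (use convD[OF assms] in \<open>auto simp: scale_closed scale_diff[symmetric] cnorm_scale
      intro!: tendsto_mult_right_zero\<close>)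

lemma conv_adj: assumes "conv f x" shows "conv (\<lambda>n. adj A (f n)) (adj A x)"
  by (rule convI[where h = "\<lambda>n. cnorm A (f n \<ominus> x)"])
    (use convD[OF assms] in \<open>auto simp: adj_closed adj_diff[symmetric] cnorm_adj\<close>)

lemma mult_diff_decomp:
  assumes "a \<in> carrier A" "b \<in> carrier A" "c \<in> carrier A" "d \<in> carrier A"
  shows "a \<otimes> b \<ominus> c \<otimes> d = (a \<ominus> c) \<otimes> b \<oplus> c \<otimes> (b \<ominus> d)"
proof -
  have "(a \<ominus> c) \<otimes> b \<oplus> c \<otimes> (b \<ominus> d) = a \<otimes> b \<oplus> (\<ominus> (c \<otimes> b) \<oplus> (c \<otimes> b \<oplus> \<ominus> (c \<otimes> d)))"
    using assms by (simp add: a_minus_def l_distr r_distr l_minus r_minus a_assoc)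
  then show ?thesis using assms by (simp add: a_minus_def r_neg1)
qed

lemma cnorm_mult_diff:
  assumes "a \<in> carrier A" "b \<in> carrier A" "c \<in> carrier A" "d \<in> carrier A"
  shows "cnorm A (a \<otimes> b \<ominus> c \<otimes> d) \<le> cnorm A (a \<ominus> c) * cnorm A b + cnorm A c * cnorm A (b \<ominus> d)"
proof -
  have "cnorm A (a \<otimes> b \<ominus> c \<otimes> d) \<le> cnorm A ((a \<ominus> c) \<otimes> b) + cnorm A (c \<otimes> (b \<ominus> d))"
    unfolding mult_diff_decomp[OF assms] using assms by (intro cnorm_triangle) auto
  also have "\<dots> \<le> cnorm A (a \<ominus> c) * cnorm A b + cnorm A c * cnorm A (b \<ominus> d)"
    using assms by (intro add_mono cnorm_mult) auto
  finally show ?thesis .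
qed

lemma conv_norm: assumes "conv f x" shows "(\<lambda>n. cnorm A (f n)) \<longlonglongrightarrow> cnorm A x"
proof -
  note [simp] = convD(1)[OF assms] convD(2)[OF assms]
  have "norm (cnorm A (f n) - cnorm A x) \<le> norm (cnorm A (f n \<ominus> x)) * 1" for n
    using cnorm_le_add[of "f n" x] cnorm_le_add[of x "f n"] cnorm_minus_commute[of x "f n"] by simp
  then have "(\<lambda>n. cnorm A (f n) - cnorm A x) \<longlonglongrightarrow> 0"
    by (intro tendsto_0_le[where K = 1, OF convD(3)[OF assms]] always_eventually) blast
  then show ?thesis by (simp add: LIM_zero_iff)
qed

lemma conv_mult: assumes "conv f x" "conv g y" shows "conv (\<lambda>n. f n \<otimes> g n) (x \<otimes> y)"
proof (rule convI)
  note [simp] = convD(1)[OF assms(1)] convD(2)[OF assms(1)] convD(1)[OF assms(2)] convD(2)[OF assms(2)]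
  show "f n \<otimes> g n \<in> carrier A" "x \<otimes> y \<in> carrier A" for n by simp_all
  show "cnorm A (f n \<otimes> g n \<ominus> x \<otimes> y) \<le> cnorm A (f n \<ominus> x) * cnorm A (g n) + cnorm A x * cnorm A (g n \<ominus> y)" for n
    by (intro cnorm_mult_diff) auto
  have "(\<lambda>n. cnorm A (f n \<ominus> x) * cnorm A (g n) + cnorm A x * cnorm A (g n \<ominus> y))
      \<longlonglongrightarrow> 0 * cnorm A y + cnorm A x * 0"
    by (intro tendsto_intros convD(3) conv_norm assms)
  then show "(\<lambda>n. cnorm A (f n \<ominus> x) * cnorm A (g n) + cnorm A x * cnorm A (g n \<ominus> y)) \<longlonglongrightarrow> 0"
    by simp
qed

end


section \<open>The universal property\<close>

context cstar_algebra
begin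

context
  fixes X :: "'x set" and \<phi> :: "'x \<Rightarrow> 'a"
  assumes \<phi>: "\<phi> \<in> X \<rightarrow> carrier A"
begin

private abbreviation "good w \<equiv> letter_gen ` set (letters w) \<subseteq> X"

lemma eval_letter_closed: "letter_gen l \<in> X \<Longrightarrow> eval_letter A \<phi> l \<in> carrier A"
  using \<phi> by (cases l) (auto intro: adj_closed)

lemma eval_letter_adj: "letter_gen l \<in> X \<Longrightarrow> eval_letter A \<phi> (adj_letter l) = adj A (eval_letter A \<phi> l)"
  using \<phi> adj_adj[symmetric] by (cases l) auto

lemma eval_fold_closed:
  "letter_gen ` set ls \<subseteq> X \<Longrightarrow> foldr (\<lambda>l a. eval_letter A \<phi> l \<otimes> a) ls \<one> \<in> carrier A"
  by (induction ls) (auto intro: eval_letter_closed)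

lemma eval_fold_append:
  "letter_gen ` set ls \<subseteq> X \<Longrightarrow> letter_gen ` set ks \<subseteq> X \<Longrightarrow>
   foldr (\<lambda>l a. eval_letter A \<phi> l \<otimes> a) (ls @ ks) \<one> =
   foldr (\<lambda>l a. eval_letter A \<phi> l \<otimes> a) ls \<one> \<otimes> foldr (\<lambda>l a. eval_letter A \<phi> l \<otimes> a) ks \<one>"
proof (induction ls)
  case Nil
  then show ?case using eval_fold_closed[of ks] by simp
next
  case (Cons l ls)
  then show ?case
    using eval_fold_closed[of ks] eval_fold_closed[of ls] eval_letter_closed[of l]
    by (simp add: m_assoc)
qed

lemma eval_fold_adj:
  "letter_gen ` set ls \<subseteq> X \<Longrightarrow>
   foldr (\<lambda>l a. eval_letter A \<phi> l \<otimes> a) (rev (map adj_letter ls)) \<one> =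
   adj A (foldr (\<lambda>l a. eval_letter A \<phi> l \<otimes> a) ls \<one>)"
proof (induction ls)
  case Nil
  then show ?case by (simp add: adj_one)
next
  case (Cons l ls)
  have "letter_gen ` set (rev (map adj_letter ls)) \<subseteq> X" "letter_gen ` set [adj_letter l] \<subseteq> X"
    using Cons.prems by auto
  from eval_fold_append[OF this] Cons show ?case
    using eval_fold_closed[of ls] eval_letter_closed[of l] eval_letter_closed[of "adj_letter l"]
    by (simp add: eval_letter_adj adj_mult)
qed

lemma eval_word_closed: "good w \<Longrightarrow> eval_word A \<phi> w \<in> carrier A"
  unfolding eval_word_def by (rule eval_fold_closed)

lemma eval_word_zero: "eval_word A \<phi> 0 = \<one>"
  by (simp add: eval_word_def)

lemma eval_word_add: "good v \<Longrightarrow> good w \<Longrightarrow> eval_word A \<phi> (v + w) = eval_word A \<phi> v \<otimes> eval_word A \<phi> w"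
  unfolding eval_word_def letters_simps by (rule eval_fold_append)

lemma eval_word_adj: "good w \<Longrightarrow> eval_word A \<phi> (adj_word w) = adj A (eval_word A \<phi> w)"
  unfolding eval_word_def letters_simps by (rule eval_fold_adj)

lemma eval_poly_superset:
  assumes "finite W" "Poly_Mapping.keys p \<subseteq> W" "\<And>w. w \<in> W \<Longrightarrow> good w"
  shows "eval_poly A \<phi> p = (\<Oplus>w\<in>W. scale A (Poly_Mapping.lookup p w) (eval_word A \<phi> w))"
  unfolding eval_poly_def
  by (rule add.finprod_mono_neutral_cong_left)
    (use assms in \<open>auto simp: in_keys_iff intro!: scale_zero_left scale_closed eval_word_closed\<close>)

lemma good_keys: "p \<in> free_star_on X \<Longrightarrow> w \<in> Poly_Mapping.keys p \<Longrightarrow> good w"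
  by (simp add: free_star_on_def)

lemma eval_closed: "p \<in> free_star_on X \<Longrightarrow> eval_poly A \<phi> p \<in> carrier A"
  unfolding eval_poly_def
  by (rule finsum_closed) (use good_keys in \<open>auto intro!: scale_closed eval_word_closed\<close>)

lemma eval_zero: "eval_poly A \<phi> 0 = \<zero>"
  by (simp add: eval_poly_def)

lemma eval_single: "good w \<Longrightarrow> eval_poly A \<phi> (Poly_Mapping.single w c) = scale A c (eval_word A \<phi> w)"
  using eval_poly_superset[of "{w}" "Poly_Mapping.single w c"] eval_word_closed[of w]
    scale_closed[of "eval_word A \<phi> w" c] by (simp add: finsum_insert)

lemma eval_add:
  assumes "p \<in> free_star_on X" "q \<in> free_star_on X"
  shows "eval_poly A \<phi> (p + q) = eval_poly A \<phi> p \<oplus> eval_poly A \<phi> q"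
proof -
  let ?W = "Poly_Mapping.keys p \<union> Poly_Mapping.keys q"
  have W: "finite ?W" and g: "\<And>w. w \<in> ?W \<Longrightarrow> good w" using assms good_keys by auto
  have "eval_poly A \<phi> (p + q) = (\<Oplus>w\<in>?W. scale A (Poly_Mapping.lookup (p + q) w) (eval_word A \<phi> w))"
    by (rule eval_poly_superset[OF W Poly_Mapping.keys_add g])
  also have "\<dots> = (\<Oplus>w\<in>?W. scale A (Poly_Mapping.lookup p w) (eval_word A \<phi> w) \<oplus>
      scale A (Poly_Mapping.lookup q w) (eval_word A \<phi> w))"
    by (rule finsum_cong')
      (use g in \<open>auto simp: lookup_add scale_add_left eval_word_closed scale_closed\<close>)
  also have "\<dots> = (\<Oplus>w\<in>?W. scale A (Poly_Mapping.lookup p w) (eval_word A \<phi> w)) \<oplus>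
      (\<Oplus>w\<in>?W. scale A (Poly_Mapping.lookup q w) (eval_word A \<phi> w))"
    by (rule finsum_addf) (use g in \<open>auto intro!: scale_closed eval_word_closed\<close>)
  also have "\<dots> = eval_poly A \<phi> p \<oplus> eval_poly A \<phi> q"
    using eval_poly_superset[OF W _ g, of p] eval_poly_superset[OF W _ g, of q] by simp
  finally show ?thesis .
qed

lemma eval_scale: "p \<in> free_star_on X \<Longrightarrow> eval_poly A \<phi> (fscale c p) = scale A c (eval_poly A \<phi> p)"
proof (induction p rule: free_star_induct)
  case zero
  then show ?case by (simp add: fscale_conv eval_zero scale_zero_right)
next
  case (single w d)
  have "fscale c (Poly_Mapping.single w d) = Poly_Mapping.single w (c * d)"
    by (simp add: fscale_conv mult_single)
  then show ?case using single by (simp add: eval_single scale_scale eval_word_closed)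
next
  case (add p q)
  then show ?case
    by (simp add: fscale_add_right eval_add free_star_on_fscale scale_add_right eval_closed)
qed

lemma eval_diff:
  assumes "p \<in> free_star_on X" "q \<in> free_star_on X"
  shows "eval_poly A \<phi> (p - q) = eval_poly A \<phi> p \<ominus> eval_poly A \<phi> q"
  using eval_add[OF assms(1) free_star_on_fscale[OF assms(2)], of "-1"] eval_scale[OF assms(2), of "-1"]
  by (simp add: fscale_minus_one scale_minus_one eval_closed assms a_minus_def)

lemma eval_star: "p \<in> free_star_on X \<Longrightarrow> eval_poly A \<phi> (fstar p) = adj A (eval_poly A \<phi> p)"
proof (induction p rule: free_star_induct)
  case zero
  then show ?case by (simp add: eval_zero adj_zero)
next
  case (single w d)
  then have "good (adj_word w)" by auto
  then show ?case
    using single by (simp add: fstar_single eval_single eval_word_adj adj_scale eval_word_closed)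
next
  case (add p q)
  then show ?case
    by (simp add: fstar_add eval_add free_star_on_fstar adj_add eval_closed)
qed

lemma eval_mult:
  assumes p: "p \<in> free_star_on X" and q: "q \<in> free_star_on X"
  shows "eval_poly A \<phi> (p * q) = eval_poly A \<phi> p \<otimes> eval_poly A \<phi> q"
  using p
proof (induction p rule: free_star_induct)
  case zero
  then show ?case using q by (simp add: eval_zero eval_closed)
next
  case (single v c)
  note v = single
  show ?case using q
  proof (induction q rule: free_star_induct)
    case zero
    then show ?case using v by (simp add: eval_zero eval_closed free_star_on_single)
  next
    case (single w d)
    then have "good (v + w)" using v by auto
    then show ?case
      using v single
      by (simp add: mult_single eval_single eval_word_add scale_mult_left scale_mult_right
          eval_word_closed scale_closed scale_scale mult.commute)
  next
    case (add p q)
    then show ?case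
      using v
      by (simp add: distrib_left eval_add free_star_on_mult free_star_on_single eval_closed r_distr)
  qed
next
  case (add p r)
  then show ?case
    using q by (simp add: distrib_right eval_add free_star_on_mult eval_closed l_distr)
qed

lemma eval_fgen: "x \<in> X \<Longrightarrow> eval_poly A \<phi> (fgen x) = \<phi> x"
proof -
  assume x: "x \<in> X"
  then have "\<phi> x \<in> carrier A" using \<phi> by blast
  then show ?thesis using x by (simp add: fgen_def eval_single scale_one eval_word_def)
qed

lemma eval_one: "eval_poly A \<phi> 1 = \<one>"
  using eval_single[of 0 1] by (simp add: eval_word_zero scale_one)

lemma cstar_seminorm_eval: "cstar_seminorm X (\<lambda>p. cnorm A (eval_poly A \<phi> p))"
  unfolding cstar_seminorm_def
  by (simp add: eval_add eval_mult eval_scale eval_star eval_closed free_star_on_fstar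
      cnorm_triangle cnorm_mult cnorm_scale cnorm_cstar)

end

text \<open>Square roots, unitary decomposition and automatic continuity of *-homomorphisms.\<close>

lemma selfadjoint_sqrt:
  assumes x: "x \<in> carrier A" "adj A x = x" "cnorm A x < 1"
  shows "\<exists>z\<in>carrier A. adj A z = z \<and> z \<otimes> x = x \<otimes> z \<and> z \<otimes> z = \<one> \<ominus> x \<otimes> x"
proof -
  define a where "a = x \<otimes> x"
  define q where "q = cnorm A a"
  have a: "a \<in> carrier A" "adj A a = a" "a \<otimes> x = x \<otimes> a"
    using x by (auto simp: a_def adj_mult m_assoc)
  have "q = (cnorm A x)\<^sup>2" using cnorm_cstar[OF x(1)] x by (simp add: q_def a_def)
  then have q: "0 \<le> q" "q < 1"
    using x cnorm_nonneg[OF x(1)] by (simp_all add: power_less_one_iff abs_square_less_1)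
  define y where "y = rec_nat \<zero> (\<lambda>_ t. scale A (1/2) (a \<oplus> t \<otimes> t))"
  have y0: "y 0 = \<zero>" and yS: "y (Suc n) = scale A (1/2) (a \<oplus> y n \<otimes> y n)" for n
    by (simp_all add: y_def)
  have yc: "y n \<in> carrier A" for n
    by (induction n) (auto simp: y0 yS a intro!: scale_closed)
  have ya: "adj A (y n) = y n" for n
    by (induction n) (auto simp: y0 yS a adj_zero adj_scale adj_add adj_mult yc)
  have yx: "y n \<otimes> x = x \<otimes> y n" for n
  proof (induction n)
    case (Suc n)
    have "(y n \<otimes> y n) \<otimes> x = x \<otimes> (y n \<otimes> y n)"
      using Suc yc[of n] x by (metis m_assoc)
    then show ?case
      using yc[of n] x a by (simp add: yS scale_mult_left scale_mult_right l_distr r_distr)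
  qed (use x in \<open>simp add: y0\<close>)
  have yn: "cnorm A (y n) \<le> q" for n
  proof (induction n)
    case (Suc n)
    have "cnorm A (y (Suc n)) = 1/2 * cnorm A (a \<oplus> y n \<otimes> y n)"
      using yc[of n] a by (simp add: yS cnorm_scale)
    also have "\<dots> \<le> 1/2 * (q + cnorm A (y n) * cnorm A (y n))"
      using cnorm_triangle[of a "y n \<otimes> y n"] cnorm_mult[of "y n" "y n"] yc[of n] a
      by (simp add: q_def)
    also have "\<dots> \<le> 1/2 * (q + q * 1)"
      using Suc q cnorm_nonneg[OF yc, of n]
      by (intro mult_left_mono add_left_mono mult_mono) auto
    finally show ?case by simp
  qed (use q in \<open>simp add: y0 cnorm_zero\<close>)
  have step: "cnorm A (y (Suc n) \<ominus> y n) \<le> q ^ n * q" for n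
  proof (induction n)
    case 0
    have "cnorm A (y (Suc 0) \<ominus> y 0) = 1/2 * q"
      using a by (simp add: yS y0 a_minus_def cnorm_scale q_def scale_closed)
    then show ?case using q by simp
  next
    case (Suc n)
    let ?b = "y (Suc n)" and ?c = "y n"
    have "y (Suc (Suc n)) \<ominus> y (Suc n) = scale A (1/2) ((a \<oplus> ?b \<otimes> ?b) \<ominus> (a \<oplus> ?c \<otimes> ?c))"
      unfolding yS[of "Suc n"] using yc[of n] yc[of "Suc n"] a yS[of n] by (simp add: scale_diff)
    also have "(a \<oplus> ?b \<otimes> ?b) \<ominus> (a \<oplus> ?c \<otimes> ?c) = ?b \<otimes> ?b \<ominus> ?c \<otimes> ?c"
      using yc[of n] yc[of "Suc n"] a
      by (simp add: a_minus_def minus_add a_ac r_neg1 r_neg2)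
    finally have "cnorm A (y (Suc (Suc n)) \<ominus> y (Suc n)) = 1/2 * cnorm A (?b \<otimes> ?b \<ominus> ?c \<otimes> ?c)"
      using yc[of n] yc[of "Suc n"] by (simp add: cnorm_scale)
    also have "\<dots> \<le> 1/2 * (cnorm A (?b \<ominus> ?c) * cnorm A ?b + cnorm A ?c * cnorm A (?b \<ominus> ?c))"
      using cnorm_mult_diff[of ?b ?b ?c ?c] yc by simp
    also have "\<dots> \<le> 1/2 * (cnorm A (?b \<ominus> ?c) * q + q * cnorm A (?b \<ominus> ?c))"
      using yn[of n] yn[of "Suc n"] cnorm_nonneg[of "?b \<ominus> ?c"] yc
      by (intro mult_left_mono add_mono mult_right_mono) auto
    also have "\<dots> = q * cnorm A (?b \<ominus> ?c)" by simp
    also have "\<dots> \<le> q * (q ^ n * q)" using Suc q by (intro mult_left_mono) auto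
    finally show ?case by simp
  qed
  have dist: "cnorm A (y (n + k) \<ominus> y n) \<le> q ^ n * (q / (1 - q))" for n k
  proof -
    have "cnorm A (y (n + k) \<ominus> y n) \<le> (\<Sum>i<k. q ^ (n + i) * q)"
    proof (induction k)
      case 0
      then show ?case using yc[of n] by (simp add: a_minus_def r_neg cnorm_zero)
    next
      case (Suc k)
      have "cnorm A (y (Suc (n + k)) \<ominus> y n) \<le>
          cnorm A (y (Suc (n + k)) \<ominus> y (n + k)) + cnorm A (y (n + k) \<ominus> y n)"
        by (intro cnorm_triangle3 yc)
      then show ?case using Suc step[of "n + k"] by simp
    qed
    also have "\<dots> = q ^ n * q * (\<Sum>i<k. q ^ i)"
      by (simp add: sum_distrib_left power_add mult_ac)
    also have "\<dots> \<le> q ^ n * q * (1 / (1 - q))"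
    proof (intro mult_left_mono)
      have "(\<Sum>i<k. q ^ i) = (1 - q ^ k) / (1 - q)"
        using q by (simp add: sum_gp_strict)
      also have "\<dots> \<le> 1 / (1 - q)" using q by (intro divide_right_mono) auto
      finally show "(\<Sum>i<k. q ^ i) \<le> 1 / (1 - q)" .
    qed (use q in auto)
    finally show ?thesis by simp
  qed
  have lim0: "(\<lambda>n. q ^ n * (q / (1 - q))) \<longlonglongrightarrow> 0"
    using q by (intro tendsto_mult_left_zero LIMSEQ_power_zero) auto
  have "\<forall>e>0. \<exists>M. \<forall>m\<ge>M. \<forall>n\<ge>M. cnorm A (y m \<ominus> y n) < e"
  proof (intro allI impI)
    fix e :: real assume e: "e > 0"
    obtain M where M: "\<And>n. n \<ge> M \<Longrightarrow> norm (q ^ n * (q / (1 - q)) - 0) < e"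
      using LIMSEQ_D[OF lim0 e] by blast
    have main: "cnorm A (y m \<ominus> y n) < e" if "n \<ge> M" "m \<ge> n" for m n
    proof -
      have "cnorm A (y m \<ominus> y n) \<le> q ^ n * (q / (1 - q))"
        using dist[of n "m - n"] that by simp
      also have "\<dots> < e" using M[OF that(1)] unfolding real_norm_def diff_0_right
        by (rule order_le_less_trans[OF abs_ge_self])
      finally show ?thesis .
    qed
    have "cnorm A (y m \<ominus> y n) < e" if "m \<ge> M" "n \<ge> M" for m n
      using main[of n m] main[of m n] that cnorm_minus_commute[OF yc yc, of m n]
      by (cases "m \<ge> n") auto
    then show "\<exists>M. \<forall>m\<ge>M. \<forall>n\<ge>M. cnorm A (y m \<ominus> y n) < e" by blast
  qed
  from complete[OF yc this] obtain t where t: "t \<in> carrier A" "(\<lambda>n. cnorm A (y n \<ominus> t)) \<longlonglongrightarrow> 0"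
    by blast
  then have ct: "conv y t" using yc by (simp add: conv_def)
  have "conv (\<lambda>n. y (Suc n)) t"
    using t yc LIMSEQ_Suc[OF t(2)] by (simp add: conv_def)
  moreover have "conv (\<lambda>n. y (Suc n)) (scale A (1/2) (a \<oplus> t \<otimes> t))"
    unfolding yS by (intro conv_scale conv_add conv_mult ct conv_const a)
  ultimately have teq: "t = scale A (1/2) (a \<oplus> t \<otimes> t)" by (rule conv_unique)
  have "scale A 2 t = a \<oplus> t \<otimes> t"
    using arg_cong[OF teq, of "scale A 2"] t a by (simp add: scale_scale scale_one)
  then have tt: "t \<oplus> t = a \<oplus> t \<otimes> t"
    using scale_add_left[OF t(1), of 1 1] t by (simp add: scale_one)
  have "conv (\<lambda>n. adj A (y n)) (adj A t)" by (rule conv_adj[OF ct])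
  then have ta: "adj A t = t" unfolding ya using ct by (rule conv_unique)
  have "conv (\<lambda>n. y n \<otimes> x) (t \<otimes> x)" by (intro conv_mult ct conv_const x)
  moreover have "conv (\<lambda>n. y n \<otimes> x) (x \<otimes> t)" unfolding yx by (intro conv_mult ct conv_const x)
  ultimately have tx: "t \<otimes> x = x \<otimes> t" by (rule conv_unique)
  have "(\<one> \<ominus> t) \<otimes> (\<one> \<ominus> t) = \<one> \<ominus> (t \<oplus> t) \<oplus> t \<otimes> t"
    using t by (simp add: a_minus_def l_distr r_distr l_minus r_minus minus_add a_assoc)
  also have "\<dots> = \<one> \<ominus> a"
    unfolding tt using t a by (simp add: a_minus_def minus_add a_assoc l_neg)
  finally have "(\<one> \<ominus> t) \<otimes> (\<one> \<ominus> t) = \<one> \<ominus> x \<otimes> x" by (simp add: a_def)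
  moreover have "adj A (\<one> \<ominus> t) = \<one> \<ominus> t" using t by (simp add: adj_diff adj_one ta)
  moreover have "(\<one> \<ominus> t) \<otimes> x = x \<otimes> (\<one> \<ominus> t)"
    using t x tx by (simp add: a_minus_def l_distr r_distr l_minus r_minus)
  ultimately show ?thesis using t by (intro bexI[of _ "\<one> \<ominus> t"]) auto
qed

lemma cnorm_one: "cnorm A \<one> \<le> 1"
proof -
  have "cnorm A \<one> = (cnorm A \<one>)\<^sup>2" using cnorm_cstar[of \<one>] by (simp add: adj_one)
  then show ?thesis by (metis le_numeral_extra(4) mult_cancel_right1 power2_eq_square zero_le_one)
qed

lemma cnorm_isometry: "v \<in> carrier A \<Longrightarrow> adj A v \<otimes> v = \<one> \<Longrightarrow> cnorm A v \<le> 1"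
  using cnorm_cstar[of v] cnorm_one by (simp add: abs_square_le_1 cnorm_nonneg)

end

lemma star_homD:
  assumes "h \<in> star_hom A B"
  shows "x \<in> carrier A \<Longrightarrow> h x \<in> carrier B"
    and "x \<in> carrier A \<Longrightarrow> y \<in> carrier A \<Longrightarrow> h (x \<otimes>\<^bsub>A\<^esub> y) = h x \<otimes>\<^bsub>B\<^esub> h y"
    and "x \<in> carrier A \<Longrightarrow> y \<in> carrier A \<Longrightarrow> h (x \<oplus>\<^bsub>A\<^esub> y) = h x \<oplus>\<^bsub>B\<^esub> h y"
    and "h \<one>\<^bsub>A\<^esub> = \<one>\<^bsub>B\<^esub>"
    and "x \<in> carrier A \<Longrightarrow> h (scale A c x) = scale B c (h x)"
    and "x \<in> carrier A \<Longrightarrow> h (adj A x) = adj B (h x)"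
  using assms by (auto simp: star_hom_def ring_hom_memE)

lemma star_hom_diff:
  assumes "cstar_algebra A" "cstar_algebra B" "h \<in> star_hom A B" "x \<in> carrier A" "y \<in> carrier A"
  shows "h (x \<ominus>\<^bsub>A\<^esub> y) = h x \<ominus>\<^bsub>B\<^esub> h y"
proof -
  interpret A: cstar_algebra A by fact
  interpret B: cstar_algebra B by fact
  note h = star_homD[OF assms(3)]
  have "h (scale A (-1) y) = scale B (-1) (h y)" by (rule h(5)[OF assms(5)])
  then have "h (\<ominus>\<^bsub>A\<^esub> y) = \<ominus>\<^bsub>B\<^esub> h y"
    using assms h(1) by (simp add: A.scale_minus_one B.scale_minus_one)
  then show ?thesis using assms h by (simp add: a_minus_def)
qed

text \<open>Every *-homomorphism between C*-algebras is contractive.\<close>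

theorem star_hom_contractive:
  assumes "cstar_algebra A" "cstar_algebra B" and hom: "h \<in> star_hom A B" and x: "x \<in> carrier A"
  shows "cnorm B (h x) \<le> cnorm A x"
proof -
  interpret A: cstar_algebra A by fact
  interpret B: cstar_algebra B by fact
  note h = star_homD[OF hom]
  have sa1: "cnorm B (h a) \<le> 1"
    if a: "a \<in> carrier A" "adj A a = a" "cnorm A a < 1" for a
  proof -
    obtain z where z: "z \<in> carrier A" "adj A z = z" "z \<otimes>\<^bsub>A\<^esub> a = a \<otimes>\<^bsub>A\<^esub> z"
      "z \<otimes>\<^bsub>A\<^esub> z = \<one>\<^bsub>A\<^esub> \<ominus>\<^bsub>A\<^esub> a \<otimes>\<^bsub>A\<^esub> a"
      using A.selfadjoint_sqrt[OF a] by blast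
    define b c where "b = h a" and "c = h z"
    have bc: "b \<in> carrier B" "c \<in> carrier B" "adj B b = b" "adj B c = c" "c \<otimes>\<^bsub>B\<^esub> b = b \<otimes>\<^bsub>B\<^esub> c"
      using a z h(1,6)[of a] h(1,6)[of z] h(2)[of z a] h(2)[of a z] by (auto simp: b_def c_def)
    have cc: "c \<otimes>\<^bsub>B\<^esub> c = \<one>\<^bsub>B\<^esub> \<ominus>\<^bsub>B\<^esub> b \<otimes>\<^bsub>B\<^esub> b"
      using h(2)[of z z] h(2)[of a a] h(4) star_hom_diff[OF assms(1,2) hom, of "\<one>\<^bsub>A\<^esub>" "a \<otimes>\<^bsub>A\<^esub> a"] z a
      by (simp add: b_def c_def)
    have v: "cnorm B (b \<oplus>\<^bsub>B\<^esub> scale B k c) \<le> 1" if k: "k = \<i> \<or> k = - \<i>" for k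
    proof (rule B.cnorm_isometry)
      have kk: "cnj k = - k" "k * k = -1" using k by auto
      have d: "scale B k c \<in> carrier B" using bc by (simp add: B.scale_closed)
      have "adj B (b \<oplus>\<^bsub>B\<^esub> scale B k c) = b \<ominus>\<^bsub>B\<^esub> scale B k c"
        using bc d kk B.scale_scale[of c "-1" k] B.scale_minus_one[OF d]
        by (simp add: B.adj_add B.adj_scale a_minus_def)
      moreover have "(b \<ominus>\<^bsub>B\<^esub> scale B k c) \<otimes>\<^bsub>B\<^esub> (b \<oplus>\<^bsub>B\<^esub> scale B k c) =
          b \<otimes>\<^bsub>B\<^esub> b \<ominus>\<^bsub>B\<^esub> scale B k c \<otimes>\<^bsub>B\<^esub> scale B k c"
      proof -
        have "scale B k c \<otimes>\<^bsub>B\<^esub> b = b \<otimes>\<^bsub>B\<^esub> scale B k c"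
          using bc by (simp add: B.scale_mult_left B.scale_mult_right)
        then show ?thesis
          using bc d
          by (simp add: a_minus_def B.l_distr B.r_distr B.l_minus B.a_assoc B.r_neg1)
      qed
      moreover have "scale B k c \<otimes>\<^bsub>B\<^esub> scale B k c = \<ominus>\<^bsub>B\<^esub> (c \<otimes>\<^bsub>B\<^esub> c)"
        using bc kk by (simp add: B.scale_mult_left B.scale_mult_right B.scale_closed
            B.scale_scale B.scale_minus_one)
      moreover have "b \<otimes>\<^bsub>B\<^esub> b \<ominus>\<^bsub>B\<^esub> (\<ominus>\<^bsub>B\<^esub> (c \<otimes>\<^bsub>B\<^esub> c)) = \<one>\<^bsub>B\<^esub>"
        unfolding cc using bc by (simp add: a_minus_def B.r_neg1 B.r_neg B.a_ac)
      ultimately show "adj B (b \<oplus>\<^bsub>B\<^esub> scale B k c) \<otimes>\<^bsub>B\<^esub> (b \<oplus>\<^bsub>B\<^esub> scale B k c) = \<one>\<^bsub>B\<^esub>"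
        by simp
    qed (use bc in \<open>simp add: B.scale_closed\<close>)
    have "scale B 2 b = (b \<oplus>\<^bsub>B\<^esub> scale B \<i> c) \<oplus>\<^bsub>B\<^esub> (b \<oplus>\<^bsub>B\<^esub> scale B (-\<i>) c)"
    proof -
      have "scale B \<i> c \<oplus>\<^bsub>B\<^esub> scale B (-\<i>) c = \<zero>\<^bsub>B\<^esub>"
        using B.scale_add_left[OF bc(2), of \<i> "-\<i>"] bc by (simp add: B.scale_zero_left)
      moreover have "(b \<oplus>\<^bsub>B\<^esub> scale B \<i> c) \<oplus>\<^bsub>B\<^esub> (b \<oplus>\<^bsub>B\<^esub> scale B (-\<i>) c) =
          (b \<oplus>\<^bsub>B\<^esub> b) \<oplus>\<^bsub>B\<^esub> (scale B \<i> c \<oplus>\<^bsub>B\<^esub> scale B (-\<i>) c)"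
        using bc by (simp add: B.scale_closed B.a_ac)
      ultimately show ?thesis
        using B.scale_add_left[OF bc(1), of 1 1] bc by (simp add: B.scale_one)
    qed
    then have "2 * cnorm B b \<le> 1 + 1"
      using B.cnorm_scale[OF bc(1), of 2] v[of \<i>] v[of "-\<i>"]
        B.cnorm_triangle[of "b \<oplus>\<^bsub>B\<^esub> scale B \<i> c" "b \<oplus>\<^bsub>B\<^esub> scale B (-\<i>) c"] bc
      by (simp add: B.scale_closed)
    then show ?thesis by (simp add: b_def)
  qed
  have sa: "cnorm B (h a) \<le> cnorm A a" if a: "a \<in> carrier A" "adj A a = a" for a
  proof (rule field_le_epsilon)
    fix e :: real assume e: "e > 0"
    define t where "t = cnorm A a + e"
    have t: "t > 0" "cnorm A a < t" using e A.cnorm_nonneg[OF a(1)] by (auto simp: t_def)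
    have "cnorm B (h (scale A (complex_of_real (1/t)) a)) \<le> 1"
      by (rule sa1) (use a t in \<open>auto simp: A.scale_closed A.adj_scale A.cnorm_scale norm_divide\<close>)
    then have "cnorm B (h a) / t \<le> 1"
      using a t h(1)[of a] by (simp add: h(5) B.cnorm_scale norm_divide)
    then show "cnorm B (h a) \<le> cnorm A a + e" using t by (simp add: t_def)
  qed
  have "(cnorm B (h x))\<^sup>2 = cnorm B (h (adj A x \<otimes>\<^bsub>A\<^esub> x))"
    using B.cnorm_cstar[of "h x"] h x by (simp add: A.adj_closed)
  also have "\<dots> \<le> cnorm A (adj A x \<otimes>\<^bsub>A\<^esub> x)"
    by (rule sa) (use x in \<open>auto simp: A.adj_closed A.adj_mult A.adj_adj\<close>)
  also have "\<dots> = (cnorm A x)\<^sup>2" by (rule A.cnorm_cstar[OF x])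
  finally show ?thesis using A.cnorm_nonneg[OF x] by (rule power2_le_imp_le)
qed


lemma star_hom_eval:
  assumes "cstar_algebra A" "cstar_algebra B" and hom: "h \<in> star_hom A B"
    and \<phi>: "\<phi> \<in> X \<rightarrow> carrier A" and p: "p \<in> free_star_on X"
  shows "h (eval_poly A \<phi> p) = eval_poly B (\<lambda>x. h (\<phi> x)) p"
proof -
  interpret A: cstar_algebra A by fact
  interpret B: cstar_algebra B by fact
  note h = star_homD[OF hom]
  have h\<phi>: "(\<lambda>x. h (\<phi> x)) \<in> X \<rightarrow> carrier B"
    using funcset_mem[OF \<phi>] by (auto intro!: h(1))
  show ?thesis
    using p
  proof (induction p rule: free_star_induct)
    case zero
    have "h \<zero>\<^bsub>A\<^esub> = \<zero>\<^bsub>B\<^esub>"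
      using h(5)[of "\<zero>\<^bsub>A\<^esub>" 0] h(1)[of "\<zero>\<^bsub>A\<^esub>"]
      by (simp add: A.scale_zero_right B.scale_zero_left)
    then show ?case by (simp only: A.eval_zero[OF \<phi>] B.eval_zero[OF h\<phi>])
  next
    case (single w c)
    have word: "letter_gen ` set ls \<subseteq> X \<Longrightarrow> h (eval_word A \<phi> (Word ls)) = eval_word B (\<lambda>x. h (\<phi> x)) (Word ls)" for ls
    proof (induction ls)
      case Nil
      then show ?case using h(4) by (simp add: eval_word_def)
    next
      case (Cons l ls)
      have "h (eval_letter A \<phi> l) = eval_letter B (\<lambda>x. h (\<phi> x)) l"
        using Cons.prems \<phi> h(6) by (cases l) auto
      moreover have "eval_letter A \<phi> l \<in> carrier A"
        using Cons.prems by (intro A.eval_letter_closed[OF \<phi>]) auto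
      moreover have "eval_word A \<phi> (Word ls) \<in> carrier A"
        using Cons.prems by (intro A.eval_word_closed[OF \<phi>]) auto
      ultimately show ?case using Cons h(2) by (simp add: eval_word_def)
    qed
    then show ?case
      using single A.eval_word_closed[OF \<phi> single] word[of "letters w"] h(5)
      by (simp add: A.eval_single[OF \<phi>] B.eval_single[OF h\<phi>])
  next
    case (add p q)
    then show ?case
      using h(3)[of "eval_poly A \<phi> p" "eval_poly A \<phi> q"]
      by (simp add: A.eval_add[OF \<phi>] B.eval_add[OF h\<phi>] A.eval_closed[OF \<phi>])
  qed
qed

context
  fixes X :: "'x set" and Rel :: "'x free_star set"
  assumes bounded: "bounded_presentation X Rel" and Rel: "Rel \<subseteq> free_star_on X"
begin

private abbreviation "N \<equiv> univ_norm X Rel"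
private abbreviation "U \<equiv> univ_cstar X Rel"

interpretation S: cstar_seminorm_on X N
  by (simp add: cstar_seminorm_on_def cstar_seminorm_univ_norm[OF bounded])

interpretation U: cstar_algebra U
  by (rule cstar_univ_cstar[OF bounded])

lemma U_eq: "U = completion X N"
  by (simp add: univ_cstar_def)

lemma univ_gen_cl: "univ_gen X Rel x = S.cl (\<lambda>_. fgen x)"
  by (simp add: univ_gen_def S.cl_def)

lemma univ_gen_closed: "univ_gen X Rel \<in> X \<rightarrow> carrier U"
  unfolding univ_gen_cl U_eq by (auto intro!: S.carrier_cl)

lemma eval_univ_gen:
  "p \<in> free_star_on X \<Longrightarrow> eval_poly U (univ_gen X Rel) p = S.cl (\<lambda>_. p)"
proof (induction p rule: free_star_induct)
  case zero
  then show ?case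
    using U.eval_zero[OF univ_gen_closed] unfolding U_eq by (simp add: S.zero_cl)
next
  case (single w c)
  have word: "letter_gen ` set ls \<subseteq> X \<Longrightarrow>
      eval_word U (univ_gen X Rel) (Word ls) = S.cl (\<lambda>_. Poly_Mapping.single (Word ls) 1)" for ls
  proof (induction ls)
    case Nil
    have "Poly_Mapping.single (Word []) 1 = (1 :: 'x free_star)"
      by (simp add: zero_star_word_def[symmetric])
    then show ?case by (simp add: eval_word_def U_eq S.one_cl)
  next
    case (Cons l ls)
    have l: "Poly_Mapping.single (Word [l]) 1 \<in> free_star_on X"
      and ls: "Poly_Mapping.single (Word ls) 1 \<in> free_star_on X"
      using Cons.prems by (auto intro!: free_star_on_single)
    have "eval_letter U (univ_gen X Rel) l = S.cl (\<lambda>_. Poly_Mapping.single (Word [l]) 1)"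
    proof (cases l)
      case (Gen x)
      then show ?thesis by (simp add: univ_gen_cl fgen_def)
    next
      case (Adj x)
      then have x: "fgen x \<in> free_star_on X" using Cons.prems by auto
      have "fstar (fgen x) = Poly_Mapping.single (Word [l]) 1"
        using Adj by (simp add: fgen_def fstar_single adj_word_def)
      then show ?thesis using Adj x by (simp add: univ_gen_cl U_eq S.adj_cl)
    qed
    moreover have "Poly_Mapping.single (Word [l]) (1::complex) * Poly_Mapping.single (Word ls) 1 =
        Poly_Mapping.single (Word (l # ls)) 1"
      by (simp add: mult_single plus_star_word_def)
    ultimately show ?case
      using Cons l ls by (simp add: eval_word_def U_eq S.mult_cl)
  qed
  have "Poly_Mapping.single w c = fscale c (Poly_Mapping.single w 1)"
    by (simp add: fscale_conv mult_single)
  then show ?case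
    using single word[of "letters w"] U.eval_single[OF univ_gen_closed single, of c]
    unfolding U_eq by (simp add: S.scale_cl free_star_on_single)
next
  case (add p q)
  then show ?case
    using U.eval_add[OF univ_gen_closed, of p q] unfolding U_eq by (simp add: S.add_cl)
qed

theorem univ_cstar_satisfies: "satisfies U (univ_gen X Rel) Rel"
  unfolding satisfies_def
proof
  fix r assume r: "r \<in> Rel"
  then have rF: "r \<in> free_star_on X" using Rel by blast
  have "S.cl (\<lambda>_. r) = S.cl (\<lambda>_. 0)"
    using rF univ_norm_rel[OF bounded r] by (subst S.cl_eq_iff) auto
  then show "eval_poly U (univ_gen X Rel) r = \<zero>\<^bsub>U\<^esub>"
    using eval_univ_gen[OF rF] by (simp add: U_eq S.zero_cl)
qed

theorem univ_cstar_universal: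
  fixes \<phi> :: "'x \<Rightarrow> 'b"
  assumes B: "cstar_algebra B" and \<phi>: "\<phi> \<in> X \<rightarrow> carrier B" and sat: "satisfies B \<phi> Rel"
  shows "\<exists>h\<in>star_hom U B. (\<forall>x\<in>X. h (univ_gen X Rel x) = \<phi> x)"
proof -
  interpret B: cstar_algebra B by (rule B)
  define E where "E = eval_poly B \<phi>"
  note E = B.eval_closed[OF \<phi>, folded E_def] B.eval_diff[OF \<phi>, folded E_def]
    B.eval_add[OF \<phi>, folded E_def] B.eval_mult[OF \<phi>, folded E_def]
    B.eval_scale[OF \<phi>, folded E_def] B.eval_star[OF \<phi>, folded E_def]
    B.eval_one[OF \<phi>, folded E_def] B.eval_fgen[OF \<phi>, folded E_def]
  have "(\<lambda>p. cnorm B (E p)) \<in> admissible X Rel"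
    using B.cstar_seminorm_eval[OF \<phi>] sat
    by (simp add: admissible_def satisfies_def E_def B.cnorm_zero)
  from univ_norm_ge[OF bounded this]
  have EN: "cnorm B (E p) \<le> N p" if "p \<in> free_star_on X" for p using that .
  have ex: "\<exists>y. B.conv (\<lambda>n. E (f n)) y" if f: "f \<in> cauchy_seqs X N" for f
  proof -
    have fF: "f n \<in> free_star_on X" for n using f by (rule S.C_in)
    have "\<exists>M. \<forall>m\<ge>M. \<forall>n\<ge>M. cnorm B (E (f m) \<ominus>\<^bsub>B\<^esub> E (f n)) < e" if e: "e > 0" for e
    proof -
      obtain M where M: "\<forall>m\<ge>M. \<forall>n\<ge>M. N (f m - f n) < e" using S.C_D[OF f e] by blast
      have "cnorm B (E (f m) \<ominus>\<^bsub>B\<^esub> E (f n)) \<le> N (f m - f n)" for m n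
        using EN[OF free_star_on_diff[OF fF fF], of m n] fF by (simp add: E(2))
      then show ?thesis using M by (meson order_le_less_trans)
    qed
    then show ?thesis
      using B.complete[of "\<lambda>n. E (f n)"] E(1)[OF fF] by (auto simp: B.conv_def)
  qed
  have same: "B.conv (\<lambda>n. E (g n)) y"
    if "g \<in> S.cl f" "B.conv (\<lambda>n. E (f n)) y" for f g y
  proof -
    from S.mem_clD[OF that(1)] have f: "f \<in> cauchy_seqs X N" and g: "g \<in> cauchy_seqs X N"
      and lim: "(\<lambda>n. N (f n - g n)) \<longlonglongrightarrow> 0" by auto
    have fF: "f n \<in> free_star_on X" and gF: "g n \<in> free_star_on X" for n
      using S.C_in[OF f] S.C_in[OF g] by auto
    show ?thesis
    proof (rule B.convI)
      show "E (g n) \<in> carrier B" for n by (rule E(1)[OF gF])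
      show yB: "y \<in> carrier B" by (rule B.convD[OF that(2)])
      show "(\<lambda>n. N (f n - g n) + cnorm B (E (f n) \<ominus>\<^bsub>B\<^esub> y)) \<longlonglongrightarrow> 0"
        using tendsto_add[OF lim B.convD(3)[OF that(2)]] by simp
      fix n
      have "cnorm B (E (g n) \<ominus>\<^bsub>B\<^esub> E (f n)) \<le> N (f n - g n)"
        using EN[OF free_star_on_diff[OF fF gF], of n n] fF gF
          B.cnorm_minus_commute[OF E(1)[OF fF] E(1)[OF gF], of n n] by (simp add: E(2))
      then show "cnorm B (E (g n) \<ominus>\<^bsub>B\<^esub> y) \<le> N (f n - g n) + cnorm B (E (f n) \<ominus>\<^bsub>B\<^esub> y)"
        using B.cnorm_triangle3[OF E(1)[OF gF] E(1)[OF fF] yB, of n n] by linarith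
    qed
  qed
  define h where "h a = (THE y. \<exists>f\<in>a. B.conv (\<lambda>n. E (f n)) y)" for a
  have h_cl: "h (S.cl f) = y" if "f \<in> cauchy_seqs X N" "B.conv (\<lambda>n. E (f n)) y" for f y
    unfolding h_def
  proof (rule the_equality)
    show "\<exists>g\<in>S.cl f. B.conv (\<lambda>n. E (g n)) y" using that S.self_cl by blast
    show "z = y" if "\<exists>g\<in>S.cl f. B.conv (\<lambda>n. E (g n)) z" for z
      using that same[OF _ \<open>B.conv (\<lambda>n. E (f n)) y\<close>] B.conv_unique by blast
  qed
  have h_conv: "B.conv (\<lambda>n. E (f n)) (h (S.cl f))" if "f \<in> cauchy_seqs X N" for f
    using ex[OF that] h_cl[OF that] by blast
  have h_const: "h (S.cl (\<lambda>_. p)) = E p" if "p \<in> free_star_on X" for p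
    by (rule h_cl) (use that in \<open>auto intro!: B.conv_const E(1)\<close>)
  have "h \<in> star_hom U B"
    unfolding star_hom_def mem_Collect_eq
  proof (intro conjI ballI allI ring_hom_memI)
    fix a assume "a \<in> carrier U"
    then obtain f where f: "f \<in> cauchy_seqs X N" "a = S.cl f"
      unfolding U_eq by (elim S.carrier_clE)
    have fF: "f n \<in> free_star_on X" for n using f(1) by (rule S.C_in)
    show "h a \<in> carrier B" using B.convD(2)[OF h_conv[OF f(1)]] f by simp
    show "h (scale U c a) = scale B c (h a)" for c
      unfolding f U_eq S.scale_cl[OF f(1)]
      by (rule h_cl[OF S.C_scale[OF f(1)]])
        (use B.conv_scale[OF h_conv[OF f(1)], of c] fF in \<open>simp add: E\<close>)
    show "h (adj U a) = adj B (h a)"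
      unfolding f U_eq S.adj_cl[OF f(1)]
      by (rule h_cl[OF S.C_star[OF f(1)]])
        (use B.conv_adj[OF h_conv[OF f(1)]] fF in \<open>simp add: E\<close>)
    fix b assume "b \<in> carrier U"
    then obtain g where g: "g \<in> cauchy_seqs X N" "b = S.cl g"
      unfolding U_eq by (elim S.carrier_clE)
    have gF: "g n \<in> free_star_on X" for n using g(1) by (rule S.C_in)
    show "h (a \<otimes>\<^bsub>U\<^esub> b) = h a \<otimes>\<^bsub>B\<^esub> h b"
      unfolding f g U_eq S.mult_cl[OF f(1) g(1)]
      by (rule h_cl[OF S.C_mult[OF f(1) g(1)]])
        (use B.conv_mult[OF h_conv[OF f(1)] h_conv[OF g(1)]] fF gF in \<open>simp add: E\<close>)
    show "h (a \<oplus>\<^bsub>U\<^esub> b) = h a \<oplus>\<^bsub>B\<^esub> h b"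
      unfolding f g U_eq S.add_cl[OF f(1) g(1)]
      by (rule h_cl[OF S.C_add[OF f(1) g(1)]])
        (use B.conv_add[OF h_conv[OF f(1)] h_conv[OF g(1)]] fF gF in \<open>simp add: E\<close>)
  next
    show "h \<one>\<^bsub>U\<^esub> = \<one>\<^bsub>B\<^esub>"
      using h_const[OF free_star_on_one] E(7) by (simp add: U_eq S.one_cl)
  qed
  moreover have "\<forall>x\<in>X. h (univ_gen X Rel x) = \<phi> x"
    using h_const E(8) by (auto simp: univ_gen_cl free_star_on_fgen)
  ultimately show ?thesis by blast
qed

theorem univ_cstar_hom_eqI:
  assumes B: "cstar_algebra B" and h: "h \<in> star_hom U B" and k: "k \<in> star_hom U B"
    and eq: "\<And>x. x \<in> X \<Longrightarrow> h (univ_gen X Rel x) = k (univ_gen X Rel x)"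
    and a: "a \<in> carrier U"
  shows "h a = k a"
proof -
  interpret B: cstar_algebra B by (rule B)
  obtain f where f: "f \<in> cauchy_seqs X N" "a = S.cl f"
    using a unfolding U_eq by (elim S.carrier_clE)
  have fF: "f n \<in> free_star_on X" for n using f(1) by (rule S.C_in)
  have cU: "S.cl (\<lambda>_. f n) \<in> carrier U" for n
    unfolding U_eq using fF by blast
  have poly: "h (S.cl (\<lambda>_. f n)) = k (S.cl (\<lambda>_. f n))" for n
  proof -
    have "eval_poly B (\<lambda>x. h (univ_gen X Rel x)) (f n) = eval_poly B (\<lambda>x. k (univ_gen X Rel x)) (f n)"
    proof -
      have "eval_letter B (\<lambda>x. h (univ_gen X Rel x)) l = eval_letter B (\<lambda>x. k (univ_gen X Rel x)) l"
        if "letter_gen l \<in> X" for l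
        using that eq by (cases l) auto
      then have "eval_word B (\<lambda>x. h (univ_gen X Rel x)) w = eval_word B (\<lambda>x. k (univ_gen X Rel x)) w"
        if "letter_gen ` set (letters w) \<subseteq> X" for w
        unfolding eval_word_def using that by (intro foldr_cong) auto
      moreover have "eval_word B (\<lambda>x. h (univ_gen X Rel x)) w \<in> carrier B"
        if "letter_gen ` set (letters w) \<subseteq> X" for w
        by (rule B.eval_word_closed[OF _ that])
          (use star_homD(1)[OF h] funcset_mem[OF univ_gen_closed] in auto)
      ultimately show ?thesis
        unfolding eval_poly_def using fF[of n]
        by (intro B.finsum_cong') (auto simp: free_star_on_def intro!: B.scale_closed)
    qed
    then show ?thesis
      using star_hom_eval[OF U.cstar_algebra_axioms B h univ_gen_closed fF[of n]]
        star_hom_eval[OF U.cstar_algebra_axioms B k univ_gen_closed fF[of n]]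
      by (simp add: eval_univ_gen[OF fF])
  qed
  have "U.conv (\<lambda>n. S.cl (\<lambda>_. f n)) a"
    unfolding U.conv_def
  proof (intro conjI allI cU a LIMSEQ_I)
    fix e :: real assume "e > 0"
    then have "e / 2 > 0" by simp
    from S.dense[OF f(1) this] obtain M where
      "\<And>n. n \<ge> M \<Longrightarrow> cnorm U (a \<ominus>\<^bsub>U\<^esub> S.cl (\<lambda>_. f n)) \<le> e / 2"
      by (auto simp: f U_eq)
    then have "norm (cnorm U (S.cl (\<lambda>_. f n) \<ominus>\<^bsub>U\<^esub> a) - 0) < e" if "n \<ge> M" for n
      using that \<open>e > 0\<close> U.cnorm_minus_commute[OF a cU[of n]]
        U.cnorm_nonneg[OF U.minus_closed[OF cU[of n] a]] by fastforce
    then show "\<exists>M. \<forall>n\<ge>M. norm (cnorm U (S.cl (\<lambda>_. f n) \<ominus>\<^bsub>U\<^esub> a) - 0) < e" by blast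
  qed
  then have lim: "B.conv (\<lambda>n. j (S.cl (\<lambda>_. f n))) (j a)" if j: "j \<in> star_hom U B" for j
    by (intro B.convI[where h = "\<lambda>n. cnorm U (S.cl (\<lambda>_. f n) \<ominus>\<^bsub>U\<^esub> a)"])
      (use star_hom_contractive[OF U.cstar_algebra_axioms B j U.minus_closed[OF cU a]]
        star_hom_diff[OF U.cstar_algebra_axioms B j cU a] star_homD(1)[OF j] cU a
        in \<open>auto simp: U.conv_def\<close>)
  show ?thesis
    using B.conv_unique[OF lim[OF h]] lim[OF k] unfolding poly by blast
qed

end


section \<open>Boundedness of the two presentations\<close>

lemma bounded_presentationI:
  assumes gen: "\<And>x p. x \<in> X \<Longrightarrow> p \<in> admissible X Rel \<Longrightarrow> p (fgen x) \<le> 1"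
  shows "bounded_presentation X Rel"
  unfolding bounded_presentation_def
proof
  fix q assume "q \<in> free_star_on X"
  then show "bdd_above ((\<lambda>p. p q) ` admissible X Rel)"
  proof (induction q rule: free_star_induct)
    case zero
    have "p 0 = 0" if "p \<in> admissible X Rel" for p
      using cstar_seminorm_on.N_zero[OF admissibleD[OF that]] .
    then show ?case by (intro bdd_aboveI2[where M = 0] eq_refl)
  next
    case (single w c)
    have word: "letter_gen ` set ls \<subseteq> X \<Longrightarrow> p (Poly_Mapping.single (Word ls) 1) \<le> 1"
      if p: "p \<in> admissible X Rel" for p ls
    proof (induction ls)
      interpret cstar_seminorm_on X p by (rule admissibleD[OF p])
      case Nil
      have "Poly_Mapping.single (Word []) 1 = (1 :: 'a free_star)"
        by (simp add: zero_star_word_def[symmetric])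
      then show ?case using N_one by simp
    next
      interpret cstar_seminorm_on X p by (rule admissibleD[OF p])
      case (Cons l ls)
      have l: "Poly_Mapping.single (Word [l]) 1 \<in> F"
        and ls: "Poly_Mapping.single (Word ls) 1 \<in> F"
        using Cons.prems by (auto intro!: free_star_on_single)
      have l1: "p (Poly_Mapping.single (Word [l]) 1) \<le> 1"
      proof (cases l)
        case (Gen x)
        then show ?thesis using gen[OF _ p, of x] Cons.prems by (simp add: fgen_def)
      next
        case (Adj x)
        then have "fstar (fgen x) = Poly_Mapping.single (Word [l]) 1"
          by (simp add: fgen_def fstar_single adj_word_def)
        then show ?thesis
          using gen[OF _ p, of x] N_fstar[of "fgen x"] Cons.prems Adj by (auto simp: free_star_on_fgen)
      qed
      have "p (Poly_Mapping.single (Word (l # ls)) 1) \<le>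
          p (Poly_Mapping.single (Word [l]) 1) * p (Poly_Mapping.single (Word ls) 1)"
        using submult[OF l ls] by (simp add: mult_single plus_star_word_def)
      also have "\<dots> \<le> 1"
        using l1 Cons N_nonneg[OF l] N_nonneg[OF ls] by (intro mult_le_one) auto
      finally show ?case .
    qed
    have "p (Poly_Mapping.single w c) \<le> cmod c" if p: "p \<in> admissible X Rel" for p
    proof -
      interpret cstar_seminorm_on X p by (rule admissibleD[OF p])
      have "Poly_Mapping.single w c = fscale c (Poly_Mapping.single w 1)"
        by (simp add: fscale_conv mult_single)
      then have "p (Poly_Mapping.single w c) = cmod c * p (Poly_Mapping.single w 1)"
        using homog[OF free_star_on_single[OF single]] by simp
      also have "\<dots> \<le> cmod c * 1"
        using word[OF p, of "letters w"] single by (intro mult_left_mono) auto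
      finally show ?thesis by simp
    qed
    then show ?case by (intro bdd_aboveI2)
  next
    case (add q r)
    then obtain b c where b: "\<And>p. p \<in> admissible X Rel \<Longrightarrow> p q \<le> b"
      and c: "\<And>p. p \<in> admissible X Rel \<Longrightarrow> p r \<le> c"
      unfolding bdd_above_def by auto
    have "p (q + r) \<le> b + c" if p: "p \<in> admissible X Rel" for p
      using cstar_seminorm_on.tri[OF admissibleD[OF p] add(1,2)] b[OF p] c[OF p] by linarith
    then show ?case by (intro bdd_aboveI2)
  qed
qed

lemma (in cstar_seminorm_on) N_isometry:
  assumes "x \<in> F" "N (fstar x * x - 1) = 0"
  shows "N x \<le> 1"
proof -
  have "(N x)\<^sup>2 \<le> 1"
    using assms cstar[OF assms(1)] tri[of "fstar x * x - 1" 1] N_one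
    by (simp add: free_star_on_diff free_star_on_mult free_star_on_fstar)
  then show ?thesis by (simp add: abs_square_le_1 N_nonneg assms(1))
qed

lemma (in cstar_seminorm_on) N_mult_zero:
  assumes "x \<in> F" "y \<in> F" "N x = 0"
  shows "N (x * y) = 0" and "N (y * x) = 0"
  using submult[OF assms(1,2)] submult[OF assms(2,1)] assms N_nonneg[of "x * y"] N_nonneg[of "y * x"]
  by (auto simp: free_star_on_mult)

theorem bounded_ring_rels: "bounded_presentation ring_gens (ring_rels :: 'r::idom ring_gen free_star set)"
proof (rule bounded_presentationI)
  fix x :: "'r ring_gen" and p
  assume x: "x \<in> ring_gens" and p: "p \<in> admissible ring_gens (ring_rels :: 'r ring_gen free_star set)"
  interpret cstar_seminorm_on "ring_gens :: 'r ring_gen set" p by (rule admissibleD[OF p])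
  have "fstar (fgen x) * fgen x - 1 \<in> ring_rels"
    using x unfolding ring_gens_def ring_rels_def by blast
  then show "p (fgen x) \<le> 1"
    using p x by (intro N_isometry) (auto simp: admissible_def)
qed

lemma ring_rels_subset: "ring_rels \<subseteq> free_star_on (ring_gens :: 'r::idom ring_gen set)"
proof -
  have s: "fs m \<in> free_star_on ring_gens" if "m \<noteq> 0" for m :: 'r
    using that by (auto simp: ring_gens_def)
  have u: "fu n \<in> free_star_on ring_gens" for n :: 'r
    by (auto simp: ring_gens_def)
  show ?thesis
    unfolding ring_rels_def
    by (auto intro!: s u free_star_on_diff free_star_on_mult free_star_on_fstar free_star_on_sum)
qed

theorem cstar_ring_cstar: "cstar_algebra ring_cstar"
  unfolding ring_cstar_def by (rule cstar_univ_cstar[OF bounded_ring_rels])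

theorem bounded_partial_rels:
  assumes "group G"
  shows "bounded_presentation (carrier G) (partial_rels G \<union> Rel)"
proof (rule bounded_presentationI)
  interpret group G by fact
  fix g p assume g: "g \<in> carrier G" and p: "p \<in> admissible (carrier G) (partial_rels G \<union> Rel)"
  interpret cstar_seminorm_on "carrier G" p by (rule admissibleD[OF p])
  let ?i = "inv\<^bsub>G\<^esub> g"
  have rel: "p r = 0" if "r \<in> partial_rels G" for r using p that by (simp add: admissible_def)
  have G: "fgen g \<in> F" "fgen ?i \<in> F" "fgen \<one>\<^bsub>G\<^esub> \<in> F" using g by (auto intro: free_star_on_fgen)
  have 1: "p (fgen ?i - fstar (fgen g)) = 0"
    using g by (intro rel) (auto simp: partial_rels_def)
  have 2: "p (fgen \<one>\<^bsub>G\<^esub> - 1) = 0"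
    by (intro rel) (auto simp: partial_rels_def)
  have "fgen g * fgen ?i * fgen (inv\<^bsub>G\<^esub> ?i) - fgen (g \<otimes>\<^bsub>G\<^esub> ?i) * fgen (inv\<^bsub>G\<^esub> ?i) \<in> partial_rels G"
    using g unfolding partial_rels_def by blast
  from rel[OF this] have 3: "p (fgen g * fgen ?i * fgen g - fgen \<one>\<^bsub>G\<^esub> * fgen g) = 0"
    using g by simp
  let ?x = "fgen g"
  have x: "?x \<in> F" "fstar ?x \<in> F" using G by auto
  have "p (?x * (fstar ?x * ?x) - ?x) \<le> 0"
  proof -
    have eq: "?x * (fstar ?x * ?x) - ?x =
        (?x * fgen ?i * ?x - fgen \<one>\<^bsub>G\<^esub> * ?x) - ?x * ((fgen ?i - fstar ?x) * ?x) + (fgen \<one>\<^bsub>G\<^esub> - 1) * ?x"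
      by (simp add: algebra_simps)
    have z0: "p ((fgen ?i - fstar ?x) * ?x) = 0"
      by (rule N_mult_zero(1)) (use 1 G x in auto)
    have z1: "p (?x * ((fgen ?i - fstar ?x) * ?x)) = 0"
      by (rule N_mult_zero(2)) (use z0 G x in auto)
    have z2: "p ((fgen \<one>\<^bsub>G\<^esub> - 1) * ?x) = 0"
      by (rule N_mult_zero(1)) (use 2 G x in auto)
    have "p (?x * (fstar ?x * ?x) - ?x) \<le>
        p ((?x * fgen ?i * ?x - fgen \<one>\<^bsub>G\<^esub> * ?x) - ?x * ((fgen ?i - fstar ?x) * ?x)) +
        p ((fgen \<one>\<^bsub>G\<^esub> - 1) * ?x)"
      unfolding eq using G x
      by (intro tri) (auto intro!: free_star_on_diff free_star_on_mult)
    also have "\<dots> \<le> p (?x * fgen ?i * ?x - fgen \<one>\<^bsub>G\<^esub> * ?x) +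
        p (?x * ((fgen ?i - fstar ?x) * ?x)) + p ((fgen \<one>\<^bsub>G\<^esub> - 1) * ?x)"
      using G x by (intro add_right_mono tri_diff) (auto intro!: free_star_on_diff free_star_on_mult)
    finally show ?thesis using 3 z1 z2 by simp
  qed
  moreover have "p (fstar ?x * (?x * (fstar ?x * ?x) - ?x)) \<le> p (fstar ?x) * p (?x * (fstar ?x * ?x) - ?x)"
    using x by (intro submult) auto
  ultimately have z: "p (fstar ?x * (?x * (fstar ?x * ?x) - ?x)) \<le> 0"
    using N_nonneg[OF x(2)] by (meson mult_nonneg_nonpos order_trans)
  let ?e = "fstar ?x * ?x"
  have e: "?e \<in> F" "fstar ?e = ?e" using x by (auto simp: fstar_mult)
  have "(p ?x) ^ 4 = (p ?e)\<^sup>2" using cstar[OF x(1)] by simp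
  also have "\<dots> = p (?e * ?e)" using cstar[OF e(1)] e(2) by simp
  also have "?e * ?e = fstar ?x * (?x * (fstar ?x * ?x) - ?x) + ?e"
    by (simp add: algebra_simps)
  also have "p \<dots> \<le> p (fstar ?x * (?x * (fstar ?x * ?x) - ?x)) + p ?e"
    using x by (intro tri) auto
  also have "\<dots> \<le> (p ?x)\<^sup>2" using z cstar[OF x(1)] by simp
  finally have le: "(p ?x) ^ 4 \<le> (p ?x)\<^sup>2" .
  show "p ?x \<le> 1"
  proof (rule ccontr)
    assume "\<not> p ?x \<le> 1"
    then have "(p ?x)\<^sup>2 < (p ?x) ^ 4" by (intro power_strict_increasing) auto
    then show False using le by simp
  qed
qed

theorem cstar_partial_cstar: "group G \<Longrightarrow> cstar_algebra (partial_cstar G Rel)"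
  unfolding partial_cstar_def by (rule cstar_univ_cstar[OF bounded_partial_rels])

theorem group_affine_group: "group (affine_group :: ('k::field \<times> 'k) monoid)"
proof (rule groupI)
  fix x :: "'k \<times> 'k" assume "x \<in> carrier affine_group"
  then obtain u w where x: "x = (u, w)" "w \<noteq> 0" by (auto simp: affine_group_def)
  have "(- u / w, 1 / w) \<otimes>\<^bsub>affine_group\<^esub> x = \<one>\<^bsub>affine_group\<^esub>"
    using x by (simp add: affine_group_def)
  moreover have "(- u / w, 1 / w) \<in> carrier affine_group" using x by (simp add: affine_group_def)
  ultimately show "\<exists>y\<in>carrier affine_group. y \<otimes>\<^bsub>affine_group\<^esub> x = \<one>\<^bsub>affine_group\<^esub>" by blast
qed (auto simp: affine_group_def algebra_simps)

lemma inv_affine_group: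
  "w \<noteq> 0 \<Longrightarrow> inv\<^bsub>affine_group\<^esub> (u, w) = (- u / w, 1 / w :: 'k::field)"
proof (rule group.inv_equality[OF group_affine_group])
qed (auto simp: affine_group_def)

lemma partial_rels_subset:
  assumes "group G"
  shows "partial_rels G \<subseteq> free_star_on (carrier G)"
proof -
  interpret group G by fact
  show ?thesis
    unfolding partial_rels_def
    by (auto intro!: free_star_on_diff free_star_on_mult free_star_on_fstar free_star_on_fgen)
qed

lemma affine_rels_subset: "affine_rels \<subseteq> free_star_on (carrier affine_group)"
proof -
  interpret group "affine_group :: ('a fract \<times> 'a fract) monoid" by (rule group_affine_group)
  have "Fract m 1 \<noteq> 0" "Fract 1 m \<noteq> 0" if "m \<noteq> 0" for m :: 'a
    using that by (simp_all add: Zero_fract_def eq_fract)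
  then have "(Fract n 1, 1) \<in> carrier affine_group"
    "m \<noteq> 0 \<Longrightarrow> (0, Fract 1 m) \<in> carrier affine_group"
    "m \<noteq> 0 \<Longrightarrow> (Fract n 1, Fract m 1) \<in> carrier affine_group" for m n :: 'a
    by (auto simp: affine_group_def)
  then show ?thesis
    unfolding affine_rels_def proj_def
    by (auto intro!: free_star_on_diff free_star_on_mult free_star_on_sum free_star_on_fgen inv_closed)
qed

end

theory Submission
  imports Defs
begin

text \<open>
  Both algebras are universal, so a homomorphism out of either is a family of elements that satisfies
  its relations, and two homomorphisms that agree on generators agree.  It therefore suffices to
  check that $[0,m]$ and $[n,1]$ satisfy the relations of the ring algebra, that the elements
  $s_{m'}^* u^n s_m$ satisfy the relations of the partial group algebra, and that the resulting
  homomorphisms invert each other on generators (\<open>univ_cstar_inverse_homs\<close>).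

  The first point uses that a partial representation \<open>P\<close> is multiplicative,
  \<open>P g P h = P (g h)\<close>, as soon as $e_g = 1$ or $e_{h^{-1}} = 1$.  One of the two holds in
  every product needed here, because $e_{(n,1)} = 1$ and $e_{(0,1/m)} = 1$.

  For the second point, the isometries $v_{x,m} = u^x s_m$ represent the semigroup of affine maps
  $y \mapsto x + m y$, and $s_{m'}^* u^n s_m = v_{0,m'}^* v_{n,m}$ depends only on the group
  element $(n/m', m/m')$ because a common factor cancels against an isometry.  Writing
  $g = (0,d)^{-1}(a,b)$ and $h = (0,y)^{-1}(x,z)$, the product of the two fractions contains
  $v_{a,b} v_{0,y}^* = v_{0,y}^* v_{ya,b} (v_{0,y} v_{0,y}^*)$, and the fraction of
  $g h$ is the same product without the projection $v_{0,y} v_{0,y}^*$.  After multiplication by the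
  fraction of $h^{-1}$ the projection is absorbed, provided that it commutes with
  $v_{x,z} v_{x,z}^*$.  So everything rests on the range projections commuting
  (\<open>range_proj_commute\<close>).

  By the sum relation, the range projection of the coset $x + (m)$ is the sum of the range
  projections of the cosets of $(m k)$ contained in it.  Two range projections thus become sums of
  range projections for one common modulus, and these are equal or orthogonal.
  Orthogonality is the analytic ingredient: projections with sum one in a C*-algebra are
  mutually orthogonal (\<open>projections_sum_one_orthogonal\<close>).  It is derived, without
  spectral theory, from the fact that the unit of a corner is an extreme point of the unit
  ball (\<open>extreme_point_corner_unit\<close>).
\<close>

section \<open>Projections with sum one\<close>

context cstar_algebra
begin

definition projection :: "'a \<Rightarrow> bool" where
  "projection p \<longleftrightarrow> p \<in> carrier A \<and> adj A p = p \<and> p \<otimes> p = p"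

lemma projectionD:
  assumes "projection p"
  shows "p \<in> carrier A" "adj A p = p" "p \<otimes> p = p"
  using assms by (auto simp: projection_def)

lemma cnorm_projection_le_one: "projection p \<Longrightarrow> cnorm A p \<le> 1"
proof -
  assume p: "projection p"
  have "cnorm A p = (cnorm A p)\<^sup>2" using cnorm_cstar[of p] projectionD[OF p] by simp
  then show ?thesis by (metis le_numeral_extra(4) mult_cancel_right1 power2_eq_square zero_le_one)
qed

lemma projection_complement: "projection p \<Longrightarrow> projection (\<one> \<ominus> p)"
proof -
  assume "projection p"
  note p = projectionD[OF this]
  have "(\<one> \<ominus> p) \<otimes> (\<one> \<ominus> p) = \<one> \<ominus> p"
    using p by (simp add: a_minus_def l_distr r_distr l_minus r_minus minus_add r_neg l_neg)
  then show ?thesis using p by (simp add: projection_def adj_diff adj_one)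
qed

text \<open>
  Consider the discs of parameters \<open>\<zeta>\<close> for which \<open>e + \<zeta> b\<close> is a
  contraction.  The squares $(e \pm b)^2$ have mean $e + b^2 = (e + i b)^*(e + i b)$, so
  \<open>\<zeta> = \<plusminus>1\<close> gives \<open>\<zeta> = \<plusminus>\<i>\<close>, and by convexity
  the disc of radius \<open>1/2\<close>.  The squares of $e + \zeta (1 \pm i) b / 2$ have mean
  $e + \zeta b$, which enlarges the radius of a disc by the factor $\sqrt 2$.  Hence all multiples of
  \<open>b\<close> are bounded by \<open>2\<close>.
\<close>

lemma extreme_point_corner_unit:
  assumes e: "projection e" and b: "b \<in> carrier A" "adj A b = b" "e \<otimes> b = b" "b \<otimes> e = b"
    and plus: "cnorm A (e \<oplus> b) \<le> 1" and minus: "cnorm A (e \<ominus> b) \<le> 1"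
  shows "b = \<zero>"
proof -
  note e' = projectionD[OF e]
  have bb: "b \<otimes> b \<in> carrier A" using b by simp
  \<comment> \<open>All elements that occur are combinations of \<open>e\<close>, \<open>b\<close> and \<open>b\<^sup>2\<close>;
    working with their coordinates reduces the algebra to complex arithmetic.\<close>
  define q where "q x y z = (scale A x e \<oplus> scale A y b) \<oplus> scale A z (b \<otimes> b)" for x y z
  have q_closed [simp]: "q x y z \<in> carrier A" for x y z
    using e' b by (simp add: q_def scale_closed)
  have q_add: "q x y z \<oplus> q x' y' z' = q (x + x') (y + y') (z + z')" for x y z x' y' z'
    using e' b by (simp add: q_def scale_add_left scale_closed a_ac)
  have q_scale: "scale A c (q x y z) = q (c * x) (c * y) (c * z)" for c x y z
    using e' b by (simp add: q_def scale_add_right scale_closed scale_scale)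
  have q_mult: "q 1 x 0 \<otimes> q 1 y 0 = q 1 (x + y) (x * y)" for x y
    using e' b
    by (simp add: q_def scale_zero_left scale_closed scale_one l_distr r_distr scale_mult_left
        scale_mult_right scale_scale scale_add_left scale_add_right mult.commute a_ac)
  have q_adj: "adj A (q 1 x 0) = q 1 (cnj x) 0" for x
    using e' b by (simp add: q_def scale_zero_left scale_closed scale_one adj_add adj_scale)
  have e_q: "e = q 1 0 0"
    using e' b by (simp add: q_def scale_zero_left scale_one)
  have tri: "cnorm A (q (x + x') (y + y') (z + z')) \<le> cnorm A (q x y z) + cnorm A (q x' y' z')"
    for x y z x' y' z'
    unfolding q_add[symmetric] by (intro cnorm_triangle q_closed)
  have scl: "cnorm A (q (c * x) (c * y) (c * z)) = cmod c * cnorm A (q x y z)" for c x y z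
    unfolding q_scale[symmetric] by (intro cnorm_scale q_closed)
  have sq: "cnorm A (q 1 (x + y) (x * y)) \<le> 1"
    if "cnorm A (q 1 x 0) \<le> 1" "cnorm A (q 1 y 0) \<le> 1" for x y
    unfolding q_mult[symmetric]
    using cnorm_mult[of "q 1 x 0" "q 1 y 0"] mult_le_one[OF that(1) cnorm_nonneg that(2)] by simp
  have half: "cnorm A (q 1 ((x + x') / 2) ((y + y') / 2)) \<le> 1"
    if "cnorm A (q 1 x y) \<le> 1" "cnorm A (q 1 x' y') \<le> 1" for x x' y y'
    using tri[of 1 1 x x' y y'] scl[of "1/2" 2 "x + x'" "y + y'"] that by simp
  have e1: "cnorm A (q 1 0 0) \<le> 1"
    using cnorm_projection_le_one[OF e] e_q by simp
  have p1: "cnorm A (q 1 1 0) \<le> 1" and m1: "cnorm A (q 1 (-1) 0) \<le> 1"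
    using plus minus e' b by (simp_all add: q_def scale_zero_left scale_one scale_minus_one a_minus_def)
  have b2: "cnorm A (q 1 0 1) \<le> 1"
    using half[OF sq[OF p1 p1] sq[OF m1 m1]] by simp
  have "cnorm A (q 1 \<i> 0) \<le> 1"
    using cnorm_cstar[of "q 1 \<i> 0"] b2 by (simp add: q_adj q_mult abs_square_le_1 cnorm_nonneg)
  moreover have "cnorm A (q 1 (-\<i>) 0) \<le> 1"
    using cnorm_cstar[of "q 1 (-\<i>) 0"] b2 by (simp add: q_adj q_mult abs_square_le_1 cnorm_nonneg)
  \<comment> \<open>\<open>e + t \<zeta> b\<close> is a convex combination of \<open>e \<plusminus> \<zeta> b\<close> and \<open>e\<close>.\<close>
  moreover have "cnorm A (q 1 (complex_of_real t * \<zeta>) 0) \<le> 1"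
    if t: "\<bar>t\<bar> \<le> 1" and z: "cnorm A (q 1 \<zeta> 0) \<le> 1" "cnorm A (q 1 (-\<zeta>) 0) \<le> 1" for t \<zeta>
  proof -
    define \<sigma> where "\<sigma> = complex_of_real (sgn t) * \<zeta>"
    have z': "cnorm A (q 1 \<sigma> 0) \<le> 1" using z e1 by (auto simp: \<sigma>_def sgn_if)
    have ts: "complex_of_real t * \<zeta> = complex_of_real \<bar>t\<bar> * \<sigma>"
      by (simp add: \<sigma>_def sgn_if abs_if)
    have "cnorm A (q 1 (complex_of_real t * \<zeta>) 0) \<le>
        cnorm A (q (complex_of_real \<bar>t\<bar> * 1) (complex_of_real \<bar>t\<bar> * \<sigma>) (complex_of_real \<bar>t\<bar> * 0)) +
        cnorm A (q (complex_of_real (1 - \<bar>t\<bar>) * 1) (complex_of_real (1 - \<bar>t\<bar>) * 0) (complex_of_real (1 - \<bar>t\<bar>) * 0))"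
      using tri[of "complex_of_real \<bar>t\<bar>" "complex_of_real (1 - \<bar>t\<bar>)" "complex_of_real \<bar>t\<bar> * \<sigma>" 0 0 0]
      by (simp add: ts)
    also have "\<dots> = \<bar>t\<bar> * cnorm A (q 1 \<sigma> 0) + (1 - \<bar>t\<bar>) * cnorm A (q 1 0 0)"
      using t by (simp only: scl norm_of_real)
    also have "\<dots> \<le> \<bar>t\<bar> * 1 + (1 - \<bar>t\<bar>) * 1"
      using z' e1 t by (intro add_mono mult_left_mono) auto
    finally show ?thesis by simp
  qed
  ultimately have axis: "cnorm A (q 1 (complex_of_real t) 0) \<le> 1"
      "cnorm A (q 1 (complex_of_real t * \<i>) 0) \<le> 1" if "\<bar>t\<bar> \<le> 1" for t
    using p1 m1 that by (metis mult.right_neutral)+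
  have disc: "cnorm A (q 1 \<zeta> 0) \<le> 1" if "cmod \<zeta> \<le> sqrt 2 ^ n / 2" for n \<zeta>
    using that
  proof (induction n arbitrary: \<zeta>)
    case 0
    have "\<bar>2 * Re \<zeta>\<bar> \<le> 1" "\<bar>2 * Im \<zeta>\<bar> \<le> 1"
      using 0 abs_Re_le_cmod[of \<zeta>] abs_Im_le_cmod[of \<zeta>] by auto
    then have "cnorm A (q 1 ((complex_of_real (2 * Re \<zeta>) + complex_of_real (2 * Im \<zeta>) * \<i>) / 2) ((0 + 0) / 2)) \<le> 1"
      by (intro half axis)
    moreover have "(complex_of_real (2 * Re \<zeta>) + complex_of_real (2 * Im \<zeta>) * \<i>) / 2 = \<zeta>"
      by (simp add: complex_eq_iff)
    ultimately show ?case by simp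
  next
    case (Suc n)
    define \<eta> \<theta> where "\<eta> = \<zeta> * (1 + \<i>) / 2" and "\<theta> = \<zeta> * (1 - \<i>) / 2"
    have n: "cmod (1 + \<i>) = sqrt 2" "cmod (1 - \<i>) = sqrt 2" by (simp_all add: cmod_def)
    have "sqrt 2 * cmod \<zeta> \<le> sqrt 2 * (sqrt 2 * sqrt 2 ^ n / 2)"
      using Suc.prems by (intro mult_left_mono) auto
    also have "\<dots> = sqrt 2 ^ n" by simp
    finally have "sqrt 2 * cmod \<zeta> \<le> sqrt 2 ^ n" .
    then have "cmod \<eta> \<le> sqrt 2 ^ n / 2" "cmod \<theta> \<le> sqrt 2 ^ n / 2"
      by (simp_all add: \<eta>_def \<theta>_def norm_mult norm_divide n mult.commute)
    then have "cnorm A (q 1 ((\<eta> + \<eta> + (\<theta> + \<theta>)) / 2) ((\<eta> * \<eta> + \<theta> * \<theta>) / 2)) \<le> 1"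
      by (intro half sq Suc.IH)
    moreover have "(\<eta> + \<eta> + (\<theta> + \<theta>)) / 2 = \<zeta>" "\<eta> * \<eta> + \<theta> * \<theta> = 0"
      by (simp_all add: \<eta>_def \<theta>_def field_simps)
    ultimately show ?case by simp
  qed
  have "cnorm A b \<le> 0"
  proof (rule ccontr)
    assume "\<not> cnorm A b \<le> 0"
    then have pos: "0 < cnorm A b" by simp
    obtain n where n: "4 / cnorm A b < sqrt 2 ^ n"
      using real_arch_pow[of "sqrt 2"] by auto
    define c where "c = complex_of_real (sqrt 2 ^ n / 2)"
    have c: "cmod c = sqrt 2 ^ n / 2" by (simp add: c_def norm_divide norm_power)
    have "cmod c * cnorm A b = cnorm A (q 0 c 0)"
      using e' b by (simp add: q_def scale_zero_left scale_closed cnorm_scale)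
    also have "\<dots> \<le> cnorm A (q 1 c 0) + cnorm A (q (-1 * 1) (-1 * 0) (-1 * 0))"
      using tri[of 1 "-1" c 0 0 0] by simp
    also have "\<dots> \<le> 1 + 1"
      unfolding scl using disc[of c n] c e1 by simp
    finally have "sqrt 2 ^ n * cnorm A b \<le> 4" by (simp add: c)
    then show False using n pos by (simp add: field_simps)
  qed
  then show ?thesis using cnorm_nonneg[of b] cnorm_eq_zero[of b] b by simp
qed

text \<open>
  A norm estimate that expresses the positivity of a sum of projections: each \<open>1 - p\<close> is a
  contraction.
\<close>

lemma cnorm_card_minus_sum_projections:
  assumes "finite I" "\<And>i. i \<in> I \<Longrightarrow> projection (p i)"
  shows "cnorm A (scale A (of_nat (card I)) \<one> \<ominus> finsum A p I) \<le> card I"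
  using assms
proof (induction I rule: finite_induct)
  case empty
  then show ?case by (simp add: scale_zero_left a_minus_def cnorm_zero)
next
  case (insert i I)
  let ?c = "scale A (of_nat (card I)) \<one>" and ?s = "finsum A p I"
  have p: "p \<in> I \<rightarrow> carrier A" "p i \<in> carrier A" using insert.prems projectionD by auto
  have s: "?s \<in> carrier A" "?c \<in> carrier A" using p by (auto simp: scale_closed)
  have "scale A (of_nat (card (insert i I))) \<one> \<ominus> finsum A p (insert i I) =
      (\<one> \<ominus> p i) \<oplus> (?c \<ominus> ?s)"
    using insert.hyps p s
    by (simp add: finsum_insert scale_add_left scale_one a_minus_def minus_add a_ac)
  moreover have "cnorm A (\<one> \<ominus> p i) \<le> 1"
    using insert.prems by (intro cnorm_projection_le_one projection_complement) auto
  ultimately show ?case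
    using cnorm_triangle[of "\<one> \<ominus> p i" "?c \<ominus> ?s"] insert p s by simp
qed

text \<open>
  Compress by $e = p_i$ and put $b = e p_j e$.  The complement of $p_i + p_j$ is a sum of
  projections, which bounds $T e + b$ by $T$ for a number $T$; and $e - b = e (1 - p_j) e$ is a
  contraction, which bounds $T e - b$.  So $e \pm b / T$ are contractions, $b = 0$ by extremality of
  $e$ in its corner, and $b = (p_j e)^* (p_j e)$ gives $p_j e = 0$.
\<close>

lemma projections_sum_one_orthogonal:
  assumes I: "finite I" and p: "\<And>i. i \<in> I \<Longrightarrow> projection (p i)"
    and sum: "finsum A p I = \<one>" and ij: "i \<in> I" "j \<in> I" "i \<noteq> j"
  shows "p i \<otimes> p j = \<zero>"
proof -
  define J where "J = I - {i, j}"
  define t where "t = card J + 1"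
  define y where "y = finsum A p J"
  have J: "finite J" "i \<notin> J" "j \<notin> J" "I = insert i (insert j J)"
    using I ij by (auto simp: J_def)
  note pi = projectionD[OF p[OF ij(1)]] and pj = projectionD[OF p[OF ij(2)]]
  have pJ: "p \<in> J \<rightarrow> carrier A" using p projectionD by (auto simp: J_def)
  have y: "y \<in> carrier A" using pJ by (simp add: y_def)
  have "\<one> = p i \<oplus> (p j \<oplus> y)"
    using sum J pJ pi pj ij by (simp add: finsum_insert y_def)
  \<comment> \<open>The right-hand side has norm at most \<open>t + 1\<close>, the left-hand side compresses to \<open>(t + 1) e + b\<close>.\<close>
  then have c: "scale A (of_nat t) \<one> \<oplus> (p i \<oplus> p j) =
      (\<one> \<oplus> \<one>) \<oplus> (scale A (of_nat (card J)) \<one> \<ominus> y)"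
  proof -
    assume one: "\<one> = p i \<oplus> (p j \<oplus> y)"
    have "p i \<oplus> p j = \<one> \<ominus> y"
      unfolding one using pi pj y by (simp add: a_minus_def a_assoc r_neg)
    then show ?thesis
      using y by (simp add: t_def scale_add_left scale_one scale_closed a_minus_def a_ac)
  qed
  define e b where "e = p i" and "b = e \<otimes> (p j \<otimes> e)"
  have e: "projection e" "e \<in> carrier A" "adj A e = e" "e \<otimes> e = e" "cnorm A e \<le> 1"
    using p[OF ij(1)] projectionD cnorm_projection_le_one by (auto simp: e_def)
  have ee: "e \<otimes> (e \<otimes> x) = e \<otimes> x" if "x \<in> carrier A" for x
    using that e by (simp add: m_assoc[symmetric])
  have b: "b \<in> carrier A" "adj A b = b" "e \<otimes> b = b" "b \<otimes> e = b"
    using e pj by (auto simp: b_def adj_mult m_assoc ee)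
  \<comment> \<open>The number of remaining projections, plus one for each of the two summands of \<open>\<one> \<oplus> \<one>\<close> in \<open>c\<close>.\<close>
  define T where "T = t + 1"
  have T: "real T > 0" by (simp add: T_def)
  have compress: "cnorm A (e \<otimes> (x \<otimes> e)) \<le> cnorm A x" if x: "x \<in> carrier A" for x
  proof -
    have "cnorm A (e \<otimes> (x \<otimes> e)) \<le> cnorm A e * (cnorm A x * cnorm A e)"
      using x e by (intro order_trans[OF cnorm_mult] mult_left_mono cnorm_mult cnorm_nonneg) auto
    also have "\<dots> \<le> 1 * (cnorm A x * 1)"
      using x e by (intro mult_mono cnorm_nonneg mult_left_mono mult_nonneg_nonneg) auto
    finally show ?thesis by simp
  qed
  have "cnorm A (scale A (of_nat t) \<one> \<oplus> (p i \<oplus> p j)) \<le> T"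
  proof -
    have "cnorm A (scale A (of_nat (card J)) \<one> \<ominus> y) \<le> card J"
      unfolding y_def by (rule cnorm_card_minus_sum_projections[OF J(1)]) (use p in \<open>auto simp: J_def\<close>)
    moreover have "cnorm A (\<one> \<oplus> \<one>) \<le> 2"
      using cnorm_triangle[of \<one> \<one>] cnorm_one by simp
    ultimately show ?thesis
      unfolding c using cnorm_triangle[of "\<one> \<oplus> \<one>" "scale A (of_nat (card J)) \<one> \<ominus> y"] y
      by (simp add: T_def t_def scale_closed)
  qed
  moreover have "e \<otimes> ((scale A (of_nat t) \<one> \<oplus> (p i \<oplus> p j)) \<otimes> e) = scale A (of_nat T) e \<oplus> b"
    using e pj
    by (simp add: e_def[symmetric] b_def T_def l_distr r_distr scale_closed scale_mult_left
        scale_mult_right scale_add_left scale_one ee a_ac)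
  ultimately have plus: "cnorm A (scale A (of_nat T) e \<oplus> b) \<le> T"
    using compress[of "scale A (of_nat t) \<one> \<oplus> (p i \<oplus> p j)"] pi pj by (simp add: scale_closed)
  have "scale A (of_nat T) e \<ominus> b = scale A (of_nat t) e \<oplus> e \<otimes> ((\<one> \<ominus> p j) \<otimes> e)"
    using e pj
    by (simp add: b_def T_def a_minus_def l_distr r_distr scale_closed
        scale_add_left scale_one l_minus r_minus a_ac)
  moreover have "cnorm A (e \<otimes> ((\<one> \<ominus> p j) \<otimes> e)) \<le> 1"
    using compress[of "\<one> \<ominus> p j"] pj cnorm_projection_le_one[OF projection_complement[OF p[OF ij(2)]]]
    by simp
  moreover have "cnorm A (scale A (of_nat t) e) \<le> t"
    using e by (simp add: cnorm_scale mult_left_le)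
  ultimately have minus: "cnorm A (scale A (of_nat T) e \<ominus> b) \<le> T"
    using cnorm_triangle[of "scale A (of_nat t) e" "e \<otimes> ((\<one> \<ominus> p j) \<otimes> e)"] e pj
    by (simp add: scale_closed T_def)
  define b' where "b' = scale A (of_real (1 / T)) b"
  have eT: "e = scale A (of_real (1 / T)) (scale A (of_nat T) e)"
    using e T by (simp add: scale_scale scale_one)
  have "e \<oplus> b' = scale A (of_real (1 / T)) (scale A (of_nat T) e \<oplus> b)"
    using e b eT by (simp add: b'_def scale_add_right scale_closed)
  then have plus': "cnorm A (e \<oplus> b') \<le> 1"
    using plus T e b by (simp add: cnorm_scale scale_closed norm_divide divide_le_eq)
  have "e \<ominus> b' = scale A (of_real (1 / T)) (scale A (of_nat T) e \<ominus> b)"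
    using e b eT by (simp add: b'_def scale_diff scale_closed)
  then have minus': "cnorm A (e \<ominus> b') \<le> 1"
    using minus T e b by (simp add: cnorm_scale scale_closed norm_divide divide_le_eq)
  have "b' = \<zero>"
    by (rule extreme_point_corner_unit[OF e(1) _ _ _ _ plus' minus'])
      (use b e in \<open>auto simp: b'_def scale_closed adj_scale scale_mult_left scale_mult_right\<close>)
  then have "scale A (of_nat T) b' = \<zero>" by (simp add: scale_zero_right)
  then have b0: "b = \<zero>" using b T by (simp add: b'_def scale_scale scale_one)
  have "adj A (p j \<otimes> e) \<otimes> (p j \<otimes> e) = b"
    using e pj by (simp add: b_def adj_mult m_assoc) (simp add: m_assoc[symmetric])
  then have "p j \<otimes> e = \<zero>"
    using cnorm_cstar[of "p j \<otimes> e"] cnorm_eq_zero[of "p j \<otimes> e"] b0 e pj by (simp add: cnorm_zero)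
  then have "adj A (p j \<otimes> e) = \<zero>" by (simp add: adj_zero)
  then show ?thesis using e pj by (simp add: adj_mult e_def)
qed

end

section \<open>Families satisfying the relations of the ring algebra\<close>

context cstar_algebra
begin

context
  fixes X :: "'x set" and \<phi> :: "'x \<Rightarrow> 'a"
  assumes \<phi>: "\<phi> \<in> X \<rightarrow> carrier A"
begin

lemma eval_sum:
  "(\<And>i. i \<in> I \<Longrightarrow> f i \<in> free_star_on X) \<Longrightarrow>
    eval_poly A \<phi> (sum f I) = (\<Oplus>i\<in>I. eval_poly A \<phi> (f i))"
proof (induction I rule: infinite_finite_induct)
  case (insert i I)
  have "eval_poly A \<phi> (f j) \<in> carrier A" if "j \<in> insert i I" for j
    using eval_closed[OF \<phi> insert.prems[OF that]] .
  then show ?case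
    using insert by (simp add: eval_add[OF \<phi>] free_star_on_sum finsum_insert Pi_iff)
qed (simp_all add: eval_zero[OF \<phi>] finsum_infinite)

lemma eval_diff_eq_zero_iff:
  "p \<in> free_star_on X \<Longrightarrow> q \<in> free_star_on X \<Longrightarrow>
    eval_poly A \<phi> (p - q) = \<zero> \<longleftrightarrow> eval_poly A \<phi> p = eval_poly A \<phi> q"
  using minus_eq_zeroD[of "eval_poly A \<phi> p" "eval_poly A \<phi> q"]
  by (auto simp: eval_diff[OF \<phi>] eval_closed[OF \<phi>] a_minus_def r_neg)

end

end

text \<open>
  Ring families, and affine families further below, state in terms of elements of an arbitrary
  C*-algebra what the two presentations require of the images of their generators.
\<close>

locale ring_family = cstar_algebra A for A :: "('a, 'm) star_algebra_scheme" (structure) +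
  fixes s u :: "'r::idom \<Rightarrow> 'a"
  assumes s_closed: "m \<noteq> 0 \<Longrightarrow> s m \<in> carrier A"
    and u_closed: "u n \<in> carrier A"
    and s_isometry: "m \<noteq> 0 \<Longrightarrow> adj A (s m) \<otimes> s m = \<one>"
    and u_unitary: "adj A (u n) \<otimes> u n = \<one>" "u n \<otimes> adj A (u n) = \<one>"
    and s_mult: "m \<noteq> 0 \<Longrightarrow> m' \<noteq> 0 \<Longrightarrow> s m \<otimes> s m' = s (m * m')"
    and u_add: "u n \<otimes> u n' = u (n + n')"
    and s_u: "m \<noteq> 0 \<Longrightarrow> s m \<otimes> u n = u (m * n) \<otimes> s m"
    and range_sum: "m \<noteq> 0 \<Longrightarrow> residue_choice m \<rho> \<Longrightarrow>
      (\<Oplus>L\<in>residues m. u (\<rho> L) \<otimes> s m \<otimes> adj A (s m) \<otimes> u (- \<rho> L)) = \<one>"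

lemma (in cstar_algebra) satisfies_ring_rels_iff:
  assumes \<phi>: "\<phi> \<in> ring_gens \<rightarrow> carrier A"
  shows "satisfies A \<phi> ring_rels \<longleftrightarrow> ring_family A (\<lambda>m. \<phi> (Iso m)) (\<lambda>n. \<phi> (Uni n))"
proof -
  have mem [simp]: "m \<noteq> 0 \<Longrightarrow> Iso m \<in> ring_gens" "Uni n \<in> ring_gens" for m n :: 'b
    by (auto simp: ring_gens_def)
  have [simp]: "m \<noteq> 0 \<Longrightarrow> \<phi> (Iso m) \<in> carrier A" "\<phi> (Uni n) \<in> carrier A" for m n
    using \<phi> mem by (auto simp del: mem)
  note [simp] = free_star_on_fgen free_star_on_mult free_star_on_fstar free_star_on_sum
  note ev = eval_diff_eq_zero_iff[OF \<phi>] eval_mult[OF \<phi>] eval_star[OF \<phi>] eval_fgen[OF \<phi>]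
    eval_one[OF \<phi>] eval_sum[OF \<phi>]
  have 1: "(\<forall>r\<in>{fstar (fs m) * fs m - 1 |m. m \<noteq> 0}. eval_poly A \<phi> r = \<zero>) \<longleftrightarrow>
      (\<forall>m. m \<noteq> 0 \<longrightarrow> adj A (\<phi> (Iso m)) \<otimes> \<phi> (Iso m) = \<one>)"
    by (auto simp: ev)
  have 2: "(\<forall>r\<in>{fstar (fu n) * fu n - 1 |n. True}. eval_poly A \<phi> r = \<zero>) \<longleftrightarrow>
      (\<forall>n. adj A (\<phi> (Uni n)) \<otimes> \<phi> (Uni n) = \<one>)"
    by (auto simp: ev)
  have 3: "(\<forall>r\<in>{fu n * fstar (fu n) - 1 |n. True}. eval_poly A \<phi> r = \<zero>) \<longleftrightarrow>
      (\<forall>n. \<phi> (Uni n) \<otimes> adj A (\<phi> (Uni n)) = \<one>)"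
    by (auto simp: ev)
  have 4: "(\<forall>r\<in>{fs m * fs m' - fs (m * m') |m m'. m \<noteq> 0 \<and> m' \<noteq> 0}. eval_poly A \<phi> r = \<zero>) \<longleftrightarrow>
      (\<forall>m m'. m \<noteq> 0 \<longrightarrow> m' \<noteq> 0 \<longrightarrow> \<phi> (Iso m) \<otimes> \<phi> (Iso m') = \<phi> (Iso (m * m')))"
  proof -
    have "eval_poly A \<phi> (fs m * fs m' - fs (m * m')) = \<zero> \<longleftrightarrow> \<phi> (Iso m) \<otimes> \<phi> (Iso m') = \<phi> (Iso (m * m'))"
      if "m \<noteq> 0" "m' \<noteq> 0" for m m'
      using that by (simp add: ev)
    then show ?thesis by blast
  qed
  have 5: "(\<forall>r\<in>{fu n * fu n' - fu (n + n') |n n'. True}. eval_poly A \<phi> r = \<zero>) \<longleftrightarrow>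
      (\<forall>n n'. \<phi> (Uni n) \<otimes> \<phi> (Uni n') = \<phi> (Uni (n + n')))"
  proof -
    have "eval_poly A \<phi> (fu n * fu n' - fu (n + n')) = \<zero> \<longleftrightarrow> \<phi> (Uni n) \<otimes> \<phi> (Uni n') = \<phi> (Uni (n + n'))" for n n'
      by (simp add: ev)
    then show ?thesis by blast
  qed
  have 6: "(\<forall>r\<in>{fs m * fu n - fu (m * n) * fs m |m n. m \<noteq> 0}. eval_poly A \<phi> r = \<zero>) \<longleftrightarrow>
      (\<forall>m n. m \<noteq> 0 \<longrightarrow> \<phi> (Iso m) \<otimes> \<phi> (Uni n) = \<phi> (Uni (m * n)) \<otimes> \<phi> (Iso m))"
  proof -
    have "eval_poly A \<phi> (fs m * fu n - fu (m * n) * fs m) = \<zero> \<longleftrightarrow>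
        \<phi> (Iso m) \<otimes> \<phi> (Uni n) = \<phi> (Uni (m * n)) \<otimes> \<phi> (Iso m)" if "m \<noteq> 0" for m n
      using that by (simp add: ev)
    then show ?thesis by blast
  qed
  have 7: "(\<forall>r\<in>{(\<Sum>L\<in>residues m. fu (\<rho> L) * fs m * fstar (fs m) * fu (- \<rho> L)) - 1 |m \<rho>.
        m \<noteq> 0 \<and> residue_choice m \<rho>}. eval_poly A \<phi> r = \<zero>) \<longleftrightarrow>
      (\<forall>m \<rho>. m \<noteq> 0 \<longrightarrow> residue_choice m \<rho> \<longrightarrow>
        (\<Oplus>L\<in>residues m. \<phi> (Uni (\<rho> L)) \<otimes> \<phi> (Iso m) \<otimes> adj A (\<phi> (Iso m)) \<otimes> \<phi> (Uni (- \<rho> L))) = \<one>)"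
  proof -
    have "eval_poly A \<phi> ((\<Sum>L\<in>residues m. fu (\<rho> L) * fs m * fstar (fs m) * fu (- \<rho> L)) - 1) = \<zero> \<longleftrightarrow>
       (\<Oplus>L\<in>residues m. \<phi> (Uni (\<rho> L)) \<otimes> \<phi> (Iso m) \<otimes> adj A (\<phi> (Iso m)) \<otimes> \<phi> (Uni (- \<rho> L))) = \<one>"
      if "m \<noteq> 0" for m \<rho>
      using that by (simp add: ev)
    then show ?thesis by blast
  qed
  show ?thesis
    unfolding satisfies_def ring_rels_def ball_Un 1 2 3 4 5 6 7 ring_family_def ring_family_axioms_def
    using cstar_algebra_axioms by (simp add: conj_assoc)
qed


section \<open>Range projections commute\<close>

context ring_family
begin

lemma u_zero: "u 0 = \<one>"
proof -
  have "u 0 = (adj A (u 0) \<otimes> u 0) \<otimes> u 0" using u_unitary u_closed by simp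
  also have "\<dots> = adj A (u 0) \<otimes> (u 0 \<otimes> u 0)" using u_closed adj_closed by (simp add: m_assoc)
  also have "\<dots> = \<one>" using u_unitary by (simp add: u_add)
  finally show ?thesis .
qed

lemma u_uminus: "u (- n) = adj A (u n)"
proof -
  have "u (- n) = adj A (u n) \<otimes> u n \<otimes> u (- n)" using u_unitary u_closed by simp
  also have "\<dots> = adj A (u n)" using u_closed adj_closed by (simp add: m_assoc u_add u_zero)
  finally show ?thesis .
qed

lemma s_one: "s 1 = \<one>"
proof -
  have "s 1 = (adj A (s 1) \<otimes> s 1) \<otimes> s 1" using s_isometry[of 1] s_closed[of 1] by simp
  also have "\<dots> = adj A (s 1) \<otimes> (s 1 \<otimes> s 1)" using s_closed[of 1] adj_closed by (simp add: m_assoc)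
  also have "\<dots> = \<one>" using s_isometry[of 1] by (simp add: s_mult)
  finally show ?thesis .
qed

text \<open>
  The isometry that implements the affine map $y \mapsto x + m y$ of the ring, as
  \<open>v_mult\<close> shows.
\<close>

definition v :: "'r \<Rightarrow> 'r \<Rightarrow> 'a" where
  "v x m = u x \<otimes> s m"

lemma v_closed [simp]: "m \<noteq> 0 \<Longrightarrow> v x m \<in> carrier A"
  by (simp add: v_def u_closed s_closed)

lemma v_adj_closed [simp]: "m \<noteq> 0 \<Longrightarrow> adj A (v x m) \<in> carrier A"
  by (simp add: adj_closed)

lemma v_mult: "m \<noteq> 0 \<Longrightarrow> k \<noteq> 0 \<Longrightarrow> v x m \<otimes> v y k = v (x + m * y) (m * k)"
proof -
  assume m: "m \<noteq> 0" and k: "k \<noteq> 0"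
  have "v x m \<otimes> v y k = u x \<otimes> ((s m \<otimes> u y) \<otimes> s k)"
    using m k by (simp add: v_def u_closed s_closed m_assoc)
  also have "\<dots> = (u x \<otimes> u (m * y)) \<otimes> (s m \<otimes> s k)"
    using m k by (simp add: s_u u_closed s_closed m_assoc)
  finally show ?thesis using m k by (simp add: v_def u_add s_mult)
qed

lemma v_isometry: "m \<noteq> 0 \<Longrightarrow> adj A (v x m) \<otimes> v x m = \<one>"
proof -
  assume m: "m \<noteq> 0"
  have "adj A (v x m) \<otimes> v x m = adj A (s m) \<otimes> ((adj A (u x) \<otimes> u x) \<otimes> s m)"
    using m by (simp add: v_def u_closed s_closed adj_mult adj_closed m_assoc)
  then show ?thesis using m by (simp add: u_unitary s_isometry s_closed)
qed

lemma v_isometry_cancel: "m \<noteq> 0 \<Longrightarrow> z \<in> carrier A \<Longrightarrow> adj A (v x m) \<otimes> (v x m \<otimes> z) = z"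
  by (simp add: v_isometry m_assoc[symmetric])

definition range_proj :: "'r \<Rightarrow> 'r \<Rightarrow> 'a" where
  "range_proj x m = v x m \<otimes> adj A (v x m)"

lemma projection_range_proj: "m \<noteq> 0 \<Longrightarrow> projection (range_proj x m)"
  by (simp add: projection_def range_proj_def adj_mult adj_adj m_assoc v_isometry_cancel)

lemma range_proj_closed [simp]: "m \<noteq> 0 \<Longrightarrow> range_proj x m \<in> carrier A"
  using projection_range_proj projectionD by blast

lemma range_proj_eq: "m \<noteq> 0 \<Longrightarrow> range_proj x m = u x \<otimes> s m \<otimes> adj A (s m) \<otimes> u (- x)"
  by (simp add: range_proj_def v_def u_uminus adj_mult adj_closed u_closed s_closed m_assoc)

lemma sum_range_proj:
  "m \<noteq> 0 \<Longrightarrow> residue_choice m \<rho> \<Longrightarrow> (\<Oplus>L\<in>residues m. range_proj (\<rho> L) m) = \<one>"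
  using range_sum[of m \<rho>] by (simp add: range_proj_eq)

lemma range_proj_cong:
  assumes m: "m \<noteq> 0" and "m dvd x - y"
  shows "range_proj x m = range_proj y m"
proof -
  obtain k where k: "x = y + m * k" using assms by (metis add.commute diff_add_cancel dvdE)
  have v: "v x m = v y m \<otimes> u k"
    using v_mult[of m 1 y k] m by (simp add: k) (simp add: v_def[of k] s_one u_closed)
  have "u k \<otimes> (adj A (u k) \<otimes> z) = z" if "z \<in> carrier A" for z
    using that u_unitary[of k] u_closed[of k] by (simp add: m_assoc[symmetric] adj_closed)
  then show ?thesis
    using m by (simp add: range_proj_def v adj_mult u_closed m_assoc adj_closed)
qed

end

lemma dvd_diff_swap: "(m :: 'r :: comm_ring_1) dvd x - y \<longleftrightarrow> m dvd y - x"
  by (metis dvd_minus_iff minus_diff_eq)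

lemma equiv_cong_rel: "equiv UNIV (cong_rel m)"
proof (rule equivI)
  show "sym (cong_rel m)"
    by (rule symI) (simp add: cong_rel_def dvd_diff_swap)
  show "trans (cong_rel m)"
  proof (rule transI)
    fix x y z assume "(x, y) \<in> cong_rel m" "(y, z) \<in> cong_rel m"
    then have "m dvd (x - y) + (y - z)" unfolding cong_rel_def by (intro dvd_add) auto
    then show "(x, z) \<in> cong_rel m" by (simp add: cong_rel_def)
  qed
qed (auto simp: cong_rel_def refl_on_def)

lemma residue_choice_exists: "\<exists>\<rho>. residue_choice m \<rho>"
proof
  show "residue_choice m (\<lambda>L. SOME z. z \<in> L)"
    unfolding residue_choice_def residues_def
    using in_quotient_imp_non_empty[OF equiv_cong_rel] by (auto intro: some_in_eq[THEN iffD2])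
qed

lemma residue_choice_dvd:
  assumes "residue_choice m \<rho>"
  shows "m dvd x - \<rho> (cong_rel m `` {x})"
proof -
  have "cong_rel m `` {x} \<in> residues m" unfolding residues_def by (rule quotientI) simp
  then have "\<rho> (cong_rel m `` {x}) \<in> cong_rel m `` {x}" using assms unfolding residue_choice_def by blast
  then show ?thesis unfolding cong_rel_def by blast
qed

locale finite_ring_family = ring_family A s u
  for A :: "('a, 'm) star_algebra_scheme" (structure) and s u :: "'r::idom \<Rightarrow> 'a" +
  assumes finite_residues: "(m :: 'r) \<noteq> 0 \<Longrightarrow> finite (residues m)"
begin

lemma range_proj_orthogonal:
  assumes m: "m \<noteq> 0" and "\<not> m dvd x - y"
  shows "range_proj x m \<otimes> range_proj y m = \<zero>"
proof -
  obtain \<rho> where \<rho>: "residue_choice m \<rho>" using residue_choice_exists by blast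
  define X Y where "X = cong_rel m `` {x}" and "Y = cong_rel m `` {y}"
  have XY: "X \<in> residues m" "Y \<in> residues m"
    by (auto simp: X_def Y_def residues_def intro: quotientI)
  have "X \<noteq> Y"
    using assms eq_equiv_class[OF _ equiv_cong_rel, of m x y] by (auto simp: X_def Y_def cong_rel_def)
  then have "range_proj (\<rho> X) m \<otimes> range_proj (\<rho> Y) m = \<zero>"
    by (intro projections_sum_one_orthogonal[of "residues m" "\<lambda>L. range_proj (\<rho> L) m"]
        sum_range_proj projection_range_proj finite_residues m \<rho> XY)
  moreover have "range_proj x m = range_proj (\<rho> X) m" "range_proj y m = range_proj (\<rho> Y) m"
    using residue_choice_dvd[OF \<rho>] m by (auto simp: X_def Y_def intro!: range_proj_cong)
  ultimately show ?thesis by simp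
qed

lemma range_proj_commute_same:
  assumes m: "m \<noteq> 0"
  shows "range_proj x m \<otimes> range_proj y m = range_proj y m \<otimes> range_proj x m"
proof (cases "m dvd x - y")
  case True
  then show ?thesis using range_proj_cong[OF m True] by simp
next
  case False
  then have "\<not> m dvd y - x" by (metis dvd_diff_swap)
  then show ?thesis using False m by (simp add: range_proj_orthogonal)
qed

text \<open>
  Conjugating the sum relation for \<open>k\<close> by \<open>v x m\<close> splits the coset
  \<open>x + (m)\<close> into cosets of \<open>(m k)\<close>.
\<close>

lemma range_proj_refine:
  assumes m: "m \<noteq> 0" and k: "k \<noteq> 0" and \<rho>: "residue_choice k \<rho>"
  shows "range_proj x m = (\<Oplus>L\<in>residues k. range_proj (x + m * \<rho> L) (m * k))"
proof -
  have c: "(\<lambda>L. range_proj (\<rho> L) k) \<in> residues k \<rightarrow> carrier A" using k by simp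
  have "range_proj x m = v x m \<otimes> ((\<Oplus>L\<in>residues k. range_proj (\<rho> L) k) \<otimes> adj A (v x m))"
    using m k \<rho> by (simp add: sum_range_proj range_proj_def[of x m])
  also have "\<dots> = (\<Oplus>L\<in>residues k. v x m \<otimes> (range_proj (\<rho> L) k \<otimes> adj A (v x m)))"
    using m k c finite_residues[OF k] by (simp add: finsum_ldistr finsum_rdistr Pi_iff)
  also have "\<dots> = (\<Oplus>L\<in>residues k. range_proj (x + m * \<rho> L) (m * k))"
  proof (rule finsum_cong')
    fix L
    have "v x m \<otimes> (range_proj (\<rho> L) k \<otimes> adj A (v x m)) =
        (v x m \<otimes> v (\<rho> L) k) \<otimes> (adj A (v (\<rho> L) k) \<otimes> adj A (v x m))"
      using m k by (simp add: range_proj_def m_assoc)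
    also have "\<dots> = (v x m \<otimes> v (\<rho> L) k) \<otimes> adj A (v x m \<otimes> v (\<rho> L) k)"
      using m k by (simp add: adj_mult)
    finally show "v x m \<otimes> (range_proj (\<rho> L) k \<otimes> adj A (v x m)) = range_proj (x + m * \<rho> L) (m * k)"
      using m k by (simp add: v_mult range_proj_def)
  qed (use m k in auto)
  finally show ?thesis .
qed

text \<open>Both projections are sums of range projections for the common modulus \<open>m k\<close>.\<close>

lemma range_proj_commute:
  assumes m: "m \<noteq> 0" and k: "k \<noteq> 0"
  shows "range_proj x m \<otimes> range_proj y k = range_proj y k \<otimes> range_proj x m"
proof -
  obtain \<rho> \<sigma> where \<rho>: "residue_choice k \<rho>" and \<sigma>: "residue_choice m \<sigma>"
    using residue_choice_exists by meson
  have sum_commute: "z \<otimes> finsum A f I = finsum A f I \<otimes> z"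
    if "z \<in> carrier A" "f \<in> I \<rightarrow> carrier A" "\<And>i. i \<in> I \<Longrightarrow> z \<otimes> f i = f i \<otimes> z"
      "finite I" for z f and I :: "'r set set"
    using that finsum_cong'[of I I "\<lambda>i. f i \<otimes> z" "\<lambda>i. z \<otimes> f i"]
    by (simp add: finsum_ldistr finsum_rdistr Pi_iff)
  have "range_proj (y + k * \<sigma> L) (m * k) \<otimes> range_proj x m =
      range_proj x m \<otimes> range_proj (y + k * \<sigma> L) (m * k)" for L
    unfolding range_proj_refine[OF m k \<rho>, of x]
    using m k by (intro sum_commute range_proj_commute_same finite_residues) auto
  then show ?thesis
    unfolding range_proj_refine[OF k m \<sigma>, of y]
    using m k by (intro sum_commute) (auto simp: mult.commute finite_residues)
qed

end


section \<open>Families satisfying the relations of the partial group algebra\<close>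

locale partial_representation =
  cstar_algebra A + G: group G
  for A :: "('a, 'm) star_algebra_scheme" (structure) and G :: "('g, 'n) monoid_scheme" +
  fixes P :: "'g \<Rightarrow> 'a"
  assumes P_closed: "g \<in> carrier G \<Longrightarrow> P g \<in> carrier A"
    and P_one: "P \<one>\<^bsub>G\<^esub> = \<one>"
    and P_inv: "g \<in> carrier G \<Longrightarrow> P (inv\<^bsub>G\<^esub> g) = adj A (P g)"
    and P_partial: "g \<in> carrier G \<Longrightarrow> h \<in> carrier G \<Longrightarrow>
      P g \<otimes> P h \<otimes> P (inv\<^bsub>G\<^esub> h) = P (g \<otimes>\<^bsub>G\<^esub> h) \<otimes> P (inv\<^bsub>G\<^esub> h)"
begin

text \<open>
  Multiplying the defining relation by $P(h)$ on the right inserts $e_{h^{-1}}$ into both products,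
  so multiplicativity can fail only through this projection.  Taking adjoints turns the condition
  on $h$ into one on $g$.
\<close>

lemma P_mult_right:
  assumes gh: "g \<in> carrier G" "h \<in> carrier G" and h: "P (inv\<^bsub>G\<^esub> h) \<otimes> P h = \<one>"
  shows "P g \<otimes> P h = P (g \<otimes>\<^bsub>G\<^esub> h)"
proof -
  have c: "P g \<in> carrier A" "P h \<in> carrier A" "P (inv\<^bsub>G\<^esub> h) \<in> carrier A" "P (g \<otimes>\<^bsub>G\<^esub> h) \<in> carrier A"
    using gh by (simp_all add: P_closed)
  have "P g \<otimes> P h = P g \<otimes> P h \<otimes> (P (inv\<^bsub>G\<^esub> h) \<otimes> P h)" using c h by simp
  also have "\<dots> = (P g \<otimes> P h \<otimes> P (inv\<^bsub>G\<^esub> h)) \<otimes> P h" using c by (simp add: m_assoc)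
  also have "\<dots> = P (g \<otimes>\<^bsub>G\<^esub> h) \<otimes> (P (inv\<^bsub>G\<^esub> h) \<otimes> P h)"
    using c unfolding P_partial[OF gh] by (simp add: m_assoc)
  finally show ?thesis using c h by simp
qed

lemma P_mult_left:
  assumes gh: "g \<in> carrier G" "h \<in> carrier G" and g: "P g \<otimes> P (inv\<^bsub>G\<^esub> g) = \<one>"
  shows "P g \<otimes> P h = P (g \<otimes>\<^bsub>G\<^esub> h)"
proof -
  have "P (inv\<^bsub>G\<^esub> h) \<otimes> P (inv\<^bsub>G\<^esub> g) = P (inv\<^bsub>G\<^esub> h \<otimes>\<^bsub>G\<^esub> inv\<^bsub>G\<^esub> g)"
    using gh g by (intro P_mult_right) auto
  then have "adj A (P g \<otimes> P h) = adj A (P (g \<otimes>\<^bsub>G\<^esub> h))"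
    using gh by (simp add: P_inv[symmetric] adj_mult P_closed G.inv_mult_group)
  moreover have "P g \<otimes> P h \<in> carrier A" "P (g \<otimes>\<^bsub>G\<^esub> h) \<in> carrier A"
    using gh by (auto intro: P_closed)
  ultimately show ?thesis by (metis adj_adj)
qed

end

lemma (in cstar_algebra) satisfies_partial_rels_iff:
  assumes "group G" and \<phi>: "\<phi> \<in> carrier G \<rightarrow> carrier A"
  shows "satisfies A \<phi> (partial_rels G) \<longleftrightarrow> partial_representation A G \<phi>"
proof -
  interpret G: group G by fact
  have [simp]: "g \<in> carrier G \<Longrightarrow> \<phi> g \<in> carrier A" for g using \<phi> by auto
  note [simp] = free_star_on_fgen free_star_on_mult free_star_on_fstar
  note ev = eval_diff_eq_zero_iff[OF \<phi>] eval_mult[OF \<phi>] eval_star[OF \<phi>] eval_fgen[OF \<phi>]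
    eval_one[OF \<phi>]
  have 1: "(\<forall>r\<in>{fgen \<one>\<^bsub>G\<^esub> - 1}. eval_poly A \<phi> r = \<zero>) \<longleftrightarrow> \<phi> \<one>\<^bsub>G\<^esub> = \<one>"
    by (simp add: ev)
  have 2: "(\<forall>r\<in>{fgen (inv\<^bsub>G\<^esub> g) - fstar (fgen g) |g. g \<in> carrier G}. eval_poly A \<phi> r = \<zero>) \<longleftrightarrow>
      (\<forall>g. g \<in> carrier G \<longrightarrow> \<phi> (inv\<^bsub>G\<^esub> g) = adj A (\<phi> g))"
  proof -
    have "eval_poly A \<phi> (fgen (inv\<^bsub>G\<^esub> g) - fstar (fgen g)) = \<zero> \<longleftrightarrow> \<phi> (inv\<^bsub>G\<^esub> g) = adj A (\<phi> g)"
      if "g \<in> carrier G" for g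
      using that by (simp add: ev)
    then show ?thesis by blast
  qed
  have 3: "(\<forall>r\<in>{fgen g * fgen h * fgen (inv\<^bsub>G\<^esub> h) - fgen (g \<otimes>\<^bsub>G\<^esub> h) * fgen (inv\<^bsub>G\<^esub> h) |g h.
        g \<in> carrier G \<and> h \<in> carrier G}. eval_poly A \<phi> r = \<zero>) \<longleftrightarrow>
      (\<forall>g h. g \<in> carrier G \<longrightarrow> h \<in> carrier G \<longrightarrow>
        \<phi> g \<otimes> \<phi> h \<otimes> \<phi> (inv\<^bsub>G\<^esub> h) = \<phi> (g \<otimes>\<^bsub>G\<^esub> h) \<otimes> \<phi> (inv\<^bsub>G\<^esub> h))"
  proof -
    have "eval_poly A \<phi> (fgen g * fgen h * fgen (inv\<^bsub>G\<^esub> h) - fgen (g \<otimes>\<^bsub>G\<^esub> h) * fgen (inv\<^bsub>G\<^esub> h)) = \<zero> \<longleftrightarrow>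
        \<phi> g \<otimes> \<phi> h \<otimes> \<phi> (inv\<^bsub>G\<^esub> h) = \<phi> (g \<otimes>\<^bsub>G\<^esub> h) \<otimes> \<phi> (inv\<^bsub>G\<^esub> h)"
      if "g \<in> carrier G" "h \<in> carrier G" for g h
      using that by (simp add: ev)
    then show ?thesis by blast
  qed
  show ?thesis
    unfolding satisfies_def partial_rels_def ball_Un 1 2 3 partial_representation_def
      partial_representation_axioms_def
    using cstar_algebra_axioms \<open>group G\<close> by simp
qed

lemma affine_mult [simp]: "(u, w) \<otimes>\<^bsub>affine_group\<^esub> (u', w') = (u + u' * w, w * w')"
  and affine_one: "\<one>\<^bsub>affine_group\<^esub> = (0, 1)"
  and affine_carrier [simp]: "(u, w) \<in> carrier affine_group \<longleftrightarrow> w \<noteq> 0"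
  by (simp_all add: affine_group_def)

lemma Fract_eq_zero_iff: "m' \<noteq> 0 \<Longrightarrow> Fract m m' = 0 \<longleftrightarrow> m = 0"
  by (simp add: Zero_fract_def eq_fract)


lemma inv_affine_Fract:
  assumes "m \<noteq> 0" "m' \<noteq> 0"
  shows "inv\<^bsub>affine_group\<^esub> (Fract n m', Fract m m') = (Fract (- n) m, Fract m' m)"
  using assms
  by (subst inv_affine_group) (simp_all add: Fract_eq_zero_iff divide_inverse eq_fract mult.commute)

lemma affine_group_cases:
  assumes "g \<in> carrier affine_group"
  obtains n m m' where "m \<noteq> 0" "m' \<noteq> 0" "g = (Fract n m', Fract m m')"
proof -
  obtain a b c d where g: "g = (Fract a b, Fract c d)" and bd: "b \<noteq> 0" "d \<noteq> 0"
    by (metis Fract_cases surj_pair)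
  then have "c \<noteq> 0" using assms by (simp add: Fract_eq_zero_iff)
  then show thesis
    using that[of "c * b" "b * d" "a * d"] bd g by (simp add: eq_fract mult.commute)
qed

lemma fract_unit: "m \<noteq> 0 \<Longrightarrow> Fract m 1 * Fract 1 m = 1"
  by (simp add: One_fract_def eq_fract)

locale affine_family = partial_representation A affine_group P
  for A :: "('a, 'm) star_algebra_scheme" (structure) and P :: "'r::idom fract \<times> 'r fract \<Rightarrow> 'a" +
  assumes P_translation: "P (Fract n 1, 1) \<otimes> P (inv\<^bsub>affine_group\<^esub> (Fract n 1, 1)) = \<one>"
    and P_dilation: "m \<noteq> 0 \<Longrightarrow> P (0, Fract 1 m) \<otimes> P (inv\<^bsub>affine_group\<^esub> (0, Fract 1 m)) = \<one>"
    and P_range_sum: "m \<noteq> 0 \<Longrightarrow> residue_choice m \<rho> \<Longrightarrow>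
      (\<Oplus>L\<in>residues m. P (Fract (\<rho> L) 1, Fract m 1) \<otimes>
        P (inv\<^bsub>affine_group\<^esub> (Fract (\<rho> L) 1, Fract m 1))) = \<one>"

lemma (in cstar_algebra) satisfies_affine_rels_iff:
  fixes \<phi> :: "'r::idom fract \<times> 'r fract \<Rightarrow> 'a"
  assumes \<phi>: "\<phi> \<in> carrier affine_group \<rightarrow> carrier A"
  shows "satisfies A \<phi> (partial_rels affine_group \<union> affine_rels) \<longleftrightarrow> affine_family A \<phi>"
proof -
  interpret G: group "affine_group :: ('r fract \<times> 'r fract) monoid" by (rule group_affine_group)
  have [simp]: "g \<in> carrier affine_group \<Longrightarrow> \<phi> g \<in> carrier A" for g using \<phi> by auto
  note [simp] = free_star_on_fgen free_star_on_mult free_star_on_sum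
  have proj: "proj affine_group g \<in> free_star_on (carrier affine_group)"
      "eval_poly A \<phi> (proj affine_group g) = \<phi> g \<otimes> \<phi> (inv\<^bsub>affine_group\<^esub> g)"
    if "g \<in> carrier affine_group" for g :: "'r fract \<times> 'r fract"
    using that by (simp_all add: proj_def eval_mult[OF \<phi>] eval_fgen[OF \<phi>])
  note ev = eval_diff_eq_zero_iff[OF \<phi>] eval_one[OF \<phi>] eval_sum[OF \<phi>] proj Fract_eq_zero_iff
  have 1: "(\<forall>r\<in>{proj affine_group (Fract n 1, 1) - 1 |n :: 'r. True}. eval_poly A \<phi> r = \<zero>) \<longleftrightarrow>
      (\<forall>n. \<phi> (Fract n 1, 1) \<otimes> \<phi> (inv\<^bsub>affine_group\<^esub> (Fract n 1, 1)) = \<one>)"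
    by (auto simp: ev)
  have 2: "(\<forall>r\<in>{proj affine_group (0, Fract 1 m) - 1 |m :: 'r. m \<noteq> 0}. eval_poly A \<phi> r = \<zero>) \<longleftrightarrow>
      (\<forall>m. m \<noteq> 0 \<longrightarrow> \<phi> (0, Fract 1 m) \<otimes> \<phi> (inv\<^bsub>affine_group\<^esub> (0, Fract 1 m)) = \<one>)"
    by (auto simp: ev)
  have 3: "(\<forall>r\<in>{(\<Sum>L\<in>residues m. proj affine_group (Fract (\<rho> L) 1, Fract m 1)) - 1 |m \<rho>.
        m \<noteq> (0 :: 'r) \<and> residue_choice m \<rho>}. eval_poly A \<phi> r = \<zero>) \<longleftrightarrow>
      (\<forall>m \<rho>. m \<noteq> 0 \<longrightarrow> residue_choice m \<rho> \<longrightarrow>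
        (\<Oplus>L\<in>residues m. \<phi> (Fract (\<rho> L) 1, Fract m 1) \<otimes>
          \<phi> (inv\<^bsub>affine_group\<^esub> (Fract (\<rho> L) 1, Fract m 1))) = \<one>)"
  proof -
    have "eval_poly A \<phi> ((\<Sum>L\<in>residues m. proj affine_group (Fract (\<rho> L) 1, Fract m 1)) - 1) = \<zero> \<longleftrightarrow>
        (\<Oplus>L\<in>residues m. \<phi> (Fract (\<rho> L) 1, Fract m 1) \<otimes>
          \<phi> (inv\<^bsub>affine_group\<^esub> (Fract (\<rho> L) 1, Fract m 1))) = \<one>"
      if "m \<noteq> 0" for m :: 'r and \<rho>
      using that by (simp add: ev)
    then show ?thesis by blast
  qed
  have "satisfies A \<phi> (partial_rels affine_group \<union> affine_rels) \<longleftrightarrow>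
      satisfies A \<phi> (partial_rels affine_group) \<and> satisfies A \<phi> affine_rels"
    unfolding satisfies_def by blast
  also have "satisfies A \<phi> (partial_rels affine_group) \<longleftrightarrow> partial_representation A affine_group \<phi>"
    by (rule satisfies_partial_rels_iff[OF group_affine_group \<phi>])
  finally show ?thesis
    unfolding satisfies_def affine_rels_def ball_Un 1 2 3 affine_family_def affine_family_axioms_def
    by simp
qed


context affine_family
begin

lemma P_translation_mult:
  assumes "w \<noteq> 0"
  shows "P (Fract n 1, 1) \<otimes> P (a, w) = P (Fract n 1 + a, w)"
    and "P (a, w) \<otimes> P (Fract n 1, 1) = P (a + Fract n 1 * w, w)"
proof -
  show "P (Fract n 1, 1) \<otimes> P (a, w) = P (Fract n 1 + a, w)"
    using P_mult_left[of "(Fract n 1, 1)" "(a, w)"] P_translation assms by simp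
  have "P (inv\<^bsub>affine_group\<^esub> (Fract n 1, 1)) \<otimes> P (Fract n 1, 1) = \<one>"
    using P_translation[of "- n"] by (simp add: inv_affine_group)
  then show "P (a, w) \<otimes> P (Fract n 1, 1) = P (a + Fract n 1 * w, w)"
    using P_mult_right[of "(a, w)" "(Fract n 1, 1)"] assms by simp
qed

lemma P_dilation_mult:
  assumes "w \<noteq> 0" "m \<noteq> 0"
  shows "P (a, w) \<otimes> P (0, Fract m 1) = P (a, w * Fract m 1)"
    and "P (0, Fract 1 m) \<otimes> P (a, w) = P (a * Fract 1 m, w * Fract 1 m)"
proof -
  have inv: "inv\<^bsub>affine_group\<^esub> (0, Fract 1 m) = (0, Fract m 1)" "inv\<^bsub>affine_group\<^esub> (0, Fract m 1) = (0, Fract 1 m)"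
    using assms(2) by (simp_all add: inv_affine_group Fract_eq_zero_iff divide_inverse)
  show "P (a, w) \<otimes> P (0, Fract m 1) = P (a, w * Fract m 1)"
    using P_mult_right[of "(a, w)" "(0, Fract m 1)"] P_dilation[of m] assms
    by (simp add: inv Fract_eq_zero_iff)
  show "P (0, Fract 1 m) \<otimes> P (a, w) = P (a * Fract 1 m, w * Fract 1 m)"
    using P_mult_left[of "(0, Fract 1 m)" "(a, w)"] P_dilation[of m] assms
    by (simp add: inv Fract_eq_zero_iff mult.commute)
qed

lemma adj_P_dilation: "m \<noteq> 0 \<Longrightarrow> adj A (P (0, Fract m 1)) = P (0, Fract 1 m)"
  using P_inv[of "(0, Fract m 1)"]
  by (simp add: inv_affine_group Fract_eq_zero_iff divide_inverse)

lemma adj_P_translation: "adj A (P (Fract n 1, 1)) = P (Fract (- n) 1, 1)"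
  using P_inv[of "(Fract n 1, 1)"] by (simp add: inv_affine_group)

text \<open>
  The group element is the product $(0,m')^{-1} (n,1) (0,m)$, on which \<open>P\<close> is
  multiplicative.  This identifies the formula for the inverse isomorphism.
\<close>

lemma P_Fract:
  assumes "m \<noteq> 0" "m' \<noteq> 0"
  shows "adj A (P (0, Fract m' 1)) \<otimes> P (Fract n 1, 1) \<otimes> P (0, Fract m 1) = P (Fract n m', Fract m m')"
  using assms
  by (simp add: adj_P_dilation P_translation_mult P_dilation_mult Fract_eq_zero_iff)

lemma P_zero: "P (0, 1) = \<one>"
  using P_one by (simp add: affine_one)

lemma ring_family_translations_dilations:
  "ring_family A (\<lambda>m. P (0, Fract m 1)) (\<lambda>n. P (Fract n 1, 1))"
proof
  fix m n :: 'r assume m: "m \<noteq> 0"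
  show "P (0, Fract m 1) \<in> carrier A" using m by (simp add: P_closed Fract_eq_zero_iff)
  show "adj A (P (0, Fract m 1)) \<otimes> P (0, Fract m 1) = \<one>"
    using m P_zero fract_unit[OF m]
    by (simp add: adj_P_dilation P_dilation_mult Fract_eq_zero_iff)
  show "P (0, Fract m 1) \<otimes> P (Fract n 1, 1) = P (Fract (m * n) 1, 1) \<otimes> P (0, Fract m 1)"
    using m by (simp add: P_translation_mult Fract_eq_zero_iff mult.commute)
next
  fix m m' :: 'r assume "m \<noteq> 0" "m' \<noteq> 0"
  then show "P (0, Fract m 1) \<otimes> P (0, Fract m' 1) = P (0, Fract (m * m') 1)"
    by (simp add: P_dilation_mult Fract_eq_zero_iff)
next
  fix n :: 'r
  show "P (Fract n 1, 1) \<in> carrier A" by (simp add: P_closed)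
  show "adj A (P (Fract n 1, 1)) \<otimes> P (Fract n 1, 1) = \<one>"
    "P (Fract n 1, 1) \<otimes> adj A (P (Fract n 1, 1)) = \<one>"
    using P_zero[unfolded Zero_fract_def] by (simp_all add: adj_P_translation P_translation_mult)
next
  fix n n' :: 'r
  show "P (Fract n 1, 1) \<otimes> P (Fract n' 1, 1) = P (Fract (n + n') 1, 1)"
    by (simp add: P_translation_mult)
next
  fix m :: 'r and \<rho> assume m: "m \<noteq> 0" and \<rho>: "residue_choice m \<rho>"
  have "P (Fract x 1, 1) \<otimes> P (0, Fract m 1) \<otimes> adj A (P (0, Fract m 1)) \<otimes> P (Fract (- x) 1, 1) =
      P (Fract x 1, Fract m 1) \<otimes> P (inv\<^bsub>affine_group\<^esub> (Fract x 1, Fract m 1))" for x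
  proof -
    have "P (Fract x 1, 1) \<otimes> P (0, Fract m 1) \<otimes> adj A (P (0, Fract m 1)) \<otimes> P (Fract (- x) 1, 1) =
      (P (Fract x 1, 1) \<otimes> P (0, Fract m 1)) \<otimes> (P (0, Fract 1 m) \<otimes> P (Fract (- x) 1, 1))"
      using m by (simp add: adj_P_dilation m_assoc P_closed Fract_eq_zero_iff)
    then show ?thesis
      using m by (simp add: P_translation_mult Fract_eq_zero_iff inv_affine_Fract)
  qed
  then show "(\<Oplus>L\<in>residues m. P (Fract (\<rho> L) 1, 1) \<otimes> P (0, Fract m 1) \<otimes>
      adj A (P (0, Fract m 1)) \<otimes> P (Fract (- \<rho> L) 1, 1)) = \<one>"
    using P_range_sum[OF m \<rho>] by simp
qed

end

section \<open>Fractions form a partial representation of the affine group\<close>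

context ring_family
begin

definition fraction :: "'r \<Rightarrow> 'r \<Rightarrow> 'r \<Rightarrow> 'a" where
  "fraction n m m' = adj A (s m') \<otimes> u n \<otimes> s m"

lemma fraction_v: "m \<noteq> 0 \<Longrightarrow> m' \<noteq> 0 \<Longrightarrow> fraction n m m' = adj A (v 0 m') \<otimes> v n m"
  by (simp add: fraction_def v_def u_zero s_closed u_closed adj_closed m_assoc)

lemma fraction_closed [simp]: "m \<noteq> 0 \<Longrightarrow> m' \<noteq> 0 \<Longrightarrow> fraction n m m' \<in> carrier A"
  by (simp add: fraction_v)

text \<open>A common factor \<open>c\<close> contributes \<open>adj A (s c) \<otimes> s c\<close>, which is one.\<close>

lemma fraction_expand:
  assumes "m \<noteq> 0" "m' \<noteq> 0" "c \<noteq> 0"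
  shows "fraction (c * n) (c * m) (c * m') = fraction n m m'"
proof -
  have "v 0 (c * m') = v 0 c \<otimes> v 0 m'" "v (c * n) (c * m) = v 0 c \<otimes> v n m"
    using assms by (simp_all add: v_mult)
  then show ?thesis
    using assms by (simp add: fraction_v adj_mult m_assoc v_isometry_cancel)
qed

lemma fraction_cong:
  assumes nz: "m \<noteq> 0" "m' \<noteq> 0" "k \<noteq> 0" "k' \<noteq> 0"
    and eq: "Fract n m' = Fract l k'" "Fract m m' = Fract k k'"
  shows "fraction n m m' = fraction l k k'"
proof -
  have "k' * n = m' * l" "k' * m = m' * k"
    using eq nz by (simp_all add: eq_fract mult.commute)
  then have "fraction (k' * n) (k' * m) (k' * m') = fraction (m' * l) (m' * k) (m' * k')"
    by (simp add: mult.commute)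
  then show ?thesis using nz by (simp add: fraction_expand)
qed

lemma adj_fraction: "m \<noteq> 0 \<Longrightarrow> m' \<noteq> 0 \<Longrightarrow> adj A (fraction n m m') = fraction (- n) m' m"
  by (simp add: fraction_def adj_mult u_uminus adj_adj s_closed u_closed adj_closed m_assoc)

text \<open>
  The choice of a representation of \<open>g\<close> by ring elements is immaterial, by
  \<open>fraction_cong\<close>.
\<close>

definition fraction_map :: "'r fract \<times> 'r fract \<Rightarrow> 'a" where
  "fraction_map g = (SOME y. \<exists>n m m'. m \<noteq> 0 \<and> m' \<noteq> 0 \<and> g = (Fract n m', Fract m m') \<and> y = fraction n m m')"

lemma fraction_map_Fract:
  assumes "m \<noteq> 0" "m' \<noteq> 0"
  shows "fraction_map (Fract n m', Fract m m') = fraction n m m'"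
  unfolding fraction_map_def
proof (rule some_equality)
  show "\<exists>l k k'. k \<noteq> 0 \<and> k' \<noteq> 0 \<and> (Fract n m', Fract m m') = (Fract l k', Fract k k') \<and>
      fraction n m m' = fraction l k k'"
    using assms by blast
next
  fix y
  assume "\<exists>l k k'. k \<noteq> 0 \<and> k' \<noteq> 0 \<and> (Fract n m', Fract m m') = (Fract l k', Fract k k') \<and> y = fraction l k k'"
  then show "y = fraction n m m'" using fraction_cong[OF assms] by auto
qed

lemma fraction_map_closed: "g \<in> carrier affine_group \<Longrightarrow> fraction_map g \<in> carrier A"
  by (elim affine_group_cases) (simp add: fraction_map_Fract)

end

context finite_ring_family
begin

text \<open>
  The partial multiplicativity relation for $g = (a/d, b/d)$ and $h = (x/y, z/y)$, with
  $h^{-1} = (-x/z, y/z)$.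
\<close>

lemma fraction_mult:
  assumes nz: "b \<noteq> 0" "d \<noteq> 0" "z \<noteq> 0" "y \<noteq> 0"
  shows "fraction a b d \<otimes> fraction x z y \<otimes> fraction (- x) y z =
    fraction (y * a + b * x) (b * z) (d * y) \<otimes> fraction (- x) y z"
proof -
  let ?D = "adj A (v 0 d)" and ?Y = "adj A (v 0 y)" and ?W = "v (y * a) b"
    and ?V = "v x z"
  \<comment> \<open>Moving \<open>?Y\<close> to the front costs the projection \<open>range_proj 0 y\<close>.\<close>
  have slide: "v a b \<otimes> ?Y = ?Y \<otimes> (?W \<otimes> range_proj 0 y)"
  proof -
    have "v a b \<otimes> ?Y = ?Y \<otimes> ((v 0 y \<otimes> v a b) \<otimes> ?Y)"
      using nz by (simp add: m_assoc v_isometry_cancel)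
    also have "v 0 y \<otimes> v a b = ?W \<otimes> v 0 y"
      using nz by (simp add: v_mult mult.commute)
    finally show ?thesis using nz by (simp add: range_proj_def m_assoc)
  qed
  \<comment> \<open>That projection disappears next to the fraction of the inverse of \<open>h\<close>; this is where
    commutation of range projections enters.\<close>
  have absorb: "range_proj 0 y \<otimes> (?V \<otimes> (adj A ?V \<otimes> v 0 y)) = ?V \<otimes> (adj A ?V \<otimes> v 0 y)"
  proof -
    have "range_proj 0 y \<otimes> (?V \<otimes> (adj A ?V \<otimes> v 0 y)) = (range_proj 0 y \<otimes> range_proj x z) \<otimes> v 0 y"
      using nz by (simp add: range_proj_def m_assoc)
    also have "\<dots> = range_proj x z \<otimes> (range_proj 0 y \<otimes> v 0 y)"
      using nz by (simp add: range_proj_commute[of y z] m_assoc)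
    also have "range_proj 0 y \<otimes> v 0 y = v 0 y"
      using nz by (simp add: range_proj_def m_assoc v_isometry)
    finally show ?thesis using nz by (simp add: range_proj_def m_assoc)
  qed
  have inv: "fraction (- x) y z = adj A ?V \<otimes> v 0 y"
    using nz by (simp add: adj_fraction[symmetric]) (simp add: fraction_v adj_mult adj_adj)
  have "fraction a b d \<otimes> fraction x z y \<otimes> fraction (- x) y z =
      ?D \<otimes> ((v a b \<otimes> ?Y) \<otimes> (?V \<otimes> (adj A ?V \<otimes> v 0 y)))"
    unfolding inv using nz by (simp add: fraction_v m_assoc)
  also have "\<dots> = ?D \<otimes> (?Y \<otimes> (?W \<otimes> (range_proj 0 y \<otimes> (?V \<otimes> (adj A ?V \<otimes> v 0 y)))))"
    unfolding slide using nz by (simp add: m_assoc)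
  also have "\<dots> = (?D \<otimes> ?Y) \<otimes> ((?W \<otimes> ?V) \<otimes> (adj A ?V \<otimes> v 0 y))"
    unfolding absorb using nz by (simp add: m_assoc)
  also have "?D \<otimes> ?Y = adj A (v 0 (d * y))"
    using nz by (simp add: adj_mult[symmetric] v_mult mult.commute)
  also have "?W \<otimes> ?V = v (y * a + b * x) (b * z)"
    using nz by (simp add: v_mult)
  finally show ?thesis
    unfolding inv using nz by (simp add: fraction_v m_assoc)
qed

lemma affine_family_fraction_map: "affine_family A fraction_map"
proof -
  have one: "fraction_map (0, 1) = \<one>"
    using fraction_map_Fract[of 1 1 0]
    by (simp add: Zero_fract_def[symmetric] One_fract_def[symmetric] fraction_def s_one u_zero adj_one)
  have inv: "fraction_map (inv\<^bsub>affine_group\<^esub> g) = adj A (fraction_map g)"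
    if "g \<in> carrier affine_group" for g
    using that
    by (elim affine_group_cases) (simp add: inv_affine_Fract fraction_map_Fract adj_fraction)
  have partial: "fraction_map g \<otimes> fraction_map h \<otimes> fraction_map (inv\<^bsub>affine_group\<^esub> h) =
      fraction_map (g \<otimes>\<^bsub>affine_group\<^esub> h) \<otimes> fraction_map (inv\<^bsub>affine_group\<^esub> h)"
    if g: "g \<in> carrier affine_group" and h: "h \<in> carrier affine_group" for g h
  proof -
    obtain a b d where gd: "b \<noteq> 0" "d \<noteq> 0" "g = (Fract a d, Fract b d)"
      using g by (rule affine_group_cases)
    obtain x z y where hd: "z \<noteq> 0" "y \<noteq> 0" "h = (Fract x y, Fract z y)"
      using h by (rule affine_group_cases)
    have "g \<otimes>\<^bsub>affine_group\<^esub> h = (Fract (y * a + b * x) (d * y), Fract (b * z) (d * y))"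
      using gd hd by (simp add: eq_fract algebra_simps)
    then show ?thesis
      using gd hd by (simp add: inv_affine_Fract fraction_map_Fract fraction_mult)
  qed
  have translation: "fraction_map (Fract n 1, 1) = u n" for n
    using fraction_map_Fract[of 1 1 n]
    by (simp add: One_fract_def[symmetric] fraction_def s_one adj_one u_closed)
  have "fraction_map (Fract n 1, 1) \<otimes> fraction_map (inv\<^bsub>affine_group\<^esub> (Fract n 1, 1)) = \<one>" for n
    by (simp add: inv translation u_unitary)
  moreover have "fraction_map (0, Fract 1 m) \<otimes> fraction_map (inv\<^bsub>affine_group\<^esub> (0, Fract 1 m)) = \<one>"
    if m: "m \<noteq> 0" for m
  proof -
    have "fraction_map (0, Fract 1 m) = fraction 0 1 m"
      using fraction_map_Fract[of 1 m 0] m by (simp add: fract_collapse)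
    then show ?thesis
      using m s_isometry[OF m]
      by (simp add: inv Fract_eq_zero_iff) (simp add: fraction_def s_one u_zero adj_adj adj_closed s_closed)
  qed
  moreover have "(\<Oplus>L\<in>residues m. fraction_map (Fract (\<rho> L) 1, Fract m 1) \<otimes>
      fraction_map (inv\<^bsub>affine_group\<^esub> (Fract (\<rho> L) 1, Fract m 1))) = \<one>"
    if m: "m \<noteq> 0" and \<rho>: "residue_choice m \<rho>" for m \<rho>
  proof -
    have "fraction_map (Fract x 1, Fract m 1) \<otimes>
        fraction_map (inv\<^bsub>affine_group\<^esub> (Fract x 1, Fract m 1)) = range_proj x m" for x
    proof -
      have "fraction_map (Fract x 1, Fract m 1) = v x m"
        using m fraction_map_Fract[of m 1 x]
        by (simp add: fraction_def v_def s_one adj_one u_closed)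
      then show ?thesis using m by (simp add: inv Fract_eq_zero_iff range_proj_def)
    qed
    then show ?thesis using sum_range_proj[OF m \<rho>] by simp
  qed
  ultimately show ?thesis
    by (intro affine_family.intro partial_representation.intro partial_representation_axioms.intro
        affine_family_axioms.intro cstar_algebra_axioms group_affine_group fraction_map_closed inv partial)
      (simp_all add: affine_one one)
qed

end

section \<open>The isomorphism\<close>

lemma star_hom_id: "(\<lambda>x. x) \<in> star_hom A A"
  by (simp add: star_hom_def ring_hom_def)

lemma star_hom_compose:
  assumes "h \<in> star_hom A B" "k \<in> star_hom B C"
  shows "(\<lambda>x. k (h x)) \<in> star_hom A C"
  using star_homD[OF assms(1)] star_homD[OF assms(2)]
  by (auto simp: star_hom_def intro!: ring_hom_memI)

lemma univ_cstar_inverse_homs: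
  assumes X: "bounded_presentation X Rel" "Rel \<subseteq> free_star_on X"
    and Y: "bounded_presentation Y Rel'" "Rel' \<subseteq> free_star_on Y"
    and h: "h \<in> star_hom (univ_cstar X Rel) (univ_cstar Y Rel')"
    and k: "k \<in> star_hom (univ_cstar Y Rel') (univ_cstar X Rel)"
    and kh: "\<And>x. x \<in> X \<Longrightarrow> k (h (univ_gen X Rel x)) = univ_gen X Rel x"
    and hk: "\<And>y. y \<in> Y \<Longrightarrow> h (k (univ_gen Y Rel' y)) = univ_gen Y Rel' y"
  shows "a \<in> carrier (univ_cstar X Rel) \<Longrightarrow> k (h a) = a"
    and "b \<in> carrier (univ_cstar Y Rel') \<Longrightarrow> h (k b) = b"
    and "h \<in> star_iso (univ_cstar X Rel) (univ_cstar Y Rel')"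
    and "k \<in> star_iso (univ_cstar Y Rel') (univ_cstar X Rel)"
proof -
  show kh': "k (h a) = a" if "a \<in> carrier (univ_cstar X Rel)" for a
    by (rule univ_cstar_hom_eqI[OF X cstar_univ_cstar[OF X(1)] star_hom_compose[OF h k] star_hom_id])
      (use kh that in auto)
  show hk': "h (k b) = b" if "b \<in> carrier (univ_cstar Y Rel')" for b
    by (rule univ_cstar_hom_eqI[OF Y cstar_univ_cstar[OF Y(1)] star_hom_compose[OF k h] star_hom_id])
      (use hk that in auto)
  have "bij_betw h (carrier (univ_cstar X Rel)) (carrier (univ_cstar Y Rel'))"
    by (rule bij_betw_byWitness[where f' = k]) (use kh' hk' star_homD(1)[OF h] star_homD(1)[OF k] in auto)
  then show "h \<in> star_iso (univ_cstar X Rel) (univ_cstar Y Rel')"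
    using h by (simp add: star_iso_def)
  have "bij_betw k (carrier (univ_cstar Y Rel')) (carrier (univ_cstar X Rel))"
    by (rule bij_betw_byWitness[where f' = h]) (use kh' hk' star_homD(1)[OF h] star_homD(1)[OF k] in auto)
  then show "k \<in> star_iso (univ_cstar Y Rel') (univ_cstar X Rel)"
    using k by (simp add: star_iso_def)
qed

theorem theorem3p6:
  assumes "\<And>m::'r::idom. m \<noteq> 0 \<Longrightarrow> finite (residues m)"
  defines "A \<equiv> ring_cstar :: (nat \<Rightarrow> 'r ring_gen free_star) set star_algebra"
    and "C \<equiv> partial_cstar affine_group (affine_rels :: ('r fract \<times> 'r fract) free_star set)"
    and "g \<equiv> partial_gen affine_group (affine_rels :: ('r fract \<times> 'r fract) free_star set)"
  shows "\<exists>\<Psi> \<Phi>.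
    \<Psi> \<in> star_iso A C \<and>
    (\<forall>n. \<Psi> (unitary n) = g (Fract n 1, 1)) \<and>
    (\<forall>m. m \<noteq> 0 \<longrightarrow> \<Psi> (isom m) = g (0, Fract m 1)) \<and>
    (\<forall>\<Psi>'\<in>star_hom A C.
       (\<forall>n. \<Psi>' (unitary n) = g (Fract n 1, 1)) \<and>
       (\<forall>m. m \<noteq> 0 \<longrightarrow> \<Psi>' (isom m) = g (0, Fract m 1)) \<longrightarrow>
       (\<forall>x\<in>carrier A. \<Psi>' x = \<Psi> x)) \<and>
    \<Phi> \<in> star_iso C A \<and>
    (\<forall>x\<in>carrier A. \<Phi> (\<Psi> x) = x) \<and>
    (\<forall>y\<in>carrier C. \<Psi> (\<Phi> y) = y) \<and>
    (\<forall>n m m'. m \<noteq> 0 \<and> m' \<noteq> 0 \<longrightarrow>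
       \<Phi> (g (Fract n m', Fract m m')) =
         adj A (isom m') \<otimes>\<^bsub>A\<^esub> unitary n \<otimes>\<^bsub>A\<^esub> isom m)"
proof -
  let ?G = "affine_group :: ('r fract \<times> 'r fract) monoid"
  let ?R = "partial_rels ?G \<union> affine_rels"
  have pres_A: "bounded_presentation ring_gens (ring_rels :: 'r ring_gen free_star set)"
      "ring_rels \<subseteq> free_star_on (ring_gens :: 'r ring_gen set)"
    by (rule bounded_ring_rels, rule ring_rels_subset)
  have pres_C: "bounded_presentation (carrier ?G) ?R" "?R \<subseteq> free_star_on (carrier ?G)"
    using bounded_partial_rels[OF group_affine_group] partial_rels_subset[OF group_affine_group]
      affine_rels_subset by auto
  have A: "A = univ_cstar ring_gens ring_rels" by (simp add: A_def ring_cstar_def)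
  have C: "C = univ_cstar (carrier ?G) ?R" by (simp add: C_def partial_cstar_def)
  have g: "g = univ_gen (carrier ?G) ?R"
    by (simp add: g_def partial_gen_def fun_eq_iff)
  interpret A: cstar_algebra A unfolding A by (rule cstar_univ_cstar[OF pres_A(1)])
  interpret C: cstar_algebra C unfolding C by (rule cstar_univ_cstar[OF pres_C(1)])

  have g_closed: "g \<in> carrier ?G \<rightarrow> carrier C" unfolding g C by (rule univ_gen_closed[OF pres_C])
  interpret C: affine_family C g
    using univ_cstar_satisfies[OF pres_C] C.satisfies_affine_rels_iff[OF g_closed]
    unfolding g C by simp
  have gen_closed: "univ_gen ring_gens (ring_rels :: 'r ring_gen free_star set) \<in> ring_gens \<rightarrow> carrier A"
    unfolding A by (rule univ_gen_closed[OF pres_A])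
  have "ring_family A isom (unitary :: 'r \<Rightarrow> _)"
    using univ_cstar_satisfies[OF pres_A] A.satisfies_ring_rels_iff[OF gen_closed]
    unfolding A isom_def unitary_def by simp
  then interpret A: finite_ring_family A isom "unitary :: 'r \<Rightarrow> _"
    using assms(1) by (intro finite_ring_family.intro finite_ring_family_axioms.intro)

  define \<psi> where "\<psi> = case_ring_gen (\<lambda>m :: 'r. g (0, Fract m 1)) (\<lambda>n. g (Fract n 1, 1))"
  have \<psi>: "\<psi> \<in> ring_gens \<rightarrow> carrier C"
    by (auto simp: \<psi>_def ring_gens_def Fract_eq_zero_iff intro!: C.P_closed)
  have "satisfies C \<psi> ring_rels"
    using C.ring_family_translations_dilations by (simp add: C.satisfies_ring_rels_iff[OF \<psi>]) (simp add: \<psi>_def)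
  from univ_cstar_universal[OF pres_A C.cstar_algebra_axioms \<psi> this]
  obtain \<Psi> where \<Psi>: "\<Psi> \<in> star_hom A C"
    and \<Psi>_gen: "\<And>x. x \<in> ring_gens \<Longrightarrow> \<Psi> (univ_gen ring_gens ring_rels x) = \<psi> x"
    unfolding A by blast
  have \<Psi>_u: "\<Psi> (unitary n) = g (Fract n 1, 1)" for n
    using \<Psi>_gen[of "Uni n"] by (simp add: ring_gens_def unitary_def \<psi>_def)
  have \<Psi>_s: "\<Psi> (isom m) = g (0, Fract m 1)" if "m \<noteq> 0" for m
    using \<Psi>_gen[of "Iso m"] that by (simp add: ring_gens_def isom_def \<psi>_def)

  have frac: "A.fraction_map \<in> carrier ?G \<rightarrow> carrier A"
    by (simp add: A.fraction_map_closed)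
  have "satisfies A A.fraction_map ?R"
    using A.affine_family_fraction_map by (simp add: A.satisfies_affine_rels_iff[OF frac])
  from univ_cstar_universal[OF pres_C A.cstar_algebra_axioms frac this]
  obtain \<Phi> where \<Phi>: "\<Phi> \<in> star_hom C A"
    and \<Phi>_gen: "\<And>x. x \<in> carrier ?G \<Longrightarrow> \<Phi> (g x) = A.fraction_map x"
    unfolding C g by blast
  have \<Phi>_fraction: "\<Phi> (g (Fract n m', Fract m m')) = adj A (isom m') \<otimes>\<^bsub>A\<^esub> unitary n \<otimes>\<^bsub>A\<^esub> isom m"
    if "m \<noteq> 0" "m' \<noteq> 0" for n m m'
    using that by (simp add: \<Phi>_gen Fract_eq_zero_iff A.fraction_map_Fract A.fraction_def)

  have \<Phi>\<Psi>: "\<Phi> (\<Psi> (univ_gen ring_gens ring_rels x)) = univ_gen ring_gens ring_rels x"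
    if x: "x \<in> ring_gens" for x
  proof (cases x)
    case (Iso m)
    then have m: "m \<noteq> 0" using x by (auto simp: ring_gens_def)
    have "\<Phi> (g (0, Fract m 1)) = isom m"
      using \<Phi>_fraction[of m 1 0] m
      by (simp add: fract_collapse A.s_one A.u_zero A.adj_one A.s_closed)
    then show ?thesis using \<Psi>_s[OF m] Iso by (simp add: isom_def)
  next
    case (Uni n)
    have "\<Phi> (g (Fract n 1, 1)) = unitary n"
      using \<Phi>_fraction[of 1 1 n] by (simp add: fract_collapse A.s_one A.adj_one A.u_closed)
    then show ?thesis using \<Psi>_u[of n] Uni by (simp add: unitary_def)
  qed
  have \<Psi>\<Phi>: "\<Psi> (\<Phi> (g y)) = g y" if y_in: "y \<in> carrier ?G" for y
  proof -
    obtain n m m' where y: "m \<noteq> 0" "m' \<noteq> 0" "y = (Fract n m', Fract m m')"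
      using y_in by (rule affine_group_cases)
    have "\<Psi> (\<Phi> (g y)) = adj C (g (0, Fract m' 1)) \<otimes>\<^bsub>C\<^esub> g (Fract n 1, 1) \<otimes>\<^bsub>C\<^esub> g (0, Fract m 1)"
      using y by (simp add: \<Phi>_fraction star_homD[OF \<Psi>] A.adj_closed A.s_closed A.u_closed \<Psi>_u \<Psi>_s)
    then show ?thesis using y by (simp add: C.P_Fract)
  qed
  note inverse = univ_cstar_inverse_homs[OF pres_A pres_C, folded A C g, OF \<Psi> \<Phi> \<Phi>\<Psi> \<Psi>\<Phi>]

  have unique: "\<Psi>' x = \<Psi> x"
    if \<Psi>': "\<Psi>' \<in> star_hom A C" "\<And>n. \<Psi>' (unitary n) = g (Fract n 1, 1)"
      "\<And>m. m \<noteq> 0 \<Longrightarrow> \<Psi>' (isom m) = g (0, Fract m 1)" and x: "x \<in> carrier A" for \<Psi>' x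
  proof (rule univ_cstar_hom_eqI[OF pres_A C.cstar_algebra_axioms, folded A, OF \<Psi>'(1) \<Psi> _ x])
    fix y :: "'r ring_gen" assume "y \<in> ring_gens"
    then show "\<Psi>' (univ_gen ring_gens ring_rels y) = \<Psi> (univ_gen ring_gens ring_rels y)"
      using \<Psi>'(2,3) \<Psi>_u \<Psi>_s by (auto simp: ring_gens_def isom_def unitary_def)
  qed
  show ?thesis
    by (intro exI[of _ \<Psi>] exI[of _ \<Phi>] conjI ballI allI impI)
      (simp_all add: inverse(1,2) inverse(3,4) \<Psi>_u \<Psi>_s \<Phi>_fraction unique)
qed

end
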